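(* There is a randomized algorithm which, given as input a directed acyclic graph $G=(V,E)$, failure probabilities $\mathbf{q}=(q_e)_{e\in E}\in[0,1]^E$, two vertices $s,t\in V$, and $\varepsilon>0$, outputs a $(1\pm\varepsilon)$-approximation to the $s-t$ reliability $R_{G,\mathbf{q}}(s,t)$ with probability at least $3/4$, in time $\widetilde{O}\big(n^{6}m^4\max\{m^4,\varepsilon^{-4}\}\big)$, where $n=|V|$, $m=|E|$, and $\widetilde{O}$ hides $\mathrm{polylog}(n/\varepsilon)$ factors.
   Context: For a directed graph $G=(V,E)$ with failure probabilities $q_e\in[0,1]$, let $\mathcal{G}=(V,\mathcal{E})$ be the random spanning subgraph in which each edge $e\in E$ is included in $\mathcal{E}$ independently with probability $1-q_e$. The $s-t$ reliability is $R_{G,\mathbf{q}}(s,t)=\Pr[\text{there is a directed path from } s \text{ to } t \text{ in } \mathcal{G}]$. A $(1\pm\varepsilon)$-approximation to a quantity $R$ is a number $\widetilde R$ with $(1-\varepsilon)R\le \widetilde R\le(1+\varepsilon)R$. The paper assumes (without loss of generality) that every vertex other than $s$ has at least one incoming edge, so that $m\ge n-1$. *)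

theory Defs
  imports "HOL-Probability.Probability" "Graph_Theory.Graph_Theory"
begin

section \<open>Two-terminal reliability\<close>

definition dag :: "'a pair_pre_digraph \<Rightarrow> bool" where
  "dag G \<longleftrightarrow> pair_fin_digraph G \<and> (\<nexists>c. pre_digraph.cycle (with_proj G) c)"

definition random_subgraph ::
  "'a pair_pre_digraph \<Rightarrow> ('a \<times> 'a \<Rightarrow> real) \<Rightarrow> 'a pair_pre_digraph pmf" where
  "random_subgraph G q =
     map_pmf (\<lambda>X. \<lparr>pverts = pverts G, parcs = {e \<in> parcs G. X e}\<rparr>)
       (Pi_pmf (parcs G) False (\<lambda>e. bernoulli_pmf (1 - q e)))"

definition reliability ::
  "'a pair_pre_digraph \<Rightarrow> ('a \<times> 'a \<Rightarrow> real) \<Rightarrow> 'a \<Rightarrow> 'a \<Rightarrow> real" where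
  "reliability G q s t =
     measure_pmf.prob (random_subgraph G q) {H. \<exists>p. pre_digraph.apath (with_proj H) s p t}"

definition approximates :: "real \<Rightarrow> real \<Rightarrow> real \<Rightarrow> bool" where
  "approximates \<epsilon> r r' \<longleftrightarrow> (1 - \<epsilon>) * r \<le> r' \<and> r' \<le> (1 + \<epsilon>) * r"

section \<open>Randomized algorithms: a probabilistic real RAM\<close>

text \<open>
  The failure probabilities are arbitrary reals and the running time does not depend on their
  representation, so time is counted on a real RAM with unit-cost exact arithmetic and comparisons
  on reals and unit-cost biased coins. Two features keep the model from being too strong.
  There is no way back from reals to natural numbers (no rounding), and a program contains no real
  constants, only natural numbers that can be converted. Natural numbers, which serve as addresses
  and counters, support addition and truncated subtraction only, as in the classical unit-cost
  RAM; multiplication has to be programmed.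
  An algorithm is a single finite program, independent of the input.
\<close>

record state =
  ireg :: "nat \<Rightarrow> nat"
  rreg :: "nat \<Rightarrow> real"
  imem :: "nat \<Rightarrow> nat"
  rmem :: "nat \<Rightarrow> real"

text \<open>Registers are addressed by constants in the program; the two memories are addressed
  indirectly, through the contents of an index register.\<close>

datatype instr =
    IConst nat nat
  | IAdd nat nat nat
  | ISub nat nat nat
  | ILoad nat nat
  | IStore nat nat
  | ROfNat nat nat
  | RAdd nat nat nat
  | RSub nat nat nat
  | RMul nat nat nat
  | RDiv nat nat nat
  | RLoad nat nat
  | RStore nat nat
  | Flip nat nat

fun exec :: "instr \<Rightarrow> state \<Rightarrow> state pmf" where
  "exec (IConst d c) \<sigma> = return_pmf (\<sigma>\<lparr>ireg := (ireg \<sigma>)(d := c)\<rparr>)"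
| "exec (IAdd d a b) \<sigma> = return_pmf (\<sigma>\<lparr>ireg := (ireg \<sigma>)(d := ireg \<sigma> a + ireg \<sigma> b)\<rparr>)"
| "exec (ISub d a b) \<sigma> = return_pmf (\<sigma>\<lparr>ireg := (ireg \<sigma>)(d := ireg \<sigma> a - ireg \<sigma> b)\<rparr>)"
| "exec (ILoad d a) \<sigma> = return_pmf (\<sigma>\<lparr>ireg := (ireg \<sigma>)(d := imem \<sigma> (ireg \<sigma> a))\<rparr>)"
| "exec (IStore a b) \<sigma> = return_pmf (\<sigma>\<lparr>imem := (imem \<sigma>)(ireg \<sigma> a := ireg \<sigma> b)\<rparr>)"
| "exec (ROfNat d a) \<sigma> = return_pmf (\<sigma>\<lparr>rreg := (rreg \<sigma>)(d := real (ireg \<sigma> a))\<rparr>)"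
| "exec (RAdd d a b) \<sigma> = return_pmf (\<sigma>\<lparr>rreg := (rreg \<sigma>)(d := rreg \<sigma> a + rreg \<sigma> b)\<rparr>)"
| "exec (RSub d a b) \<sigma> = return_pmf (\<sigma>\<lparr>rreg := (rreg \<sigma>)(d := rreg \<sigma> a - rreg \<sigma> b)\<rparr>)"
| "exec (RMul d a b) \<sigma> = return_pmf (\<sigma>\<lparr>rreg := (rreg \<sigma>)(d := rreg \<sigma> a * rreg \<sigma> b)\<rparr>)"
| "exec (RDiv d a b) \<sigma> = return_pmf (\<sigma>\<lparr>rreg := (rreg \<sigma>)(d := rreg \<sigma> a / rreg \<sigma> b)\<rparr>)"
| "exec (RLoad d a) \<sigma> = return_pmf (\<sigma>\<lparr>rreg := (rreg \<sigma>)(d := rmem \<sigma> (ireg \<sigma> a))\<rparr>)"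
| "exec (RStore a b) \<sigma> = return_pmf (\<sigma>\<lparr>rmem := (rmem \<sigma>)(ireg \<sigma> a := rreg \<sigma> b)\<rparr>)"
| "exec (Flip d a) \<sigma> =
     map_pmf (\<lambda>b. \<sigma>\<lparr>ireg := (ireg \<sigma>)(d := (if b then 1 else 0))\<rparr>) (bernoulli_pmf (rreg \<sigma> a))"

text \<open>The library clamps the parameter of \<^const>\<open>bernoulli_pmf\<close> to the unit interval.\<close>

datatype test = ILess nat nat | ILe nat nat | RLess nat nat | RLe nat nat

fun holds :: "test \<Rightarrow> state \<Rightarrow> bool" where
  "holds (ILess a b) \<sigma> \<longleftrightarrow> ireg \<sigma> a < ireg \<sigma> b"
| "holds (ILe a b) \<sigma> \<longleftrightarrow> ireg \<sigma> a \<le> ireg \<sigma> b"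
| "holds (RLess a b) \<sigma> \<longleftrightarrow> rreg \<sigma> a < rreg \<sigma> b"
| "holds (RLe a b) \<sigma> \<longleftrightarrow> rreg \<sigma> a \<le> rreg \<sigma> b"

datatype prog =
    Skip
  | Do instr
  | Seq prog prog
  | Cond test prog prog
  | While test prog

primrec step :: "prog \<Rightarrow> state \<Rightarrow> (prog \<times> state) pmf" where
  "step Skip \<sigma> = return_pmf (Skip, \<sigma>)"
| "step (Do i) \<sigma> = map_pmf (Pair Skip) (exec i \<sigma>)"
| "step (Seq P Q) \<sigma> =
     (if P = Skip then return_pmf (Q, \<sigma>)
      else map_pmf (\<lambda>(P', \<sigma>'). (Seq P' Q, \<sigma>')) (step P \<sigma>))"
| "step (Cond b P Q) \<sigma> = return_pmf (if holds b \<sigma> then P else Q, \<sigma>)"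
| "step (While b P) \<sigma> = return_pmf (if holds b \<sigma> then Seq P (While b P) else Skip, \<sigma>)"

primrec run :: "nat \<Rightarrow> prog \<Rightarrow> state \<Rightarrow> (prog \<times> state) pmf" where
  "run 0 P \<sigma> = return_pmf (P, \<sigma>)"
| "run (Suc k) P \<sigma> = bind_pmf (step P \<sigma>) (\<lambda>(P', \<sigma>'). run k P' \<sigma>')"

text \<open>Worst case over all coin flips: every computation reaches \<^const>\<open>Skip\<close>, where it stays
  forever, after at most \<open>T\<close> steps.\<close>

definition halts_within :: "nat \<Rightarrow> prog \<Rightarrow> state \<Rightarrow> bool" where
  "halts_within T P \<sigma> \<longleftrightarrow> (\<forall>(P', \<sigma>') \<in> set_pmf (run T P \<sigma>). P' = Skip)"

definition output_pmf :: "nat \<Rightarrow> prog \<Rightarrow> state \<Rightarrow> real pmf" where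
  "output_pmf T P \<sigma> = map_pmf (\<lambda>(P', \<sigma>'). rreg \<sigma>' 0) (run T P \<sigma>)"

section \<open>Input encoding\<close>

text \<open>The input is given as a list of edges, in arbitrary order, whose endpoints are named
  by an arbitrary numbering of the vertices with the numbers below \<open>|V|\<close>.\<close>

definition is_presentation ::
  "'a pair_pre_digraph \<Rightarrow> ('a \<Rightarrow> nat) \<Rightarrow> ('a \<times> 'a) list \<Rightarrow> bool" where
  "is_presentation G num es \<longleftrightarrow>
     bij_betw num (pverts G) {..<card (pverts G)} \<and> distinct es \<and> set es = parcs G"

definition input_state ::
  "'a pair_pre_digraph \<Rightarrow> ('a \<Rightarrow> nat) \<Rightarrow> ('a \<times> 'a) list \<Rightarrow> ('a \<times> 'a \<Rightarrow> real)
    \<Rightarrow> 'a \<Rightarrow> 'a \<Rightarrow> real \<Rightarrow> state" where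
  "input_state G num es q s t \<epsilon> =
     \<lparr>ireg = (\<lambda>_. 0)(0 := card (pverts G), 1 := length es, 2 := num s, 3 := num t),
      rreg = (\<lambda>_. 0)(0 := \<epsilon>),
      imem = (\<lambda>a. if a < 2 * length es
                  then num ((if even a then fst else snd) (es ! (a div 2))) else 0),
      rmem = (\<lambda>a. if a < length es then q (es ! a) else 0)\<rparr>"

section \<open>The running time bound\<close>

text \<open>
  The two offsets are the usual conventions in asymptotic bounds for degenerate parameters.
  The factor \<open>max 1\<close> matters only for the graph with one vertex and no edge, where the
  expression would vanish, and the shift by 2 keeps the logarithm at least 1.
\<close>

definition time_bound :: "real \<Rightarrow> nat \<Rightarrow> nat \<Rightarrow> nat \<Rightarrow> real \<Rightarrow> real" where
  "time_bound C k n m \<epsilon> =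
     C * max 1 (real n ^ 6 * real m ^ 4 * max (real m ^ 4) (1 / \<epsilon> ^ 4))
       * log 2 (2 + real n / \<epsilon>) ^ k"

end

theory Submission
  imports Defs
begin

text \<open>
  Sort the arcs so that all arcs into \<open>u\<close> precede every arc out of \<open>u\<close>. Revealing them in this order,
  the set of vertices reached from \<open>s\<close> is a Markov chain: an arc \<open>(u, w)\<close> that is present adds \<open>w\<close> if \<open>u\<close> has
  been reached. Let \<open>R\<^sub>i(v)\<close> be the probability that \<open>v\<close> is reached through the first \<open>i\<close> arcs, and let
  \<open>K\<^sub>i(v)\<close> be an estimate of it. A particle is a pair of a location \<open>z\<close> and a realisation \<open>A\<close> of the chain with
  \<open>z \<in> A\<close>. When the arc \<open>(u, w)\<close> of probability \<open>p\<close> is revealed, a particle at \<open>w\<close> survives with probability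
  \<open>K\<^sub>i\<^sub>-\<^sub>1(w) / K\<^sub>i(w)\<close>, and a particle at \<open>u\<close> with \<open>w \<notin> A\<close> has with probability \<open>p K\<^sub>i\<^sub>-\<^sub>1(u) / K\<^sub>i(w)\<close> an
  additional offspring at \<open>w\<close>, in whose realisation the arc is present.

  As long as these probabilities are at most 1, the expected number of particles at \<open>v\<close> after \<open>i\<close> arcs is exactly
  \<open>R\<^sub>i(v) / K\<^sub>i(v)\<close>, so errors of the estimates do not accumulate. If they are correct up to a factor of two,
  then the second moment is \<open>O(m)\<close>: two particles at \<open>v\<close> separate at some arc with tail \<open>u\<close>, from where on they
  are independent, and \<open>R\<^sub>j(u)\<close> times the probability that \<open>u\<close> reaches \<open>v\<close> through the later arcs is at most
  \<open>R\<^sub>i(v)\<close>. Hence \<open>O(m\<^sup>2 / \<epsilon>\<^sup>2)\<close> independent roots give the next estimate by Chebyshev's inequality with failure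
  probability \<open>O(1 / m)\<close>. The work has polynomial expectation, so by Markov's inequality it can be cut off after
  polynomially many steps at the price of another \<open>O(1 / m)\<close>.
\<close>

section \<open>Refinement of probabilistic computations by programs\<close>

text \<open>The constants: a root costs at most \<open>6 m^2\<close> machine steps on average, and
  its count has second moment at most \<open>8 m\<close> times the squared mean. With
  \<open>N \<ge> 64 m^2 / \<delta>^2\<close> roots and \<open>F \<ge> 48 m^3 N\<close> steps,
  Chebyshev and Markov each lose at most \<open>1 / (8 m)\<close>, so the \<open>m\<close> phases
  together lose at most \<open>1 / 4\<close>. A step costs \<open>O(n)\<close> instructions, mainly
  for copying a vertex set, which gives \<open>O(n m F)\<close>, that is
  \<open>O(n m^6 / \<epsilon>^2)\<close> for small \<open>\<epsilon>\<close>. As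
  \<open>m^2 / \<epsilon>^2\<close> is at most the maximum of \<open>m^4\<close> and
  \<open>1 / \<epsilon>^4\<close>, the bound holds without a logarithm. Two obstacles shape the
  argument. The weights are random, and all later trees depend on them; each phase draws fresh roots
  and is analysed for an arbitrary fixed history of accurate weights, so a union bound replaces
  independence of the phases. Halting must hold in the worst case, but a cut-off biases the count;
  the moments are therefore those of the uncut tree, and only the event that the work fits into the
  budget is transferred to the machine.\<close>

definition result :: "nat \<Rightarrow> prog \<Rightarrow> state \<Rightarrow> state pmf" where
  "result T P \<sigma> = map_pmf snd (run T P \<sigma>)"

lemma run_Skip: "run T Skip \<sigma> = return_pmf (Skip, \<sigma>)"
  by (induction T) (simp_all add: bind_return_pmf)

lemma halts_Suc:
  "halts_within (Suc T) P \<sigma> \<longleftrightarrow> (\<forall>(P', \<sigma>') \<in> set_pmf (step P \<sigma>). halts_within T P' \<sigma>')"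
  by (auto simp: halts_within_def)

lemma result_Suc: "result (Suc T) P \<sigma> = step P \<sigma> \<bind> (\<lambda>(P', \<sigma>'). result T P' \<sigma>')"
  by (simp add: result_def map_bind_pmf case_prod_unfold)

lemma halts_0: "halts_within 0 P \<sigma> \<longleftrightarrow> P = Skip"
  by (simp add: halts_within_def)

lemma halts_Skip: "halts_within T Skip \<sigma>"
  by (simp add: halts_within_def run_Skip)

lemma result_Skip: "result T Skip \<sigma> = return_pmf \<sigma>"
  by (simp add: result_def run_Skip)

lemma halts_result_mono:
  assumes "halts_within T P \<sigma>" "T \<le> T'"
  shows "halts_within T' P \<sigma> \<and> result T' P \<sigma> = result T P \<sigma>"
  using assms
proof (induction T arbitrary: T' P \<sigma>)
  case 0
  then show ?case by (simp add: halts_0 halts_Skip result_Skip)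
next
  case (Suc T)
  then obtain T'' where T': "T' = Suc T''" "T \<le> T''"
    by (cases T') auto
  have *: "halts_within T'' P' \<sigma>' \<and> result T'' P' \<sigma>' = result T P' \<sigma>'"
    if "(P', \<sigma>') \<in> set_pmf (step P \<sigma>)" for P' \<sigma>'
    using Suc.IH[of P' \<sigma>' T''] Suc.prems that T' by (auto simp: halts_Suc)
  then have "result T' P \<sigma> = result (Suc T) P \<sigma>"
    unfolding T' result_Suc by (intro bind_pmf_cong) auto
  with * show ?case unfolding T' by (auto simp: halts_Suc)
qed

text \<open>Paths of \<open>P\<close> may end at different times; one that ends early starts
  \<open>Q\<close> early and idles at the end, by \<open>halts_result_mono\<close>. The extra step
  discards the finished left component.\<close>

lemma halts_result_Seq:
  assumes "halts_within T P \<sigma>" "\<And>\<sigma>'. \<sigma>' \<in> set_pmf (result T P \<sigma>) \<Longrightarrow> halts_within U Q \<sigma>'"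
  shows "halts_within (T + Suc U) (Seq P Q) \<sigma> \<and>
    result (T + Suc U) (Seq P Q) \<sigma> = result T P \<sigma> \<bind> result U Q"
  using assms
proof (induction T arbitrary: P \<sigma>)
  case 0
  then show ?case
    by (simp add: halts_0 halts_Suc result_Suc result_Skip bind_return_pmf)
next
  case (Suc T)
  show ?case
  proof (cases "P = Skip")
    case True
    with Suc.prems have "halts_within U Q \<sigma>" by (simp add: result_Skip)
    then have "halts_within (T + Suc U) Q \<sigma> \<and> result (T + Suc U) Q \<sigma> = result U Q \<sigma>"
      by (rule halts_result_mono) simp
    then show ?thesis unfolding True add_Suc halts_Suc result_Suc
      by (simp add: result_Skip bind_return_pmf)
  next
    case False
    have *: "halts_within (T + Suc U) (Seq P' Q) \<sigma>' \<and>
        result (T + Suc U) (Seq P' Q) \<sigma>' = result T P' \<sigma>' \<bind> result U Q"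
      if "(P', \<sigma>') \<in> set_pmf (step P \<sigma>)" for P' \<sigma>'
      using Suc.prems that
      by (intro Suc.IH) (force simp: halts_Suc result_Suc)+
    then have h: "halts_within (Suc T + Suc U) (Seq P Q) \<sigma>"
      unfolding add_Suc halts_Suc using False by auto
    have "result (Suc T + Suc U) (Seq P Q) \<sigma>
        = step P \<sigma> \<bind> (\<lambda>x. result (T + Suc U) (Seq (fst x) Q) (snd x))"
      unfolding add_Suc result_Suc using False
      by (simp add: bind_map_pmf case_prod_unfold)
    also have "\<dots> = step P \<sigma> \<bind> (\<lambda>x. result T (fst x) (snd x) \<bind> result U Q)"
      using * by (intro bind_pmf_cong) auto
    also have "\<dots> = result (Suc T) P \<sigma> \<bind> result U Q"
      by (simp add: result_Suc bind_assoc_pmf case_prod_unfold)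
    finally show ?thesis using h by simp
  qed
qed

text \<open>A coupling rather than an equality of distributions: \<open>R\<close> says which states
  represent an abstract outcome and leaves scratch registers free. Couplings compose along
  \<open>bind_pmf\<close>, and at the end they transfer lower bounds on probabilities.\<close>

definition refines ::
  "nat \<Rightarrow> prog \<Rightarrow> state \<Rightarrow> 'a pmf \<Rightarrow> ('a \<Rightarrow> state \<Rightarrow> bool) \<Rightarrow> bool" where
  "refines T P \<sigma> M R \<longleftrightarrow> halts_within T P \<sigma> \<and> rel_pmf R M (result T P \<sigma>)"

abbreviation runs :: "nat \<Rightarrow> prog \<Rightarrow> state \<Rightarrow> (state \<Rightarrow> bool) \<Rightarrow> bool" where
  "runs T P \<sigma> Q \<equiv> refines T P \<sigma> (return_pmf ()) (\<lambda>_. Q)"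

lemma refines_mono:
  assumes "refines T P \<sigma> M R" "T \<le> T'" "\<And>x \<sigma>'. R x \<sigma>' \<Longrightarrow> R' x \<sigma>'"
  shows "refines T' P \<sigma> M R'"
  using assms halts_result_mono[of T P \<sigma> T'] unfolding refines_def
  by (auto elim: pmf.rel_mono_strong)

lemma refines_Skip: "R x \<sigma> \<Longrightarrow> refines T Skip \<sigma> (return_pmf x) R"
  by (simp add: refines_def halts_Skip result_Skip)

lemma refines_Seq:
  assumes "refines T P \<sigma> M R" "\<And>x \<sigma>'. R x \<sigma>' \<Longrightarrow> refines U Q \<sigma>' (f x) R'"
  shows "refines (T + Suc U) (Seq P Q) \<sigma> (M \<bind> f) R'"
proof -
  have rel: "rel_pmf R M (result T P \<sigma>)" and h: "halts_within T P \<sigma>"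
    using assms(1) by (auto simp: refines_def)
  have "halts_within U Q \<sigma>'" if "\<sigma>' \<in> set_pmf (result T P \<sigma>)" for \<sigma>'
  proof -
    from rel_setD2[OF pmf.set_transfer[THEN rel_funD, OF rel] that]
    obtain x where "R x \<sigma>'" by auto
    then show ?thesis using assms(2) by (auto simp: refines_def)
  qed
  from halts_result_Seq[OF h this] have
    "halts_within (T + Suc U) (Seq P Q) \<sigma>"
    "result (T + Suc U) (Seq P Q) \<sigma> = result T P \<sigma> \<bind> result U Q" by auto
  moreover have "rel_pmf R' (M \<bind> f) (result T P \<sigma> \<bind> result U Q)"
    by (rule rel_pmf_bindI[OF rel]) (use assms(2) in \<open>auto simp: refines_def\<close>)
  ultimately show ?thesis by (simp add: refines_def)
qed

lemma runs_Seq: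
  assumes "runs T P \<sigma> Q'" "\<And>\<sigma>'. Q' \<sigma>' \<Longrightarrow> refines U Q \<sigma>' M R"
  shows "refines (T + Suc U) (Seq P Q) \<sigma> M R"
  using refines_Seq[OF assms(1), of U Q "\<lambda>_. M" R] assms(2) by (simp add: bind_return_pmf)

lemma refines_Cond:
  assumes "holds b \<sigma> \<Longrightarrow> refines T P \<sigma> M R" "\<not> holds b \<sigma> \<Longrightarrow> refines T Q \<sigma> M R"
  shows "refines (Suc T) (Cond b P Q) \<sigma> M R"
  using assms unfolding refines_def halts_Suc result_Suc
  by (auto simp: bind_return_pmf)

lemma refines_Flip:
  assumes "\<And>x. R x (\<sigma>\<lparr>ireg := (ireg \<sigma>)(d := (if x then 1 else 0))\<rparr>)"
  shows "refines 1 (Do (Flip d a)) \<sigma> (bernoulli_pmf (rreg \<sigma> a)) R"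
  using assms[of True] assms[of False] unfolding refines_def One_nat_def halts_Suc result_Suc
  by (auto simp: halts_0 result_Skip bind_return_pmf bind_map_pmf pmf.rel_map bind_return_pmf'
      map_pmf_def[symmetric] intro!: rel_pmf_reflI)

text \<open>A plain function in place of a \<open>pmf\<close>, so that the simplifier can run a
  straight-line block symbolically by \<open>fold\<close>. The clause for \<open>Flip\<close> is a
  dummy value that \<open>is_det\<close> excludes.\<close>

fun det_exec :: "instr \<Rightarrow> state \<Rightarrow> state" where
  "det_exec (IConst d c) \<sigma> = \<sigma>\<lparr>ireg := (ireg \<sigma>)(d := c)\<rparr>"
| "det_exec (IAdd d a b) \<sigma> = \<sigma>\<lparr>ireg := (ireg \<sigma>)(d := ireg \<sigma> a + ireg \<sigma> b)\<rparr>"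
| "det_exec (ISub d a b) \<sigma> = \<sigma>\<lparr>ireg := (ireg \<sigma>)(d := ireg \<sigma> a - ireg \<sigma> b)\<rparr>"
| "det_exec (ILoad d a) \<sigma> = \<sigma>\<lparr>ireg := (ireg \<sigma>)(d := imem \<sigma> (ireg \<sigma> a))\<rparr>"
| "det_exec (IStore a b) \<sigma> = \<sigma>\<lparr>imem := (imem \<sigma>)(ireg \<sigma> a := ireg \<sigma> b)\<rparr>"
| "det_exec (ROfNat d a) \<sigma> = \<sigma>\<lparr>rreg := (rreg \<sigma>)(d := real (ireg \<sigma> a))\<rparr>"
| "det_exec (RAdd d a b) \<sigma> = \<sigma>\<lparr>rreg := (rreg \<sigma>)(d := rreg \<sigma> a + rreg \<sigma> b)\<rparr>"
| "det_exec (RSub d a b) \<sigma> = \<sigma>\<lparr>rreg := (rreg \<sigma>)(d := rreg \<sigma> a - rreg \<sigma> b)\<rparr>"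
| "det_exec (RMul d a b) \<sigma> = \<sigma>\<lparr>rreg := (rreg \<sigma>)(d := rreg \<sigma> a * rreg \<sigma> b)\<rparr>"
| "det_exec (RDiv d a b) \<sigma> = \<sigma>\<lparr>rreg := (rreg \<sigma>)(d := rreg \<sigma> a / rreg \<sigma> b)\<rparr>"
| "det_exec (RLoad d a) \<sigma> = \<sigma>\<lparr>rreg := (rreg \<sigma>)(d := rmem \<sigma> (ireg \<sigma> a))\<rparr>"
| "det_exec (RStore a b) \<sigma> = \<sigma>\<lparr>rmem := (rmem \<sigma>)(ireg \<sigma> a := rreg \<sigma> b)\<rparr>"
| "det_exec (Flip d a) \<sigma> = \<sigma>"

fun is_det :: "instr \<Rightarrow> bool" where
  "is_det (Flip d a) = False"
| "is_det i = True"

primrec block :: "instr list \<Rightarrow> prog" where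
  "block [] = Skip"
| "block (i # is) = Seq (Do i) (block is)"

lemma runs_Do: "is_det i \<Longrightarrow> runs 1 (Do i) \<sigma> (\<lambda>\<sigma>'. \<sigma>' = det_exec i \<sigma>)"
  unfolding refines_def One_nat_def halts_Suc result_Suc
  by (cases i) (auto simp: halts_0 result_Skip bind_return_pmf bind_map_pmf)

lemma runs_block:
  "list_all is_det is \<Longrightarrow> runs (2 * length is) (block is) \<sigma> (\<lambda>\<sigma>'. \<sigma>' = fold det_exec is \<sigma>)"
proof (induction "is" arbitrary: \<sigma>)
  case Nil
  then show ?case by (simp add: refines_Skip)
next
  case (Cons i "is")
  have "refines (1 + Suc (2 * length is)) (block (i # is)) \<sigma> (return_pmf ())
      (\<lambda>_ \<sigma>'. \<sigma>' = fold det_exec is (det_exec i \<sigma>))"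
    unfolding block.simps using Cons by (intro runs_Seq[OF runs_Do]) auto
  then show ?case by simp
qed

lemma refines_block:
  assumes "list_all is_det is" "R x (fold det_exec is \<sigma>)" "2 * length is \<le> T"
  shows "refines T (block is) \<sigma> (return_pmf x) R"
proof -
  have "refines (2 * length is) (block is) \<sigma> (return_pmf ()) (\<lambda>_ \<sigma>'. \<sigma>' = fold det_exec is \<sigma>)"
    using assms(1) by (rule runs_block)
  then have "halts_within (2 * length is) (block is) \<sigma>"
    "\<forall>\<sigma>'\<in>set_pmf (result (2 * length is) (block is) \<sigma>). \<sigma>' = fold det_exec is \<sigma>"
    by (auto simp: refines_def rel_pmf_return_pmf1)
  then have "refines (2 * length is) (block is) \<sigma> (return_pmf x) R"
    using assms(2) by (auto simp: refines_def rel_pmf_return_pmf1)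
  then show ?thesis using assms(3) by (rule refines_mono) auto
qed

lemma refines_block_Seq:
  assumes "list_all is_det is" "refines T P (fold det_exec is \<sigma>) M R"
  shows "refines (2 * length is + Suc T) (Seq (block is) P) \<sigma> M R"
  using assms by (intro runs_Seq[OF runs_block]) auto

lemma refines_Flip_Seq:
  assumes "rreg \<sigma> a = p"
    "\<And>x. refines T P (\<sigma>\<lparr>ireg := (ireg \<sigma>)(d := (if x then 1 else 0))\<rparr>) (f x) R"
  shows "refines (2 + T) (Seq (Do (Flip d a)) P) \<sigma> (bernoulli_pmf p \<bind> f) R"
proof -
  have "refines (1 + Suc T) (Seq (Do (Flip d a)) P) \<sigma> (bernoulli_pmf p \<bind> f) R"
    unfolding assms(1)[symmetric]
    by (rule refines_Seq[OF refines_Flip[where R = "\<lambda>x \<sigma>'. \<sigma>' = \<sigma>\<lparr>ireg := (ireg \<sigma>)(d := (if x then 1 else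
        0))\<rparr>"]])
      (use assms in auto)
  then show ?thesis by simp
qed

primrec iterate_pmf :: "nat \<Rightarrow> ('a \<Rightarrow> 'a pmf) \<Rightarrow> 'a \<Rightarrow> 'a pmf" where
  "iterate_pmf 0 f x = return_pmf x"
| "iterate_pmf (Suc k) f x = f x \<bind> iterate_pmf k f"

text \<open>\<open>I k\<close> is the invariant with \<open>k\<close> rounds left, so the number of
  rounds is fixed in advance and the abstract process is an iterate. A round pays one step for the
  test and one for dropping the finished body; the final test is the \<open>+ 1\<close>.\<close>

lemma refines_While:
  assumes step: "\<And>k x \<sigma>. I (Suc k) x \<sigma> \<Longrightarrow> holds b \<sigma> \<and> refines T P \<sigma> (f x) (I k)"
    and stop: "\<And>x \<sigma>. I 0 x \<sigma> \<Longrightarrow> \<not> holds b \<sigma>"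
    and init: "I k x \<sigma>"
  shows "refines (k * (T + 2) + 1) (While b P) \<sigma> (iterate_pmf k f x) (I 0)"
  using init
proof (induction k arbitrary: x \<sigma>)
  case 0
  then show ?case using stop[OF 0] unfolding refines_def
    by (simp add: halts_Suc result_Suc halts_Skip result_Skip bind_return_pmf)
next
  case (Suc k)
  from step[OF Suc.prems] have b: "holds b \<sigma>" and r: "refines T P \<sigma> (f x) (I k)" by auto
  have "refines (T + Suc (k * (T + 2) + 1)) (Seq P (While b P)) \<sigma> (f x \<bind> iterate_pmf k f) (I 0)"
    using r Suc.IH by (rule refines_Seq)
  then have "refines (Suc (T + Suc (k * (T + 2) + 1))) (While b P) \<sigma> (f x \<bind> iterate_pmf k f) (I 0)"
    using b unfolding refines_def halts_Suc[of _ "While b P"] result_Suc[of _ "While b P"]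
    by (simp add: bind_return_pmf)
  then show ?case by (simp add: ac_simps)
qed

lemma iterate_pmf_return: "iterate_pmf k return_pmf x = return_pmf x"
  by (induction k) (simp_all add: bind_return_pmf)

lemma runs_While:
  assumes "\<And>k \<sigma>. I (Suc k) \<sigma> \<Longrightarrow> holds b \<sigma> \<and> runs T P \<sigma> (I k)"
    and "\<And>\<sigma>. I 0 \<sigma> \<Longrightarrow> \<not> holds b \<sigma>" and "I k \<sigma>"
  shows "runs (k * (T + 2) + 1) (While b P) \<sigma> (I 0)"
  using refines_While[of "\<lambda>k _. I k" b T P return_pmf k "()" \<sigma>] assms
  by (simp add: iterate_pmf_return)

section \<open>The reachability chain\<close>

type_synonym arc = "nat \<times> nat \<times> real"

fun arc_ok :: "arc \<Rightarrow> bool" where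
  "arc_ok (u, w, p) \<longleftrightarrow> u \<noteq> w \<and> 0 \<le> p \<and> p \<le> 1"

fun grow :: "arc \<Rightarrow> nat set \<Rightarrow> nat set" where
  "grow (u, w, p) A = (if u \<in> A then insert w A else A)"

text \<open>Conditioning on the next arc for an arbitrary current set keeps the analysis free of
  probability spaces; the link to independent arcs is made in \<open>hit_eq_prob\<close>.\<close>

primrec hit :: "nat \<Rightarrow> arc list \<Rightarrow> nat set \<Rightarrow> real" where
  "hit v [] A = of_bool (v \<in> A)"
| "hit v (e # es) A = snd (snd e) * hit v es (grow e A) + (1 - snd (snd e)) * hit v es A"

lemma hit_nonneg: "list_all arc_ok es \<Longrightarrow> 0 \<le> hit v es A"
  by (induction es arbitrary: A) auto

lemma grow_mono: "A \<subseteq> B \<Longrightarrow> grow e A \<subseteq> grow e B"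
  by (cases e) auto

lemma hit_mono: "list_all arc_ok es \<Longrightarrow> A \<subseteq> B \<Longrightarrow> hit v es A \<le> hit v es B"
proof (induction es arbitrary: A B)
  case (Cons e es)
  have "0 \<le> snd (snd e)" "snd (snd e) \<le> 1" using Cons.prems by (cases e; simp)+
  then show ?case using Cons.IH[OF _ grow_mono[OF Cons.prems(2), of e]] Cons.IH[of A B] Cons.prems
    by (auto intro!: add_mono mult_left_mono simp del: grow.simps)
qed auto

text \<open>Markov property and monotonicity: once \<open>u\<close> is reached through
  \<open>es\<close>, the current set contains \<open>{u}\<close>, and from it the later arcs reach
  \<open>v\<close> at least as likely as from \<open>{u}\<close> alone.\<close>

lemma hit_append:
  assumes "list_all arc_ok es" "list_all arc_ok fs"
  shows "hit u es A * hit v fs {u} \<le> hit v (es @ fs) A"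
  using assms(1)
proof (induction es arbitrary: A)
  case Nil
  then show ?case using hit_mono[OF assms(2), of "{u}" A] hit_nonneg[OF assms(2)] by auto
next
  case (Cons e es)
  have p: "0 \<le> snd (snd e)" "snd (snd e) \<le> 1" using Cons.prems by (cases e; simp)+
  have "hit u (e # es) A * hit v fs {u} = snd (snd e) * (hit u es (grow e A) * hit v fs {u})
      + (1 - snd (snd e)) * (hit u es A * hit v fs {u})"
    by (simp add: algebra_simps)
  also have "\<dots> \<le> hit v ((e # es) @ fs) A"
    using p Cons by (auto intro!: add_mono mult_left_mono)
  finally show ?case .
qed

text \<open>The mean of \<open>f\<close> over a particle and its offspring after the weights have
  cancelled, see \<open>expectation_children_weighted\<close>. No weight occurs in it, which is why
  the mean count is exact whatever the estimates are.\<close>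

fun lin :: "arc \<Rightarrow> (nat \<Rightarrow> nat set \<Rightarrow> real) \<Rightarrow> nat \<Rightarrow> nat set \<Rightarrow> real" where
  "lin (u, w, p) f z A = p * f z (grow (u, w, p) A) + (1 - p) * f z A
    + (if z = u \<and> w \<notin> A then p * f w (insert w A) else 0)"

text \<open>
  Give every realisation of the chain that reaches a vertex a single derivation of it, by keeping the old
  derivation whenever an arc into a reached vertex is revealed. Then \<open>canon v es z A\<close> is the probability,
  given that \<open>A\<close> has been reached, that \<open>v\<close> is reached after the arcs \<open>es\<close> by a derivation which is now
  at \<open>z\<close>. Up to the ratio of the weights it is the expected number of descendants at \<open>v\<close> of a particle
  at \<open>z\<close>.
\<close>

primrec canon :: "nat \<Rightarrow> arc list \<Rightarrow> nat \<Rightarrow> nat set \<Rightarrow> real" where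
  "canon v [] z A = of_bool (z = v)"
| "canon v (e # es) z A = lin e (canon v es) z A"

lemma canon_nonneg: "list_all arc_ok es \<Longrightarrow> 0 \<le> canon v es z A"
  by (induction es arbitrary: z A) auto

lemma sum_lin:
  assumes "finite B" "B \<subseteq> A" "arc_ok (u, w, p)"
  shows "(\<Sum>z\<in>B. lin (u, w, p) f z A) = p * (\<Sum>z\<in>B. f z (grow (u, w, p) A))
    + (1 - p) * (\<Sum>z\<in>B. f z A) + (if u \<in> B \<and> w \<notin> A then p * f w (insert w A) else 0)"
proof -
  have "(\<Sum>z\<in>B. (if z = u \<and> w \<notin> A then p * f w (insert w A) else 0))
      = (if u \<in> B \<and> w \<notin> A then p * f w (insert w A) else 0)"
    using assms(1) by (cases "w \<in> A") (auto simp: sum.delta)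
  then show ?thesis by (simp add: sum.distrib sum_distrib_left)
qed

text \<open>A derivation starting in \<open>B\<close> only follows arcs that also extend the chain
  started from \<open>B\<close> alone. If the revealed arc leaves \<open>B\<close>, then
  \<open>B\<close> gains \<open>w\<close>; a derivation at \<open>w\<close> is created only if
  \<open>w\<close> is outside \<open>A\<close>, and otherwise the sum over \<open>B\<close> is part
  of the sum over \<open>insert w B\<close>.\<close>

lemma sum_canon_le_hit:
  assumes "list_all arc_ok es" "finite B" "B \<subseteq> A"
  shows "(\<Sum>z\<in>B. canon v es z A) \<le> hit v es B"
  using assms
proof (induction es arbitrary: A B)
  case Nil
  then show ?case by (auto simp: of_bool_def sum.delta)
next
  case (Cons e es)
  obtain u w p where e: "e = (u, w, p)" by (cases e) auto
  have p: "0 \<le> p" "p \<le> 1" and ok: "list_all arc_ok es" "arc_ok (u, w, p)" using Cons.prems e by auto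
  define S where "S = (\<Sum>z\<in>B. canon v es z (grow e A)) + (if u \<in> B \<and> w \<notin> A then canon v es w (insert w A)
      else 0)"
  have "S \<le> hit v es (grow e B)"
  proof (cases "u \<in> B")
    case False
    have "B \<subseteq> grow e A" using Cons.prems by (auto simp: e)
    then show ?thesis using False Cons.IH[of B "grow e A"] Cons.prems ok by (auto simp: S_def e)
  next
    case True
    have "insert w B \<subseteq> insert w A" using Cons.prems by auto
    then have le: "(\<Sum>z\<in>insert w B. canon v es z (insert w A)) \<le> hit v es (insert w B)"
      using Cons.IH[of "insert w B" "insert w A"] Cons.prems ok by auto
    have uA: "u \<in> A" using True Cons.prems by auto
    have "S \<le> (\<Sum>z\<in>insert w B. canon v es z (insert w A))"
    proof (cases "w \<in> A")
      case True
      then show ?thesis using uA Cons.prems canon_nonneg[OF ok(1)]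
        by (auto simp: S_def e intro!: sum_mono2)
    next
      case False
      then have "w \<notin> B" using Cons.prems by auto
      then show ?thesis using uA Cons.prems \<open>u \<in> B\<close> False by (simp add: S_def e)
    qed
    then show ?thesis using le True by (simp add: e)
  qed
  moreover have "(\<Sum>z\<in>B. canon v es z A) \<le> hit v es B" using Cons.IH Cons.prems ok by auto
  moreover have "(\<Sum>z\<in>B. canon v (e # es) z A) = p * S + (1 - p) * (\<Sum>z\<in>B. canon v es z A)"
    using sum_lin[OF Cons.prems(2,3) ok(2), of "canon v es"]
    by (simp add: S_def e algebra_simps del: lin.simps)
  ultimately show ?case using p by (auto simp: e intro!: add_mono mult_left_mono)
qed

lemma canon_le_hit:
  "list_all arc_ok es \<Longrightarrow> z \<in> A \<Longrightarrow> canon v es z A \<le> hit v es {z}"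
  using sum_canon_le_hit[of es "{z}" A] by simp

text \<open>For \<open>B = A\<close> nothing is lost: a derivation at \<open>w\<close> is created
  exactly when \<open>A\<close> gains \<open>w\<close>.\<close>

lemma sum_canon_eq_hit:
  assumes "list_all arc_ok es" "finite A"
  shows "(\<Sum>z\<in>A. canon v es z A) = hit v es A"
  using assms
proof (induction es arbitrary: A)
  case Nil
  then show ?case by (auto simp: of_bool_def sum.delta)
next
  case (Cons e es)
  obtain u w p where e: "e = (u, w, p)" by (cases e) auto
  have ok: "list_all arc_ok es" "arc_ok (u, w, p)" using Cons.prems e by auto
  define S where "S = (\<Sum>z\<in>A. canon v es z (grow e A)) + (if u \<in> A \<and> w \<notin> A then canon v es w (insert w A)
      else 0)"
  have "S = (\<Sum>z\<in>grow e A. canon v es z (grow e A))"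
    using Cons.prems by (cases "w \<in> A") (auto simp: S_def e insert_absorb)
  also have "\<dots> = hit v es (grow e A)" using Cons.prems ok by (intro Cons.IH) (auto simp: e)
  finally have "S = hit v es (grow e A)" .
  moreover have "(\<Sum>z\<in>A. canon v (e # es) z A) = p * S + (1 - p) * (\<Sum>z\<in>A. canon v es z A)"
    using sum_lin[OF Cons.prems(2) subset_refl ok(2), of "canon v es"]
    by (simp add: S_def e algebra_simps del: lin.simps)
  ultimately show ?case using Cons.IH[of A] Cons.prems ok by (simp add: e)
qed

lemma canon_start: "list_all arc_ok es \<Longrightarrow> canon v es s {s} = hit v es {s}"
  using sum_canon_eq_hit[of es "{s}"] by simp

text \<open>
  Up to the ratio of the weights, this is the expected total of the costs \<open>c j\<close> over all descendants that are at
  the tail of the arc \<open>j\<close> when it is revealed.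
\<close>

definition visits :: "(nat \<Rightarrow> real) \<Rightarrow> arc list \<Rightarrow> nat \<Rightarrow> nat set \<Rightarrow> real" where
  "visits c es z A = (\<Sum>j<length es. c j * canon (fst (es ! j)) (take j es) z A)"

lemma lin_sum: "lin e (\<lambda>z A. \<Sum>j\<in>J. c j * f j z A) z A = (\<Sum>j\<in>J. c j * lin e (f j) z A)"
  by (cases e) (auto simp: distrib_left sum.distrib sum_distrib_left mult.left_commute simp del: grow.simps
      intro!: sum.neutral)

lemma visits_Nil: "visits c [] z A = 0"
  by (simp add: visits_def)

lemma visits_Cons:
  "visits c (e # es) z A = c 0 * of_bool (z = fst e) + lin e (visits (\<lambda>j. c (Suc j)) es) z A"
  unfolding visits_def[of c] list.size(4) Suc_eq_plus1[symmetric]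
  by (simp add: sum.lessThan_Suc_shift lin_sum[symmetric] visits_def[abs_def] del: sum.lessThan_Suc)

lemma visits_nonneg:
  assumes "list_all arc_ok es" "\<And>j. j < length es \<Longrightarrow> 0 \<le> c j"
  shows "0 \<le> visits c es z A"
proof -
  have "list_all arc_ok (take j es)" for j
    using assms(1) by (auto simp: list_all_iff dest: in_set_takeD)
  then show ?thesis unfolding visits_def using assms(2)
    by (auto intro!: sum_nonneg mult_nonneg_nonneg canon_nonneg)
qed

section \<open>Weighted branching particles\<close>

type_synonym particle = "nat \<times> nat set"

text \<open>The simulation reads only the arc, \<open>keep\<close> and \<open>spawn\<close>;
  \<open>wt\<close>, the new weight of the head, records for the analysis how these two
  probabilities arose.\<close>

datatype stage = Stage (stage_arc: arc) (keep: real) (spawn: real) (wt: real)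

text \<open>The probability \<open>b\<close> already contains the factor \<open>p\<close>, so the
  offspring has \<open>w\<close> in its set whatever \<open>x\<close> is; \<open>x\<close> belongs
  to the realisation of the parent only. Hence parent and offspring go on independently, and the
  cross term of the second moment is a product of means. The second coin is tossed even where no
  offspring is possible, as in \<open>move_prog\<close>.\<close>

fun children :: "stage \<Rightarrow> particle \<Rightarrow> particle list pmf" where
  "children (Stage (u, w, p) a b \<kappa>) (z, A) =
     bernoulli_pmf p \<bind> (\<lambda>x.
       if z = w
       then map_pmf (\<lambda>k. if k then [(z, if x then grow (u, w, p) A else A)] else []) (bernoulli_pmf a)
       else map_pmf (\<lambda>k. (if k \<and> z = u \<and> w \<notin> A then [(w, insert w A)] else []) @
              [(z, if x then grow (u, w, p) A else A)]) (bernoulli_pmf b))"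

fun stage_ok :: "(nat \<Rightarrow> real) \<Rightarrow> stage \<Rightarrow> bool" where
  "stage_ok K (Stage (u, w, p) a b \<kappa>) \<longleftrightarrow> arc_ok (u, w, p) \<and> 0 \<le> K u \<and> 0 \<le> K w \<and>
     K w \<le> \<kappa> \<and> p * K u \<le> \<kappa> \<and> a = K w / \<kappa> \<and> b = p * K u / \<kappa>"

fun next_wt :: "(nat \<Rightarrow> real) \<Rightarrow> stage \<Rightarrow> nat \<Rightarrow> real" where
  "next_wt K (Stage (u, w, p) a b \<kappa>) = K(w := \<kappa>)"

primrec stages_ok :: "(nat \<Rightarrow> real) \<Rightarrow> stage list \<Rightarrow> bool" where
  "stages_ok K [] \<longleftrightarrow> True"
| "stages_ok K (x # xs) \<longleftrightarrow> stage_ok K x \<and> stages_ok (next_wt K x) xs"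

definition final_wt :: "(nat \<Rightarrow> real) \<Rightarrow> stage list \<Rightarrow> nat \<Rightarrow> real" where
  "final_wt K xs = foldl next_wt K xs"

lemma final_wt_simps [simp]:
  "final_wt K [] = K" "final_wt K (x # xs) = final_wt (next_wt K x) xs"
  "final_wt K (xs @ ys) = final_wt (final_wt K xs) ys"
  by (simp_all add: final_wt_def)

lemma stages_ok_append [simp]:
  "stages_ok K (xs @ ys) \<longleftrightarrow> stages_ok K xs \<and> stages_ok (final_wt K xs) ys"
  by (induction xs arbitrary: K) auto

lemma stages_ok_arcs: "stages_ok K xs \<Longrightarrow> list_all arc_ok (map stage_arc xs)"
proof (induction xs arbitrary: K)
  case (Cons x xs)
  then show ?case by (cases "(K, x)" rule: stage_ok.cases) auto
qed simp

section \<open>Moments of the branching process\<close>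

lemma expectation_bind_finite:
  fixes h :: "'b \<Rightarrow> real"
  assumes "finite (set_pmf p)" "\<And>x. x \<in> set_pmf p \<Longrightarrow> finite (set_pmf (f x))"
  shows "measure_pmf.expectation (p \<bind> f) h = measure_pmf.expectation p (\<lambda>x. measure_pmf.expectation (f x)
      h)"
  using assms
  by (subst pmf_expectation_bind[of "set_pmf p"])
    (auto simp: integral_measure_pmf[of "set_pmf p"])

lemma finite_children: "finite (set_pmf (children x pt))"
  by (cases "(x, pt)" rule: children.cases) auto

lemma expectation_children:
  fixes h :: "particle list \<Rightarrow> real"
  assumes "stage_ok K (Stage (u, w, p) a b \<kappa>)"
  shows "measure_pmf.expectation (children (Stage (u, w, p) a b \<kappa>) (z, A)) h =
    (if z = w then a * (p * h [(z, grow (u, w, p) A)] + (1 - p) * h [(z, A)]) + (1 - a) * h []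
     else if z = u \<and> w \<notin> A
     then b * (p * h [(w, insert w A), (z, grow (u, w, p) A)] + (1 - p) * h [(w, insert w A), (z, A)])
        + (1 - b) * (p * h [(z, grow (u, w, p) A)] + (1 - p) * h [(z, A)])
     else p * h [(z, grow (u, w, p) A)] + (1 - p) * h [(z, A)])"
proof -
  have "0 \<le> a" "a \<le> 1" "0 \<le> b" "b \<le> 1" "0 \<le> p" "p \<le> 1"
    using assms by (auto simp: divide_le_eq_1)
  then show ?thesis
    by (simp add: expectation_bind_finite algebra_simps del: grow.simps)
qed

primrec total :: "('a \<Rightarrow> (nat \<times> nat) pmf) \<Rightarrow> 'a list \<Rightarrow> (nat \<times> nat) pmf" where
  "total f [] = return_pmf (0, 0)"
| "total f (x # xs) = f x \<bind> (\<lambda>a. map_pmf (\<lambda>b. (fst a + fst b, snd a + snd b)) (total f xs))"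

text \<open>The second component counts the nodes of the family tree, which is the number of steps
  that the stack machine spends on it.\<close>

primrec tree :: "nat \<Rightarrow> stage list \<Rightarrow> particle \<Rightarrow> (nat \<times> nat) pmf" where
  "tree v [] pt = return_pmf (of_bool (fst pt = v), 1)"
| "tree v (x # xs) pt = children x pt \<bind> (\<lambda>ps. map_pmf (map_prod id Suc) (total (tree v xs) ps))"

lemma finite_total: "(\<And>x. finite (set_pmf (f x))) \<Longrightarrow> finite (set_pmf (total f xs))"
  by (induction xs) auto

lemma finite_tree: "finite (set_pmf (tree v xs pt))"
  by (induction xs arbitrary: pt) (auto intro!: finite_total simp: finite_children)

definition count_mean :: "(nat \<times> nat) pmf \<Rightarrow> real" where
  "count_mean M = measure_pmf.expectation M (\<lambda>x. real (fst x))"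

definition count_square :: "(nat \<times> nat) pmf \<Rightarrow> real" where
  "count_square M = measure_pmf.expectation M (\<lambda>x. real (fst x) ^ 2)"

definition work_mean :: "(nat \<times> nat) pmf \<Rightarrow> real" where
  "work_mean M = measure_pmf.expectation M (\<lambda>x. real (snd x))"

lemmas moment_defs = count_mean_def count_square_def work_mean_def

text \<open>The summands are drawn independently, so the mixed term of the square factors into
  means. Finite supports make every function integrable.\<close>

lemma total_moments:
  assumes fin: "\<And>x. finite (set_pmf (f x))"
  shows "count_mean (total f []) = 0" "count_square (total f []) = 0" "work_mean (total f []) = 0"
    "count_mean (total f (x # xs)) = count_mean (f x) + count_mean (total f xs)"
    "work_mean (total f (x # xs)) = work_mean (f x) + work_mean (total f xs)"
    "count_square (total f (x # xs)) =
       count_square (f x) + 2 * count_mean (f x) * count_mean (total f xs) + count_square (total f xs)"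
  using fin
  by (simp_all add: moment_defs expectation_bind_finite finite_total integrable_measure_pmf_finite
      power2_sum)

lemma tree_moments:
  "count_mean (tree v (x # xs) pt) =
     measure_pmf.expectation (children x pt) (\<lambda>ps. count_mean (total (tree v xs) ps))"
  "count_square (tree v (x # xs) pt) =
     measure_pmf.expectation (children x pt) (\<lambda>ps. count_square (total (tree v xs) ps))"
  "work_mean (tree v (x # xs) pt) =
     1 + measure_pmf.expectation (children x pt) (\<lambda>ps. work_mean (total (tree v xs) ps))"
  by (simp_all add: moment_defs expectation_bind_finite finite_children finite_total finite_tree
      integrable_measure_pmf_finite)

lemmas tree_total_moments = total_moments[where f = "tree v xs" for v xs, OF finite_tree]

text \<open>Also valid for \<open>k = 0\<close>, where the quotients are 0: the inequalities of
  \<open>stage_ok\<close> then force both numerators to be 0.\<close>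

lemma stage_ok_mult:
  assumes "stage_ok K (Stage (u, w, p) a b k)"
  shows "a * k = K w" "b * k = p * K u"
proof -
  have "0 \<le> p * K u" using assms by auto
  then show "a * k = K w" "b * k = p * K u" using assms by (cases "k = 0"; auto)+
qed

lemma total_sum_list:
  "count_mean (total (tree v xs) ps) = (\<Sum>pt\<leftarrow>ps. count_mean (tree v xs pt))"
  "work_mean (total (tree v xs) ps) = (\<Sum>pt\<leftarrow>ps. work_mean (tree v xs pt))"
  by (induction ps) (simp_all add: tree_total_moments del: total.simps)

lemma expectation_children_sum:
  fixes h :: "particle \<Rightarrow> real"
  assumes "stage_ok K (Stage (u, w, p) a b k)"
  shows "measure_pmf.expectation (children (Stage (u, w, p) a b k) (z, A)) (\<lambda>ps. \<Sum>pt\<leftarrow>ps. h pt) =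
    (if z = w then a else 1) * (p * h (z, grow (u, w, p) A) + (1 - p) * h (z, A)) +
    (if z = u \<and> w \<notin> A then b * h (w, insert w A) else 0)"
proof -
  have "u \<noteq> w" using assms by simp
  then show ?thesis unfolding expectation_children[OF assms] by (simp add: algebra_simps del: grow.simps)
qed

text \<open>Unbiasedness for arbitrary admissible weights: survival at \<open>w\<close> turns the
  new weight \<open>k\<close> into \<open>a * k = K w\<close>, an offspring of a particle at
  \<open>u\<close> contributes \<open>b * k = p * K u\<close>, and all other weights are
  unchanged.\<close>

lemma expectation_children_weighted:
  assumes "stage_ok K x"
  shows "measure_pmf.expectation (children x (z, A)) (\<lambda>ps. \<Sum>pt\<leftarrow>ps. next_wt K x (fst pt) * f (fst pt) (snd
      pt))
    = K z * lin (stage_arc x) f z A"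
proof -
  obtain u w p a b k where x: "x = Stage (u, w, p) a b k" by (metis stage.exhaust prod.exhaust)
  have ok: "stage_ok K (Stage (u, w, p) a b k)" using assms x by simp
  have "u \<noteq> w" using ok by simp
  then show ?thesis
    unfolding x expectation_children_sum[OF ok]
    using stage_ok_mult[OF ok] by (auto simp: algebra_simps simp del: grow.simps)
qed

text \<open>Iterates the weight cancellation over the stages. The final weight stays on the left as
  a factor, so that weight 0 needs no separate case.\<close>

lemma count_mean_tree:
  assumes "stages_ok K xs"
  shows "final_wt K xs v * count_mean (tree v xs (z, A)) = K z * canon v (map stage_arc xs) z A"
  using assms
proof (induction xs arbitrary: K z A)
  case Nil
  then show ?case by (simp add: count_mean_def)
next
  case (Cons x xs)
  have IH: "final_wt (next_wt K x) xs v * count_mean (tree v xs pt)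
      = next_wt K x (fst pt) * canon v (map stage_arc xs) (fst pt) (snd pt)" for pt
    using Cons by (cases pt) simp
  have "final_wt K (x # xs) v * count_mean (tree v (x # xs) (z, A)) =
    measure_pmf.expectation (children x (z, A))
      (\<lambda>ps. \<Sum>pt\<leftarrow>ps. next_wt K x (fst pt) * canon v (map stage_arc xs) (fst pt) (snd pt))"
    unfolding tree_moments total_sum_list IH[symmetric] sum_list_const_mult by simp
  also have "\<dots> = K z * canon v (map stage_arc (x # xs)) z A"
    using Cons.prems by (subst expectation_children_weighted) auto
  finally show ?case .
qed

text \<open>The branching probability \<open>p * K u / wt\<close> without the weight of the tail,
  which enters through the factor \<open>K z\<close> in front of \<open>visits\<close>.\<close>

definition spawn_rate :: "stage list \<Rightarrow> nat \<Rightarrow> real" where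
  "spawn_rate xs j = snd (snd (stage_arc (xs ! j))) / wt (xs ! j)"

lemma stage_ok_next_wt: "stage_ok K x \<Longrightarrow> (\<And>v. 0 \<le> K v) \<Longrightarrow> 0 \<le> next_wt K x v"
  by (cases "(K, x)" rule: stage_ok.cases) (auto intro: order_trans)

lemma stages_ok_final_wt: "stages_ok K xs \<Longrightarrow> (\<And>v. 0 \<le> K v) \<Longrightarrow> 0 \<le> final_wt K xs v"
  by (induction xs arbitrary: K) (auto simp: stage_ok_next_wt)

lemma stages_ok_nth: "stages_ok K xs \<Longrightarrow> j < length xs \<Longrightarrow> stage_ok (final_wt K (take j xs)) (xs ! j)"
proof (induction xs arbitrary: K j)
  case (Cons x xs)
  then show ?case by (cases j) auto
qed simp

lemma spawn_rate_nonneg: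
  assumes "stages_ok K xs" "j < length xs"
  shows "0 \<le> spawn_rate xs j"
proof -
  have "stage_ok (final_wt K (take j xs)) (xs ! j)"
    using assms by (rule stages_ok_nth)
  then show ?thesis unfolding spawn_rate_def
    by (cases "(final_wt K (take j xs), xs ! j)" rule: stage_ok.cases) auto
qed

text \<open>A family line has at most \<open>length xs + 1\<close> nodes, and there is one line plus
  one for every birth. \<open>visits\<close> with \<open>spawn_rate\<close> yields an upper bound
  for the expected number of births.\<close>

lemma work_mean_tree:
  assumes "stages_ok K xs" "\<And>v. 0 \<le> K v"
  shows "work_mean (tree v xs (z, A))
    \<le> (length xs + 1) * (1 + K z * visits (spawn_rate xs) (map stage_arc xs) z A)"
  using assms
proof (induction xs arbitrary: K z A)
  case Nil
  then show ?case by (simp add: work_mean_def visits_Nil)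
next
  case (Cons x xs)
  obtain u w p a b k where x: "x = Stage (u, w, p) a b k" by (metis stage.exhaust prod.exhaust)
  let ?D = "visits (spawn_rate xs) (map stage_arc xs)"
  let ?L = "real (length xs + 1)"
  define V where "V = visits (spawn_rate (x # xs)) (map stage_arc (x # xs)) z A"
  have ok: "stage_ok K (Stage (u, w, p) a b k)" using Cons.prems x by simp
  have okx: "stage_ok K x" using Cons.prems by simp
  have V: "K z * V = (if z = u then b else 0) + K z * lin (stage_arc x) ?D z A"
    using ok by (auto simp: V_def visits_Cons x spawn_rate_def[abs_def] algebra_simps simp del: grow.simps)
  have "0 \<le> visits (spawn_rate (x # xs)) (map stage_arc (x # xs)) z A"
    using spawn_rate_nonneg[OF Cons.prems(1)] stages_ok_arcs[OF Cons.prems(1)]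
    by (intro visits_nonneg) auto
  then have V0: "0 \<le> K z * V" unfolding V_def using Cons.prems(2) by simp
  have fin: "integrable (measure_pmf (children x (z, A))) f" for f :: "particle list \<Rightarrow> real"
    by (intro integrable_measure_pmf_finite finite_children)
  have IH: "work_mean (tree v xs pt) \<le> ?L * (1 + next_wt K x (fst pt) * ?D (fst pt) (snd pt))" for pt
    using Cons.IH[of "next_wt K x" "fst pt" "snd pt"] Cons.prems stage_ok_next_wt[OF okx] by simp
  have "work_mean (tree v (x # xs) (z, A)) \<le> 1 + measure_pmf.expectation (children x (z, A))
      (\<lambda>ps. \<Sum>pt\<leftarrow>ps. ?L * (1 + next_wt K x (fst pt) * ?D (fst pt) (snd pt)))"
    unfolding tree_moments total_sum_list
    by (intro add_left_mono integral_mono fin sum_list_mono IH)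
  also have "\<dots> = 1 + ?L * (measure_pmf.expectation (children x (z, A)) (\<lambda>ps. \<Sum>pt\<leftarrow>ps. 1)
      + measure_pmf.expectation (children x (z, A)) (\<lambda>ps. \<Sum>pt\<leftarrow>ps. next_wt K x (fst pt) * ?D (fst pt) (snd
          pt)))"
    by (simp only: sum_list_const_mult sum_list_addf integral_mult_right_zero fin
        Bochner_Integration.integral_add)
  \<comment> \<open>Deaths and the condition that \<open>w\<close> is new are dropped here; what
    remains is the source term of \<open>visits\<close>.\<close>
  also have "measure_pmf.expectation (children x (z, A)) (\<lambda>ps. \<Sum>pt\<leftarrow>ps. 1) \<le> 1 + (if z = u then b else 0)"
    unfolding x expectation_children_sum[OF ok] using ok by (auto simp: divide_le_eq_1)
  also have "measure_pmf.expectation (children x (z, A)) (\<lambda>ps. \<Sum>pt\<leftarrow>ps. next_wt K x (fst pt) * ?D (fst pt)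
      (snd pt))
      = K z * lin (stage_arc x) ?D z A"
    by (rule expectation_children_weighted[OF okx])
  also have "1 + ?L * (1 + (if z = u then b else 0) + K z * lin (stage_arc x) ?D z A)
      = 1 + ?L * (1 + K z * V)" using V by simp
  also have "\<dots> \<le> real (length (x # xs) + 1) * (1 + K z * V)"
    using V0 by (simp add: algebra_simps)
  finally show ?case by (simp add: V_def)
qed

text \<open>The source term of a branching at \<open>u\<close> is at most twice the squared weight
  of \<open>u\<close> times the squared chance of still reaching \<open>v\<close>. One of the two
  weights is split off as the factor \<open>K z\<close> in front of \<open>visits\<close>.\<close>

definition split_rate :: "nat \<Rightarrow> (nat \<Rightarrow> real) \<Rightarrow> stage list \<Rightarrow> nat \<Rightarrow> real" where
  "split_rate v K xs j = (let u = fst (stage_arc (xs ! j)) in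
     final_wt K (take j xs) u * (hit v (map stage_arc (drop j xs)) {u})\<^sup>2)"

text \<open>
  The descendants of siblings are independent, so the second moment obeys the linear recursion of the first
  moment up to a source term for each branching, which is the product of two means.
\<close>

lemma count_square_tree:
  assumes "stages_ok K xs" "\<And>v. 0 \<le> K v" "z \<in> A"
  shows "(final_wt K xs v)\<^sup>2 * count_square (tree v xs (z, A))
    \<le> final_wt K xs v * K z * canon v (map stage_arc xs) z A
      + 2 * K z * visits (split_rate v K xs) (map stage_arc xs) z A"
  using assms
proof (induction xs arbitrary: K z A)
  case Nil
  then show ?case by (simp add: count_square_def visits_Nil power2_eq_square)
next
  case (Cons x xs)
  obtain u w p a b k where x: "x = Stage (u, w, p) a b k" by (metis stage.exhaust prod.exhaust)
  let ?K = "next_wt K x"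
  let ?es = "map stage_arc xs"
  let ?F = "final_wt ?K xs v"
  let ?q = "\<lambda>z A. ?F\<^sup>2 * count_square (tree v xs (z, A))"
  let ?c = "\<lambda>z A. ?F * count_mean (tree v xs (z, A))"
  let ?C = "canon v ?es"
  let ?V = "visits (split_rate v ?K xs) ?es"
  let ?f = "\<lambda>z A. ?F * ?C z A + 2 * ?V z A"
  let ?G = "grow (u, w, p) A"
  let ?h = "hit v (stage_arc x # ?es) {u}"
  have ok: "stage_ok K (Stage (u, w, p) a b k)" and okx: "stage_ok K x" using Cons.prems x by simp_all
  have p: "0 \<le> p" "p \<le> 1" and uw: "u \<noteq> w" using ok by simp_all
  have ab: "0 \<le> a" "a \<le> 1" "0 \<le> b" "b \<le> 1" using ok by (auto simp: divide_le_eq_1)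
  have oks: "list_all arc_ok ?es" "list_all arc_ok (map stage_arc (x # xs))"
    using stages_ok_arcs[OF Cons.prems(1)] by auto
  have G: "A \<subseteq> ?G" by auto
  have IH: "?q z A \<le> ?K z * ?f z A" if "z \<in> A" for z A
  proof -
    have "?F\<^sup>2 * count_square (tree v xs (z, A)) \<le> ?F * ?K z * ?C z A + 2 * ?K z * ?V z A"
      using Cons.prems that by (intro Cons.IH stage_ok_next_wt[OF okx]) auto
    then show ?thesis by (simp add: algebra_simps)
  qed
  have c: "?c z A = ?K z * ?C z A" for z A
    using Cons.prems by (intro count_mean_tree) auto
  \<comment> \<open>The mixed term of parent and offspring. All other terms are linear in the second
    moments of the subtrees.\<close>
  define X where "X = (if z = u \<and> w \<notin> A then 2 * (b * ?c w (insert w A)) * (p * ?c z ?G + (1 - p) * ?c z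
      A) else 0)"
  have "(final_wt K (x # xs) v)\<^sup>2 * count_square (tree v (x # xs) (z, A)) =
     (if z = w then a else 1) * (p * ?q z ?G + (1 - p) * ?q z A) +
     (if z = u \<and> w \<notin> A then b * ?q w (insert w A) else 0) + X"
    unfolding tree_moments x expectation_children[OF ok] X_def using uw
    by (simp add: tree_total_moments algebra_simps power2_eq_square del: grow.simps total.simps)
  also have "\<dots> \<le> (if z = w then a else 1) * (p * (?K z * ?f z ?G) + (1 - p) * (?K z * ?f z A)) +
     (if z = u \<and> w \<notin> A then b * (?K w * ?f w (insert w A)) else 0) + X"
    using p ab Cons.prems(3) G
    by (intro add_mono mult_left_mono IH order_refl) (auto simp del: grow.simps intro!: mult_left_mono IH)
  also have "\<dots> = K z * lin (stage_arc x) ?f z A + X"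
  proof -
    have "(if z = w then a else 1) * (p * (?K z * ?f z ?G) + (1 - p) * (?K z * ?f z A)) +
     (if z = u \<and> w \<notin> A then b * (?K w * ?f w (insert w A)) else 0)
      = measure_pmf.expectation (children x (z, A)) (\<lambda>ps. \<Sum>pt\<leftarrow>ps. next_wt K x (fst pt) * ?f (fst pt) (snd
          pt))"
      unfolding x expectation_children_sum[OF ok] by simp
    then show ?thesis using expectation_children_weighted[OF okx, of z A ?f] by simp
  qed
  also have "X \<le> 2 * K z * (split_rate v K (x # xs) 0 * of_bool (z = u))"
  proof (cases "z = u \<and> w \<notin> A")
    case False
    then show ?thesis using Cons.prems(2) hit_nonneg[OF oks(2)]
      by (auto simp: X_def split_rate_def Let_def)
  next
    case True
    have "?C w (insert w A) \<ge> 0" "?C z ?G \<ge> 0" "?C z A \<ge> 0" using canon_nonneg[OF oks(1)] by auto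
    \<comment> \<open>Both sibling means are summands of one canonical probability, which is at most
      \<open>?h\<close>; by nonnegativity each summand is at most \<open>?h\<close> as well.\<close>
    moreover have "canon v (stage_arc x # ?es) z A \<le> ?h"
      using canon_le_hit[OF oks(2), of z A v] True Cons.prems by simp
    moreover have "canon v (stage_arc x # ?es) z A = p * ?C z ?G + (1 - p) * ?C z A + p * ?C w (insert w A)"
      using True by (simp add: x del: grow.simps)
    moreover from calculation p
    have nn: "0 \<le> p * ?C w (insert w A)" "0 \<le> p * ?C z ?G + (1 - p) * ?C z A"
      by (simp_all del: grow.simps canon.simps)
    ultimately have le: "p * ?C w (insert w A) \<le> ?h" "p * ?C z ?G + (1 - p) * ?C z A \<le> ?h"
      by linarith+
    have "X = 2 * (b * k * ?C w (insert w A)) * (p * (K u * ?C z ?G) + (1 - p) * (K u * ?C z A))"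
      unfolding X_def c using True uw by (simp add: x del: grow.simps)
    also have "\<dots> = 2 * (K u)\<^sup>2 * ((p * ?C w (insert w A)) * (p * ?C z ?G + (1 - p) * ?C z A))"
      unfolding stage_ok_mult[OF ok] by (simp add: algebra_simps power2_eq_square del: grow.simps)
    also have "\<dots> \<le> 2 * (K u)\<^sup>2 * (?h * ?h)"
      using le nn by (intro mult_left_mono mult_mono) (auto simp del: grow.simps)
    also have "\<dots> = 2 * K z * (split_rate v K (x # xs) 0 * of_bool (z = u))"
      using True by (simp add: split_rate_def Let_def power2_eq_square x del: grow.simps hit.simps)
    finally show ?thesis .
  qed
  also have "K z * lin (stage_arc x) ?f z A + 2 * K z * (split_rate v K (x # xs) 0 * of_bool (z = u))
    = final_wt K (x # xs) v * K z * canon v (map stage_arc (x # xs)) z A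
      + 2 * K z * visits (split_rate v K (x # xs)) (map stage_arc (x # xs)) z A"
  proof -
    have "lin (stage_arc x) ?f z A = ?F * lin (stage_arc x) ?C z A + 2 * lin (stage_arc x) ?V z A"
      by (simp add: x algebra_simps del: grow.simps)
    moreover have "(\<lambda>j. split_rate v K (x # xs) (Suc j)) = split_rate v ?K xs"
      by (simp add: split_rate_def fun_eq_iff)
    ultimately show ?thesis by (simp add: visits_Cons x algebra_simps del: lin.simps grow.simps)
  qed
  finally show ?case by simp
qed

section \<open>The stack machine\<close>

type_synonym config = "(stage list \<times> particle) list \<times> nat"

text \<open>One step per node of the family tree. The empty stack idles, so the machine can always
  be run for exactly \<open>F\<close> steps.\<close>

fun micro :: "nat \<Rightarrow> config \<Rightarrow> config pmf" where
  "micro v ([], c) = return_pmf ([], c)"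
| "micro v (([], pt) # S, c) = return_pmf (S, c + of_bool (fst pt = v))"
| "micro v ((x # xs, pt) # S, c) = map_pmf (\<lambda>ps. (map (Pair xs) ps @ S, c)) (children x pt)"

definition grove :: "nat \<Rightarrow> (stage list \<times> particle) list \<Rightarrow> (nat \<times> nat) pmf" where
  "grove v S = total (\<lambda>(xs, pt). tree v xs pt) S"

lemma finite_grove: "finite (set_pmf (grove v S))"
  unfolding grove_def by (intro finite_total) (auto intro: finite_tree)

lemma finite_micro: "finite (set_pmf (micro v x))"
  by (cases "(v, x)" rule: micro.cases) (auto intro: finite_children)

lemma finite_iterate: "(\<And>x. finite (set_pmf (f x))) \<Longrightarrow> finite (set_pmf (iterate_pmf k f x))"
  by (induction k arbitrary: x) auto

lemma total_append:
  "total f (xs @ ys) = total f xs \<bind> (\<lambda>a. map_pmf (\<lambda>b. (fst a + fst b, snd a + snd b)) (total f ys))"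
  by (induction xs) (simp_all add: bind_return_pmf bind_assoc_pmf map_bind_pmf bind_map_pmf
      pmf.map_comp o_def add.assoc)

lemma total_map: "total f (map h xs) = total (\<lambda>x. f (h x)) xs"
  by (induction xs) simp_all

lemma grove_step:
  "grove v ((x # xs, pt) # S) = children x pt \<bind> (\<lambda>ps. map_pmf (map_prod id Suc) (grove v (map (Pair xs) ps
      @ S)))"
  by (simp add: grove_def total_append total_map bind_assoc_pmf bind_map_pmf map_bind_pmf
      pmf.map_comp o_def map_prod_def case_prod_unfold)

lemma tree_work_pos: "x \<in> set_pmf (tree v xs pt) \<Longrightarrow> 0 < snd x"
  by (cases xs) auto

lemma grove_work_pos: "x \<in> set_pmf (grove v (y # S)) \<Longrightarrow> 0 < snd x"
  by (auto simp: grove_def split: prod.splits dest!: tree_work_pos)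

lemma iterate_micro_Nil: "iterate_pmf F (micro v) ([], c) = return_pmf ([], c)"
  by (induction F) (simp_all add: bind_return_pmf)

text \<open>Depth-first processing uses the coins of the trees, and the work of \<open>grove\<close>
  is the number of steps until the stack is empty. Runs over budget count as 0 on the left, while on
  the right they contribute some value of \<open>g\<close>, which is nonnegative.\<close>

lemma expectation_machine:
  fixes g :: "nat \<Rightarrow> real"
  assumes g: "\<And>c. 0 \<le> g c"
  shows "measure_pmf.expectation (grove v S) (\<lambda>x. if snd x \<le> F then g (c + fst x) else 0)
    \<le> measure_pmf.expectation (iterate_pmf F (micro v) (S, c)) (\<lambda>x. g (snd x))"
proof (induction F arbitrary: S c)
  case 0
  show ?case
  proof (cases S)
    case Nil
    then show ?thesis by (simp add: grove_def)
  next
    case (Cons y S')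
    have "measure_pmf.expectation (grove v S) (\<lambda>x. if snd x \<le> 0 then g (c + fst x) else 0)
      = measure_pmf.expectation (grove v S) (\<lambda>x. 0)"
      unfolding Cons by (intro integral_cong_AE) (auto simp: AE_measure_pmf_iff dest!: grove_work_pos)
    then show ?thesis using g by simp
  qed
next
  case (Suc F)
  have fin: "finite (set_pmf (iterate_pmf F (micro v) x))" for x
    by (intro finite_iterate finite_micro)
  consider "S = []" | pt S' where "S = ([], pt) # S'" | x xs pt S' where "S = (x # xs, pt) # S'"
    by (metis list.exhaust prod.exhaust)
  then show ?case
  proof cases
    case 1
    then show ?thesis by (simp add: grove_def iterate_micro_Nil bind_return_pmf)
  next
    case 2
    have "measure_pmf.expectation (grove v S) (\<lambda>x. if snd x \<le> Suc F then g (c + fst x) else 0)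
      = measure_pmf.expectation (grove v S') (\<lambda>x. if snd x \<le> F then g (c + of_bool (fst pt = v) + fst x)
          else 0)"
      by (simp add: 2 grove_def bind_return_pmf add.assoc cong: if_cong)
    also have "\<dots> \<le> measure_pmf.expectation (iterate_pmf F (micro v) (S', c + of_bool (fst pt = v))) (\<lambda>x. g
        (snd x))"
      by (rule Suc.IH)
    finally show ?thesis by (simp add: 2 bind_return_pmf)
  next
    case 3
    have "measure_pmf.expectation (grove v S) (\<lambda>x. if snd x \<le> Suc F then g (c + fst x) else 0)
      = measure_pmf.expectation (children x pt) (\<lambda>ps. measure_pmf.expectation (grove v (map (Pair xs) ps @
          S'))
          (\<lambda>x. if snd x \<le> F then g (c + fst x) else 0))"
      unfolding 3 grove_step
      by (subst expectation_bind_finite) (auto intro: finite_children finite_grove cong: if_cong)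
    also have "\<dots> \<le> measure_pmf.expectation (children x pt) (\<lambda>ps.
        measure_pmf.expectation (iterate_pmf F (micro v) (map (Pair xs) ps @ S', c)) (\<lambda>x. g (snd x)))"
      by (intro integral_mono Suc.IH integrable_measure_pmf_finite finite_children)
    also have "\<dots> = measure_pmf.expectation (iterate_pmf (Suc F) (micro v) (S, c)) (\<lambda>x. g (snd x))"
      by (simp add: 3 bind_map_pmf expectation_bind_finite finite_children fin)
    finally show ?thesis .
  qed
qed

section \<open>Concentration of the count under a step budget\<close>

lemma grove_replicate_moments:
  fixes v :: nat and xs :: "stage list" and pt :: particle
  defines "M \<equiv> tree v xs pt" and "G \<equiv> \<lambda>N. grove v (replicate N (xs, pt))"
  shows "count_mean (G N) = N * count_mean M" "work_mean (G N) = N * work_mean M"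
    "count_square (G N) = N * count_square M + N * (real N - 1) * (count_mean M)\<^sup>2"
proof -
  have fin: "finite (set_pmf (case y of (xs, pt) \<Rightarrow> tree v xs pt))" for y
    by (cases y) (simp add: finite_tree)
  have 1: "count_mean (G N) = N * count_mean M" "work_mean (G N) = N * work_mean M" for N
    by (induction N) (simp_all add: G_def M_def grove_def total_moments[OF fin] algebra_simps del:
        total.simps)
  show "count_square (G N) = N * count_square M + N * (real N - 1) * (count_mean M)\<^sup>2"
  proof (induction N)
    case (Suc N)
    have "count_square (G (Suc N)) = count_square M + 2 * count_mean M * count_mean (G N) + count_square
        (G N)"
      by (simp add: G_def M_def grove_def total_moments[OF fin] del: total.simps)
    then show ?case using Suc by (simp add: 1 algebra_simps power2_eq_square)
  qed (simp add: G_def grove_def total_moments[OF fin] del: total.simps)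
  show "count_mean (G N) = N * count_mean M" "work_mean (G N) = N * work_mean M" by (fact 1)+
qed

lemma markov_pmf:
  fixes f :: "'a \<Rightarrow> real"
  assumes "finite (set_pmf M)" "\<And>x. 0 \<le> f x" "0 < a"
  shows "measure_pmf.prob M {x. a \<le> f x} \<le> measure_pmf.expectation M f / a"
  using integral_Markov_inequality_measure[of "measure_pmf M" f UNIV a] assms
  by (auto intro!: integrable_measure_pmf_finite)

lemma machine_concentration:
  assumes N: "0 < N" and \<mu>: "\<mu> = count_mean (tree v xs pt)" "0 < \<mu>"
    and sq: "count_square (tree v xs pt) \<le> B * \<mu>\<^sup>2" and wk: "work_mean (tree v xs pt) \<le> W"
    and \<delta>: "0 < \<delta>" and F: "0 < F"
  shows "measure_pmf.prob (iterate_pmf F (micro v) (replicate N (xs, pt), 0))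
      {x. \<bar>real (snd x) - N * \<mu>\<bar> < \<delta> * (N * \<mu>)} \<ge> 1 - B / (N * \<delta>\<^sup>2) - N * W / F"
proof -
  let ?G = "grove v (replicate N (xs, pt))"
  define A where "A = {c::nat. \<bar>real c - N * \<mu>\<bar> < \<delta> * (N * \<mu>)}"
  have fin: "finite (set_pmf ?G)" by (rule finite_grove)
  have int: "integrable (measure_pmf ?G) f" for f :: "_ \<Rightarrow> real"
    by (intro integrable_measure_pmf_finite fin)
  have a: "0 < (\<delta> * (N * \<mu>))\<^sup>2" using assms by simp
  have "measure_pmf.prob ?G {x. fst x \<notin> A} \<le> measure_pmf.prob ?G {x. (\<delta> * (N * \<mu>))\<^sup>2 \<le> (real (fst x) - N *
      \<mu>)\<^sup>2}"
  proof (intro measure_pmf.finite_measure_mono)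
    have "(\<delta> * (N * \<mu>))\<^sup>2 \<le> (real c - N * \<mu>)\<^sup>2" if "c \<notin> A" for c
      using that \<mu> \<delta> by (auto simp: A_def power2_le_iff_abs_le[symmetric] abs_le_square_iff[symmetric])
    then show "{x :: nat \<times> nat. fst x \<notin> A} \<subseteq> {x. (\<delta> * (N * \<mu>))\<^sup>2 \<le> (real (fst x) - N * \<mu>)\<^sup>2}" by auto
  qed simp
  also have "\<dots> \<le> measure_pmf.expectation ?G (\<lambda>x. (real (fst x) - N * \<mu>)\<^sup>2) / (\<delta> * (N * \<mu>))\<^sup>2"
    by (intro markov_pmf fin a) auto
  finally have cheb: "measure_pmf.prob ?G {x. fst x \<notin> A} \<le> \<dots>" .
  have "measure_pmf.expectation ?G (\<lambda>x. (real (fst x) - N * \<mu>)\<^sup>2)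
      = count_square ?G - 2 * (N * \<mu>) * count_mean ?G + (N * \<mu>)\<^sup>2"
    by (simp add: moment_defs power2_diff int algebra_simps)
  also have "\<dots> = N * (count_square (tree v xs pt) - \<mu>\<^sup>2)"
    unfolding grove_replicate_moments \<mu>(1)[symmetric] by (simp add: algebra_simps power2_eq_square)
  also have "\<dots> \<le> N * (B * \<mu>\<^sup>2)"
    using sq zero_le_power2[of \<mu>] by (intro mult_left_mono) (linarith, simp)
  finally have "measure_pmf.expectation ?G (\<lambda>x. (real (fst x) - N * \<mu>)\<^sup>2) / (\<delta> * (N * \<mu>))\<^sup>2
      \<le> N * (B * \<mu>\<^sup>2) / (\<delta> * (N * \<mu>))\<^sup>2"
    by (intro divide_right_mono) simp_all
  also have "\<dots> = B / (N * \<delta>\<^sup>2)"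
    using N \<mu>(2) \<delta> by (simp add: power2_eq_square field_simps)
  finally have 1: "measure_pmf.prob ?G {x. fst x \<notin> A} \<le> B / (N * \<delta>\<^sup>2)"
    using cheb by simp
  have "measure_pmf.prob ?G {x. real F \<le> real (snd x)} \<le> work_mean ?G / F"
    unfolding work_mean_def using F by (intro markov_pmf fin) auto
  also have "\<dots> \<le> N * W / F"
    unfolding grove_replicate_moments using wk by (intro divide_right_mono mult_left_mono) auto
  finally have 2: "measure_pmf.prob ?G {x. F \<le> snd x} \<le> N * W / F" by simp
  have "1 = measure_pmf.prob ?G UNIV" by simp
  also have "\<dots> \<le> measure_pmf.prob ?G ({x. fst x \<in> A \<and> snd x \<le> F} \<union> ({x. fst x \<notin> A} \<union> {x. F \<le> snd x}))"
    by (intro measure_pmf.finite_measure_mono) auto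
  also have "\<dots> \<le> measure_pmf.prob ?G {x. fst x \<in> A \<and> snd x \<le> F} + (measure_pmf.prob ?G {x. fst x \<notin> A}
      + measure_pmf.prob ?G {x. F \<le> snd x})"
    by (intro order_trans[OF measure_Un_le] add_left_mono order_refl) auto
  finally have 3: "1 - B / (N * \<delta>\<^sup>2) - N * W / F \<le> measure_pmf.prob ?G {x. fst x \<in> A \<and> snd x \<le> F}"
    using 1 2 by linarith
  \<comment> \<open>The event of an accurate count within the budget is rewritten into the form of
    \<open>expectation_machine\<close>, with the indicator of the accurate counts as
    \<open>g\<close>.\<close>
  have "measure_pmf.prob ?G {x. fst x \<in> A \<and> snd x \<le> F}
      = measure_pmf.expectation ?G (indicator {x. fst x \<in> A \<and> snd x \<le> F})" by simp
  also have "\<dots> = measure_pmf.expectation ?G (\<lambda>x. if snd x \<le> F then indicator A (0 + fst x) else 0)"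
    by (intro Bochner_Integration.integral_cong) (auto simp: indicator_def)
  also have "\<dots> \<le> measure_pmf.expectation (iterate_pmf F (micro v) (replicate N (xs, pt), 0)) (\<lambda>x.
      indicator A (snd x))"
    by (rule expectation_machine) auto
  also have "\<dots> = measure_pmf.expectation (iterate_pmf F (micro v) (replicate N (xs, pt), 0))
      (indicator {x. snd x \<in> A})"
    by (intro Bochner_Integration.integral_cong) (auto simp: indicator_def)
  also have "\<dots> = measure_pmf.prob (iterate_pmf F (micro v) (replicate N (xs, pt), 0)) {x. snd x \<in> A}" by
      simp
  finally show ?thesis using 3 by (simp add: A_def)
qed

section \<open>Phases\<close>

lemma hit_snoc_other: "v \<noteq> w \<Longrightarrow> hit v (es @ [(u, w, p)]) A = hit v es A"
  by (induction es arbitrary: A) (auto simp: algebra_simps)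

text \<open>The appended arc can add only \<open>w\<close>, and its coin is independent of the set
  on which it acts. Each of the two ways to reach \<open>w\<close> gives a lower bound, their union
  the upper one. The lower bounds control both the maximum in \<open>revised_wt\<close> and the
  provisional weight in \<open>phase_good\<close>.\<close>

lemma hit_snoc_bounds:
  assumes "list_all arc_ok es" "arc_ok (u, w, p)"
  shows "hit w es A \<le> hit w (es @ [(u, w, p)]) A \<and> p * hit u es A \<le> hit w (es @ [(u, w, p)]) A \<and>
    hit w (es @ [(u, w, p)]) A \<le> hit w es A + p * hit u es A"
  using assms(1)
proof (induction es arbitrary: A)
  case Nil
  then show ?case using assms(2) by auto
next
  case (Cons e es)
  define r where "r = snd (snd e)"
  have r: "0 \<le> r" "0 \<le> 1 - r" using Cons.prems unfolding r_def by (cases e; simp)+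
  have ok: "list_all arc_ok es" using Cons.prems by simp
  note I = Cons.IH[OF ok, of "grow e A"] Cons.IH[OF ok, of A]
  have "r * hit w es (grow e A) + (1 - r) * hit w es A
      \<le> r * hit w (es @ [(u, w, p)]) (grow e A) + (1 - r) * hit w (es @ [(u, w, p)]) A"
    using I r by (intro add_mono mult_left_mono) auto
  moreover have "r * (p * hit u es (grow e A)) + (1 - r) * (p * hit u es A)
      \<le> r * hit w (es @ [(u, w, p)]) (grow e A) + (1 - r) * hit w (es @ [(u, w, p)]) A"
    using I r by (intro add_mono mult_left_mono) auto
  moreover have "r * hit w (es @ [(u, w, p)]) (grow e A) + (1 - r) * hit w (es @ [(u, w, p)]) A
     \<le> r * (hit w es (grow e A) + p * hit u es (grow e A)) + (1 - r) * (hit w es A + p * hit u es A)"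
    using I r by (intro add_mono mult_left_mono) auto
  ultimately show ?case by (simp add: r_def[symmetric] algebra_simps)
qed

definition start_wt :: "nat \<Rightarrow> nat \<Rightarrow> real" where
  "start_wt s v = of_bool (v = s)"

definition accurate :: "nat \<Rightarrow> real \<Rightarrow> arc list \<Rightarrow> (nat \<Rightarrow> real) \<Rightarrow> bool" where
  "accurate s \<delta> es K \<longleftrightarrow> (\<forall>v. approximates \<delta> (hit v es {s}) (K v))"

text \<open>Accuracy is recorded for every earlier time because the moments of a tree depend on the
  weight that each tail had when its arc was revealed.\<close>

definition good :: "nat \<Rightarrow> real \<Rightarrow> arc list \<Rightarrow> nat \<Rightarrow> (nat \<Rightarrow> real) \<times> stage list \<Rightarrow> bool" where
  "good s \<delta> es i x \<longleftrightarrow> (case x of (K, xs) \<Rightarrow> map stage_arc xs = take i es \<and> stages_ok (start_wt s) xs \<and>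
     K = final_wt (start_wt s) xs \<and>
     (\<forall>j\<le>i. accurate s \<delta> (take j es) (final_wt (start_wt s) (take j xs))))"

text \<open>
  Taking the maximum keeps the survival and branching probabilities of the new stage below 1. It does not spoil
  the accuracy because the true probability dominates the true values of the same two quantities.
\<close>

definition revised_wt :: "arc \<Rightarrow> (nat \<Rightarrow> real) \<Rightarrow> real \<Rightarrow> real" where
  "revised_wt e K r = (case e of (u, w, p) \<Rightarrow> max (max ((K w + p * K u) * r) (K w)) (p * K u))"

definition mk_stage :: "arc \<Rightarrow> (nat \<Rightarrow> real) \<Rightarrow> real \<Rightarrow> stage" where
  "mk_stage e K \<kappa> = (case e of (u, w, p) \<Rightarrow> Stage e (K w / \<kappa>) (p * K u / \<kappa>) \<kappa>)"

text \<open>The new stage needs a weight for \<open>w\<close> before there is an estimate. The sum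
  \<open>K w + p * K u\<close> dominates both terms, so the trial stage is admissible; the mean
  count of a root is the true probability divided by this sum, and \<open>revised_wt\<close>
  multiplies by the sum again.\<close>

fun phase :: "nat \<Rightarrow> nat \<Rightarrow> nat \<Rightarrow> arc \<Rightarrow> (nat \<Rightarrow> real) \<times> stage list \<Rightarrow> ((nat \<Rightarrow> real) \<times> stage list) pmf" where
  "phase N F s (u, w, p) (K, xs) =
     map_pmf (\<lambda>x. let \<kappa> = revised_wt (u, w, p) K (real (snd x) / real N)
         in (K(w := \<kappa>), xs @ [mk_stage (u, w, p) K \<kappa>]))
       (iterate_pmf F (micro w)
         (replicate N (xs @ [mk_stage (u, w, p) K (K w + p * K u)], (s, {s})), 0))"

lemma accurate_nonneg:
  assumes "accurate s \<delta> es K" "list_all arc_ok es" "\<delta> \<le> 1 / 2"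
  shows "0 \<le> K v"
proof -
  have "0 \<le> (1 - \<delta>) * hit v es {s}" using assms by (intro mult_nonneg_nonneg hit_nonneg) auto
  also have "\<dots> \<le> K v" using assms by (simp add: accurate_def approximates_def)
  finally show ?thesis .
qed

lemma accurate_factor2:
  assumes "accurate s \<delta> es K" "list_all arc_ok es" "0 < \<delta>" "\<delta> \<le> 1 / 2"
  shows "hit v es {s} \<le> 2 * K v" "K v \<le> 3 / 2 * hit v es {s}"
proof -
  have h: "0 \<le> hit v es {s}" using assms by (intro hit_nonneg) auto
  have "1 / 2 * hit v es {s} \<le> (1 - \<delta>) * hit v es {s}" "(1 + \<delta>) * hit v es {s} \<le> 3 / 2 * hit v es {s}"
    using assms h by (intro mult_right_mono; simp)+
  then show "hit v es {s} \<le> 2 * K v" "K v \<le> 3 / 2 * hit v es {s}"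
    using assms(1) unfolding accurate_def approximates_def by (auto dest!: spec[of _ v])
qed

text \<open>By \<open>hit_append\<close> every arc contributes at most \<open>2 R^2\<close> to the
  branching term, where \<open>R\<close> is the probability for \<open>v\<close>; and every arc has
  at most two expected births. The final weight is bounded with the larger factor 4 because the last
  stage may carry the provisional weight.\<close>

lemma tree_bounds:
  assumes ok: "stages_ok (start_wt s) xs" and len: "length xs \<le> m" and m: "0 < m"
    and low: "\<And>j. j < length xs \<Longrightarrow>
      hit (fst (stage_arc (xs ! j))) (map stage_arc (take j xs)) {s}
      \<le> 2 * final_wt (start_wt s) (take j xs) (fst (stage_arc (xs ! j)))"
    and upp: "\<And>j. j < length xs \<Longrightarrow>
      final_wt (start_wt s) (take j xs) (fst (stage_arc (xs ! j)))
      \<le> 2 * hit (fst (stage_arc (xs ! j))) (map stage_arc (take j xs)) {s}"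
    and fin: "final_wt (start_wt s) xs v \<le> 4 * hit v (map stage_arc xs) {s}"
    and pos: "0 < hit v (map stage_arc xs) {s}"
  defines "M \<equiv> tree v xs (s, {s})"
  shows "final_wt (start_wt s) xs v * count_mean M = hit v (map stage_arc xs) {s}"
    and "0 < count_mean M" and "count_square M \<le> 8 * real m * (count_mean M)\<^sup>2"
    and "work_mean M \<le> 6 * (real m)\<^sup>2"
proof -
  let ?es = "map stage_arc xs"
  let ?K = "final_wt (start_wt s)"
  let ?R = "hit v ?es {s}"
  let ?u = "\<lambda>j. fst (stage_arc (xs ! j))"
  let ?Rj = "\<lambda>j. hit (?u j) (map stage_arc (take j xs)) {s}"
  have oks: "list_all arc_ok ?es" using ok by (rule stages_ok_arcs)
  then have okt: "list_all arc_ok (map stage_arc (take j xs))" "list_all arc_ok (map stage_arc (drop j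
      xs))" for j
    by (auto simp: list_all_iff dest!: in_set_takeD in_set_dropD)
  have s0: "0 \<le> start_wt s v" for v by (simp add: start_wt_def)
  have s1: "start_wt s s = 1" by (simp add: start_wt_def)
  show mean: "?K xs v * count_mean M = ?R"
    using count_mean_tree[OF ok, of v s "{s}"] canon_start[OF oks] by (simp add: M_def s1)
  have K0: "0 \<le> ?K xs v" using ok s0 by (rule stages_ok_final_wt)
  with mean pos have K: "0 < ?K xs v" by (cases "?K xs v = 0") auto
  with mean pos show "0 < count_mean M" by (metis zero_less_mult_pos)
  have vis: "visits c ?es s {s} = (\<Sum>j<length xs. c j * ?Rj j)" for c
    unfolding visits_def using canon_start[OF okt(1)] by (auto simp: take_map intro!: sum.cong)
  have "visits (split_rate v (start_wt s) xs) ?es s {s} \<le> (\<Sum>j<length xs. 2 * ?R\<^sup>2)"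
    unfolding vis
  proof (intro sum_mono)
    fix j assume j: "j \<in> {..<length xs}"
    let ?h = "hit v (map stage_arc (drop j xs)) {?u j}"
    have h: "0 \<le> ?Rj j" "0 \<le> ?h" using hit_nonneg[OF okt(1)] hit_nonneg[OF okt(2)] by auto
    have "?Rj j * ?h \<le> hit v (map stage_arc (take j xs) @ map stage_arc (drop j xs)) {s}"
      by (intro hit_append okt)
    also have "map stage_arc (take j xs) @ map stage_arc (drop j xs) = ?es"
      by (simp flip: map_append)
    finally have le: "?Rj j * ?h \<le> ?R" .
    have "split_rate v (start_wt s) xs j * ?Rj j = ?K (take j xs) (?u j) * (?h\<^sup>2 * ?Rj j)"
      by (simp add: split_rate_def Let_def)
    also have "\<dots> \<le> 2 * ?Rj j * (?h\<^sup>2 * ?Rj j)"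
      using h upp[of j] j by (intro mult_right_mono) auto
    also have "\<dots> = 2 * (?Rj j * ?h)\<^sup>2" by (simp add: power2_eq_square)
    also have "\<dots> \<le> 2 * ?R\<^sup>2" using le h by (intro mult_left_mono power_mono) auto
    finally show "split_rate v (start_wt s) xs j * ?Rj j \<le> 2 * ?R\<^sup>2" .
  qed
  also have "\<dots> \<le> 2 * real m * ?R\<^sup>2" using len by (simp add: mult_right_mono)
  finally have V: "visits (split_rate v (start_wt s) xs) ?es s {s} \<le> 2 * real m * ?R\<^sup>2" .
  have "(?K xs v)\<^sup>2 * count_square M \<le> ?K xs v * ?R + 2 * visits (split_rate v (start_wt s) xs) ?es s {s}"
    using count_square_tree[OF ok s0, of s "{s}" v] canon_start[OF oks] by (simp add: M_def s1)
  also have "\<dots> \<le> 4 * ?R * ?R + 2 * (2 * real m * ?R\<^sup>2)"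
    using fin pos V by (intro add_mono mult_left_mono mult_right_mono) auto
  also have "\<dots> = (4 + 4 * real m) * ?R\<^sup>2" by (simp add: power2_eq_square algebra_simps)
  also have "\<dots> \<le> 8 * real m * ?R\<^sup>2" using m by (intro mult_right_mono) auto
  also have "\<dots> = (?K xs v)\<^sup>2 * (8 * real m * (count_mean M)\<^sup>2)"
    unfolding mean[symmetric] by (simp add: power_mult_distrib)
  finally show "count_square M \<le> 8 * real m * (count_mean M)\<^sup>2" using K by simp
  have "visits (spawn_rate xs) ?es s {s} \<le> (\<Sum>j<length xs. 2)"
    unfolding vis
  proof (intro sum_mono)
    fix j assume j: "j \<in> {..<length xs}"
    obtain u w p a b k where x: "xs ! j = Stage (u, w, p) a b k" by (metis stage.exhaust prod.exhaust)
    have okj: "stage_ok (?K (take j xs)) (Stage (u, w, p) a b k)"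
      using stages_ok_nth[OF ok, of j] j x by simp
    have "p * ?Rj j \<le> p * (2 * ?K (take j xs) u)" using low[of j] j x okj by (intro mult_left_mono) auto
    also have "\<dots> \<le> 2 * k" using okj by simp
    \<comment> \<open>For \<open>k = 0\<close> the quotient in \<open>spawn_rate\<close> is 0, and
      the bound is trivial.\<close>
    finally show "spawn_rate xs j * ?Rj j \<le> 2" using okj
      by (cases "k = 0") (auto simp: spawn_rate_def x field_simps)
  qed
  also have "\<dots> \<le> 2 * real m" using len by simp
  finally have V: "visits (spawn_rate xs) ?es s {s} \<le> 2 * real m" .
  have "work_mean M \<le> (length xs + 1) * (1 + visits (spawn_rate xs) ?es s {s})"
    using work_mean_tree[OF ok s0, of v s "{s}"] by (simp add: M_def s1)
  also have "\<dots> \<le> (length xs + 1) * (1 + 2 * real m)" using V by (intro mult_left_mono) auto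
  also have "\<dots> \<le> (2 * real m) * (3 * real m)" using len m by (intro mult_mono) auto
  finally show "work_mean M \<le> 6 * (real m)\<^sup>2" by (simp add: power2_eq_square)
qed

text \<open>The history \<open>x\<close> is fixed here; only the coins of the current phase are
  random.\<close>

lemma phase_good:
  assumes es: "list_all arc_ok es" and m: "m = length es" and i: "i < m"
    and \<delta>: "0 < \<delta>" "\<delta> \<le> 1 / 2" and N: "64 * real m ^ 2 / \<delta>\<^sup>2 \<le> N" and F: "48 * m ^ 3 * N \<le> F"
    and g: "good s \<delta> es i x"
  shows "measure_pmf.prob (phase N F s (es ! i) x) {y. good s \<delta> es (Suc i) y} \<ge> 1 - 1 / (4 * real m)"
proof -
  obtain K xs where x: "x = (K, xs)" by (cases x)
  obtain u w p where e: "es ! i = (u, w, p)" by (cases "es ! i") auto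
  define M where "M = K w + p * K u"
  let ?K0 = "start_wt s"
  let ?S = "mk_stage (u, w, p) K"
  let ?ys = "xs @ [?S M]"
  from g x have arcs: "map stage_arc xs = take i es" and ok: "stages_ok ?K0 xs"
    and K: "K = final_wt ?K0 xs"
    and acc: "\<And>j. j \<le> i \<Longrightarrow> accurate s \<delta> (take j es) (final_wt ?K0 (take j xs))"
    by (auto simp: good_def)
  have len: "length xs = i" using arcs i m by (metis length_map length_take min.absorb4)
  have take_ok: "list_all arc_ok (take j es)" for j using es by (auto simp: list_all_iff dest: in_set_takeD)
  have aok: "arc_ok (u, w, p)" using es i m e by (metis list_all_length)
  have take_Suc: "take (Suc i) es = take i es @ [(u, w, p)]" using i m e by (simp add:
      take_Suc_conv_app_nth)
  define R where "R = hit w (take (Suc i) es) {s}"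
  have Rb: "hit w (take i es) {s} \<le> R" "p * hit u (take i es) {s} \<le> R"
    "R \<le> hit w (take i es) {s} + p * hit u (take i es) {s}"
    using hit_snoc_bounds[OF take_ok aok, of i "{s}"] by (auto simp: R_def take_Suc)
  have accK: "accurate s \<delta> (take i es) K" using acc[of i] len K by simp
  have Kn: "0 \<le> K v" for v using accK take_ok \<delta> by (intro accurate_nonneg)
  have K2: "hit v (take i es) {s} \<le> 2 * K v" "K v \<le> 3 / 2 * hit v (take i es) {s}" for v
    using accurate_factor2[OF accK take_ok \<delta>] by auto
  have p: "0 \<le> p" "p \<le> 1" "u \<noteq> w" using aok by auto
  have pK: "0 \<le> p * K u" using p Kn by simp
  have stage: "stage_ok K (?S \<kappa>)" if "K w \<le> \<kappa>" "p * K u \<le> \<kappa>" for \<kappa>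
    using that aok Kn by (simp add: mk_stage_def)
  have next_K: "next_wt K (?S \<kappa>) = K(w := \<kappa>)" and arc_S: "stage_arc (?S \<kappa>) = (u, w, p)" for \<kappa>
    by (simp_all add: mk_stage_def)
  have R0: "0 \<le> R" unfolding R_def by (intro hit_nonneg take_ok)
  have upper: "K w \<le> (1 + \<delta>) * R" "p * K u \<le> (1 + \<delta>) * R"
  proof -
    have "K w \<le> (1 + \<delta>) * hit w (take i es) {s}" using accK by (simp add: accurate_def approximates_def)
    also have "\<dots> \<le> (1 + \<delta>) * R" using Rb \<delta> by (intro mult_left_mono) auto
    finally show "K w \<le> (1 + \<delta>) * R" .
    have "p * K u \<le> p * ((1 + \<delta>) * hit u (take i es) {s})"
      using accK p by (intro mult_left_mono) (auto simp: accurate_def approximates_def)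
    also have "\<dots> = (1 + \<delta>) * (p * hit u (take i es) {s})" by simp
    also have "\<dots> \<le> (1 + \<delta>) * R" using Rb \<delta> by (intro mult_left_mono) auto
    finally show "p * K u \<le> (1 + \<delta>) * R" .
  qed
  have succ: "good s \<delta> es (Suc i) (K(w := \<kappa>), xs @ [?S \<kappa>])"
    if \<kappa>: "K w \<le> \<kappa>" "p * K u \<le> \<kappa>" "approximates \<delta> R \<kappa>" for \<kappa>
  proof -
    have "accurate s \<delta> (take j es) (final_wt ?K0 (take j (xs @ [?S \<kappa>])))" if "j \<le> Suc i" for j
    proof (cases "j = Suc i")
      case True
      have "accurate s \<delta> (take (Suc i) es) (K(w := \<kappa>))"
        unfolding accurate_def
      proof
        fix v
        show "approximates \<delta> (hit v (take (Suc i) es) {s}) ((K(w := \<kappa>)) v)"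
        proof (cases "v = w")
          case True
          then show ?thesis using \<kappa> by (simp add: R_def)
        next
          case False
          then show ?thesis using accK by (simp add: take_Suc hit_snoc_other accurate_def)
        qed
      qed
      then show ?thesis using True len by (simp add: K[symmetric] next_K)
    next
      case False
      then show ?thesis using acc[of j] that len by simp
    qed
    then show ?thesis using ok stage[OF \<kappa>(1,2)] arcs
      by (simp add: good_def K[symmetric] next_K arc_S take_Suc)
  qed
  define Z where "Z = iterate_pmf F (micro w) (replicate N (?ys, (s, {s})), 0)"
  define \<kappa> where "\<kappa> c = revised_wt (u, w, p) K (real c / real N)" for c
  have phase: "phase N F s (es ! i) x = map_pmf (\<lambda>y. (K(w := \<kappa> (snd y)), xs @ [?S (\<kappa> (snd y))])) Z"
    by (simp add: x e Z_def \<kappa>_def M_def Let_def)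
  have \<kappa>_ge: "K w \<le> \<kappa> c" "p * K u \<le> \<kappa> c" for c by (auto simp: \<kappa>_def revised_wt_def)
  show ?thesis
  proof (cases "R = 0")
    \<comment> \<open>A relative error leaves no room around 0. But then both old terms vanish, so
      the revised weight is 0 for every outcome of the count.\<close>
    case True
    then have "K w = 0" "p * K u = 0" using upper Kn[of w] pK by auto
    then have "\<kappa> c = 0" for c by (auto simp: \<kappa>_def revised_wt_def)
    then have "good s \<delta> es (Suc i) (K(w := \<kappa> c), xs @ [?S (\<kappa> c)])" for c
      using succ[OF \<kappa>_ge[of c]] True by (simp add: approximates_def)
    then show ?thesis unfolding phase by simp
  next
    case False
    then have Rpos: "0 < R" using R0 by simp
    have okys: "stages_ok ?K0 ?ys"
      using ok stage[of M] pK Kn[of w] by (simp add: K[symmetric] M_def)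
    have fys: "final_wt ?K0 ?ys w = M" using K by (simp add: next_K K[symmetric])
    have arcs_ys: "map stage_arc ?ys = take (Suc i) es" by (simp add: arcs arc_S take_Suc)
    have ys_nth: "take j ?ys = take j xs" "stage_arc (?ys ! j) = es ! j" "map stage_arc (take j ?ys) =
        take j es"
      if "j < length ?ys" for j
    proof -
      have j: "j < Suc i" using that len by simp
      have "map stage_arc ?ys ! j = take (Suc i) es ! j" unfolding arcs_ys ..
      then show "stage_arc (?ys ! j) = es ! j" using that j by (simp del: map_append)
      show 1: "take j ?ys = take j xs" using j len by simp
      have "map stage_arc (take j xs) = take j (take i es)" unfolding arcs[symmetric] take_map ..
      then show "map stage_arc (take j ?ys) = take j es" using 1 j by simp
    qed
    have facc: "accurate s \<delta> (take j es) (final_wt ?K0 (take j xs))" if "j < length ?ys" for j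
      using that len by (intro acc) simp
    have b2: "hit v (take j es) {s} \<le> 2 * final_wt ?K0 (take j xs) v"
      "final_wt ?K0 (take j xs) v \<le> 2 * hit v (take j es) {s}" if "j < length ?ys" for j v
      using accurate_factor2[OF facc[OF that] take_ok \<delta>, of v] hit_nonneg[OF take_ok, of v j "{s}"] by
          linarith+
    \<comment> \<open>Both summands of \<open>M\<close> are at most \<open>3 / 2 * R\<close>, which
      is within the factor 4 that \<open>tree_bounds\<close> allows.\<close>
    have "p * K u \<le> p * (3 / 2 * hit u (take i es) {s})" using K2 p by (intro mult_left_mono) auto
    then have M4: "M \<le> 4 * R" using K2(2)[of w] Rb R0 by (simp add: M_def)
    let ?T = "tree w ?ys (s, {s})"
    have T: "M * count_mean ?T = R" "0 < count_mean ?T"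
      "count_square ?T \<le> 8 * real m * (count_mean ?T)\<^sup>2" "work_mean ?T \<le> 6 * (real m)\<^sup>2"
    proof -
      have len_ys: "length ?ys \<le> m" "0 < m" using i len by auto
      have *: "map stage_arc (take j xs) = take j es" if "j < length ?ys" for j
        using ys_nth(1,3)[OF that] by simp
      have bl: "hit (fst (stage_arc (?ys ! j))) (map stage_arc (take j ?ys)) {s}
          \<le> 2 * final_wt ?K0 (take j ?ys) (fst (stage_arc (?ys ! j)))"
        and bu: "final_wt ?K0 (take j ?ys) (fst (stage_arc (?ys ! j)))
          \<le> 2 * hit (fst (stage_arc (?ys ! j))) (map stage_arc (take j ?ys)) {s}"
        if "j < length ?ys" for j
        unfolding ys_nth(1,2)[OF that] *[OF that] by (rule b2[OF that])+
      have "final_wt ?K0 ?ys w \<le> 4 * hit w (map stage_arc ?ys) {s}" "0 < hit w (map stage_arc ?ys) {s}"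
        unfolding fys arcs_ys R_def[symmetric] by (rule M4, rule Rpos)
      from tree_bounds[OF okys len_ys bl bu this]
      show "M * count_mean ?T = R" "0 < count_mean ?T"
        "count_square ?T \<le> 8 * real m * (count_mean ?T)\<^sup>2" "work_mean ?T \<le> 6 * (real m)\<^sup>2"
        unfolding fys arcs_ys R_def[symmetric] by simp_all
    qed
    have m0: "0 < m" using i by simp
    have N0: "0 < N"
    proof -
      have "0 < 64 * real m ^ 2 / \<delta>\<^sup>2" using m0 \<delta> by simp
      with N show ?thesis by (metis less_le_trans of_nat_0_less_iff)
    qed
    have F0: "0 < F"
    proof -
      have "0 < 48 * m ^ 3 * N" using m0 N0 by simp
      with F show ?thesis by linarith
    qed
    \<comment> \<open>The failure probability is shared equally by Chebyshev and the exhausted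
      budget, which explains the constants \<open>64 = 8 * 8\<close> and
      \<open>48 = 6 * 8\<close>.\<close>
    have "8 * real m / (N * \<delta>\<^sup>2) \<le> 1 / (8 * real m)"
      using N m0 N0 \<delta> by (simp add: field_simps power2_eq_square)
    moreover have "real N * (6 * (real m)\<^sup>2) / F \<le> 1 / (8 * real m)"
    proof -
      have "real (48 * m ^ 3 * N) \<le> real F" using F by (rule of_nat_mono)
      then show ?thesis using m0 F0 by (simp add: field_simps power2_eq_square power3_eq_cube)
    qed
    moreover have "1 - 8 * real m / (N * \<delta>\<^sup>2) - real N * (6 * (real m)\<^sup>2) / F \<le>
      measure_pmf.prob Z {x. \<bar>real (snd x) - N * count_mean ?T\<bar> < \<delta> * (N * count_mean ?T)}"
      unfolding Z_def using T N0 F0 \<delta> by (intro machine_concentration) auto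
    moreover have "\<dots> \<le> measure_pmf.prob Z {y. good s \<delta> es (Suc i) (K(w := \<kappa> (snd y)), xs @ [?S (\<kappa> (snd
        y))])}"
    proof (intro measure_pmf.finite_measure_mono subsetI CollectI succ \<kappa>_ge)
      fix y :: config assume "y \<in> {x. \<bar>real (snd x) - N * count_mean ?T\<bar> < \<delta> * (N * count_mean ?T)}"
      then have y: "\<bar>real (snd y) - N * count_mean ?T\<bar> < \<delta> * (N * count_mean ?T)" by simp
      have M0: "0 \<le> M" using Kn pK by (simp add: M_def)
      have r: "(1 - \<delta>) * count_mean ?T \<le> real (snd y) / N" "real (snd y) / N \<le> (1 + \<delta>) * count_mean ?T"
        using y N0 by (auto simp: field_simps abs_less_iff)
      from r[THEN mult_left_mono, OF M0]
      have "(1 - \<delta>) * R \<le> M * (real (snd y) / N)" "M * (real (snd y) / N) \<le> (1 + \<delta>) * R"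
        unfolding T(1)[symmetric] by (simp_all add: mult.left_commute)
      then show "approximates \<delta> R (\<kappa> (snd y))"
        using upper by (auto simp: approximates_def \<kappa>_def revised_wt_def M_def)
    qed simp
    ultimately have "1 - 1 / (8 * real m) - 1 / (8 * real m) \<le>
      measure_pmf.prob Z {y. good s \<delta> es (Suc i) (K(w := \<kappa> (snd y)), xs @ [?S (\<kappa> (snd y))])}" by linarith
    then show ?thesis unfolding phase by (simp add: vimage_def)
  qed
qed

text \<open>A union bound for adaptive experiments: the second one has to succeed only from good
  outcomes of the first.\<close>

lemma prob_bind_ge:
  assumes "measure_pmf.prob M A \<ge> 1 - a" "\<And>x. x \<in> A \<Longrightarrow> measure_pmf.prob (f x) B \<ge> 1 - b" "0 \<le> b"
  shows "measure_pmf.prob (M \<bind> f) B \<ge> 1 - a - b"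
proof -
  have int: "integrable (measure_pmf M) (\<lambda>x. measure_pmf.prob (f x) B)"
    by (intro measure_pmf.integrable_const_bound[of _ 1]) auto
  have "1 - a - b \<le> measure_pmf.prob M A - b" using assms by simp
  also have "\<dots> = measure_pmf.expectation M (\<lambda>x. indicator A x - b)"
    by (subst Bochner_Integration.integral_diff) (auto intro!: measure_pmf.integrable_const_bound[of _ 1])
  also have "\<dots> \<le> measure_pmf.expectation M (\<lambda>x. measure_pmf.prob (f x) B)"
  proof (intro integral_mono int)
    show "integrable (measure_pmf M) (\<lambda>x. indicator A x - b)"
      by (intro measure_pmf.integrable_const_bound[of _ "1 + b"]) (use assms(3) in \<open>auto simp:
          indicator_def\<close>)
    show "indicator A x - b \<le> measure_pmf.prob (f x) B" for x
    proof (cases "x \<in> A")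
      case False
      then have "indicator A x - b \<le> 0" using assms(3) by simp
      then show ?thesis by (rule order_trans) simp
    qed (use assms(2)[of x] in auto)
  qed
  also have "\<dots> = measure_pmf.prob (M \<bind> f) B"
    by (simp add: measure_pmf_bind measure_pmf.measure_bind[where N = "count_space UNIV"]
        measure_pmf_in_subprob_algebra)
  finally show ?thesis .
qed

text \<open>The number of stages built so far serves as phase counter, so that all phases iterate a
  single map.\<close>

definition sweep :: "nat \<Rightarrow> nat \<Rightarrow> nat \<Rightarrow> arc list \<Rightarrow> (nat \<Rightarrow> real) \<times> stage list \<Rightarrow> ((nat \<Rightarrow> real) \<times> stage list)
    pmf" where
  "sweep N F s es x = phase N F s (es ! length (snd x)) x"

lemma sweep_good:
  assumes es: "list_all arc_ok es" and m: "m = length es"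
    and \<delta>: "0 < \<delta>" "\<delta> \<le> 1 / 2" and N: "64 * real m ^ 2 / \<delta>\<^sup>2 \<le> N" and F: "48 * m ^ 3 * N \<le> F"
  shows "i + k = m \<Longrightarrow> good s \<delta> es i x \<Longrightarrow>
    measure_pmf.prob (iterate_pmf k (sweep N F s es) x) {y. good s \<delta> es m y} \<ge> 1 - k * (1 / (4 * real m))"
proof (induction k arbitrary: i x)
  case (Suc k)
  have i: "i < m" using Suc.prems by simp
  have "length (snd x) = i"
  proof -
    have "map stage_arc (snd x) = take i es" using Suc.prems(2) by (auto simp: good_def)
    then have "length (map stage_arc (snd x)) = length (take i es)" by simp
    then show ?thesis using i m by simp
  qed
  then have "measure_pmf.prob (sweep N F s es x) {y. good s \<delta> es (Suc i) y} \<ge> 1 - 1 / (4 * real m)"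
    unfolding sweep_def using phase_good[OF es m i \<delta> N F Suc.prems(2)] by simp
  then have "measure_pmf.prob (sweep N F s es x \<bind> iterate_pmf k (sweep N F s es)) {y. good s \<delta> es m y}
      \<ge> 1 - 1 / (4 * real m) - k * (1 / (4 * real m))"
    using Suc by (intro prob_bind_ge[where A = "{y. good s \<delta> es (Suc i) y}"]) auto
  then show ?case by (simp add: algebra_simps add_divide_distrib)
qed simp

section \<open>Topological sorting\<close>

definition ready :: "(nat \<times> nat) list \<Rightarrow> nat list \<Rightarrow> nat \<Rightarrow> bool" where
  "ready es L e \<longleftrightarrow> e \<notin> set L \<and> (\<forall>j<length es. snd (es ! j) = fst (es ! e) \<longrightarrow> j \<in> set L)"

definition visit :: "(nat \<times> nat) list \<Rightarrow> nat list \<Rightarrow> nat \<Rightarrow> nat list" where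
  "visit es L e = (if ready es L e then L @ [e] else L)"

definition pass :: "(nat \<times> nat) list \<Rightarrow> nat list \<Rightarrow> nat list" where
  "pass es L = foldl (visit es) L [0..<length es]"

definition topo :: "(nat \<times> nat) list \<Rightarrow> nat list \<Rightarrow> bool" where
  "topo es L \<longleftrightarrow> distinct L \<and> set L \<subseteq> {..<length es} \<and>
     (\<forall>i<length L. \<forall>j<length es. snd (es ! j) = fst (es ! (L ! i)) \<longrightarrow> j \<in> set (take i L))"

lemma topo_Nil: "topo es []"
  by (simp add: topo_def)

lemma topo_visit: "topo es L \<Longrightarrow> e < length es \<Longrightarrow> topo es (visit es L e)"
  by (auto simp: topo_def visit_def ready_def nth_append less_Suc_eq)

lemma topo_foldl: "topo es L \<Longrightarrow> set ks \<subseteq> {..<length es} \<Longrightarrow> topo es (foldl (visit es) L ks)"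
  by (induction ks arbitrary: L) (auto simp: topo_visit)

lemma topo_pass: "topo es L \<Longrightarrow> topo es (pass es L)"
  unfolding pass_def by (rule topo_foldl) auto

lemma visit_mono: "set L \<subseteq> set (visit es L e)" "length L \<le> length (visit es L e)"
  by (auto simp: visit_def)

lemma foldl_visit_mono:
  "set L \<subseteq> set (foldl (visit es) L ks) \<and> length L \<le> length (foldl (visit es) L ks)"
proof (induction ks arbitrary: L)
  case (Cons k ks)
  have "length L \<le> length (visit es L k)" "length (visit es L k) \<le> length (foldl (visit es) (visit es L k)
      ks)"
    using visit_mono(2) Cons by blast+
  then show ?case using visit_mono(1)[of L es k] Cons[of "visit es L k"] by auto
qed simp

text \<open>Arcs listed earlier in the same scan cannot spoil the readiness of \<open>e\<close>:
  when the scan arrives at \<open>e\<close>, either \<open>e\<close> is in the list by then or it is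
  still ready.\<close>

lemma pass_progress:
  assumes "topo es L" "ready es L e" "e < length es"
  shows "length L < length (pass es L)"
proof -
  let ?L = "foldl (visit es) L [0..<e]"
  have split: "[0..<length es] = [0..<e] @ e # [Suc e..<length es]"
    using assms(3) by (metis less_imp_le_nat upt_add_eq_append le0 upt_conv_Cons add.left_neutral
        le_add_diff_inverse)
  have m1: "set L \<subseteq> set ?L" "length L \<le> length ?L" using foldl_visit_mono[of L es] by auto
  have e: "e \<notin> set L" using assms(2) by (simp add: ready_def)
  have "{0..<e} \<subseteq> {..<length es}" using assms(3) by auto
  then have "distinct L" "distinct ?L" using assms topo_foldl[of es L "[0..<e]"] by (auto simp: topo_def)
  have "length L < length (visit es ?L e)"
  proof (cases "e \<in> set ?L")
    case True
    then have "set L \<subset> set ?L" using m1 e by auto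
    then have "card (set L) < card (set ?L)" by (intro psubset_card_mono) auto
    then show ?thesis using \<open>distinct L\<close> \<open>distinct ?L\<close> visit_mono(2)[of ?L es e]
      by (simp add: distinct_card)
  next
    case False
    then have "ready es ?L e" using assms(2) m1 by (auto simp: ready_def)
    then show ?thesis using m1 by (simp add: visit_def)
  qed
  also have "\<dots> \<le> length (pass es L)"
    unfolding pass_def split using foldl_visit_mono[of "visit es ?L e" es "[Suc e..<length es]"] by simp
  finally show ?thesis .
qed

text \<open>Choose an unlisted arc whose tail is minimal for the well-founded arc relation; an
  unlisted arc into this tail would have a smaller tail.\<close>

lemma ready_exists:
  assumes "acyclic (set es)" "set L \<subset> {..<length es}"
  shows "\<exists>e<length es. ready es L e"
proof -
  let ?U = "{e. e < length es \<and> e \<notin> set L}"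
  have "wf (set es)" using assms(1) by (intro finite_acyclic_wf) auto
  obtain e0 where "e0 \<in> ?U" using assms(2) by auto
  then have "fst (es ! e0) \<in> (\<lambda>e. fst (es ! e)) ` ?U" by blast
  from wfE_min[OF \<open>wf (set es)\<close> this] obtain z where z: "z \<in> (\<lambda>e. fst (es ! e)) ` ?U"
    and zmin: "\<And>y. (y, z) \<in> set es \<Longrightarrow> y \<notin> (\<lambda>e. fst (es ! e)) ` ?U" by blast
  then obtain e where e: "e < length es" "e \<notin> set L" "z = fst (es ! e)" by blast
  have "j \<in> set L" if "j < length es" "snd (es ! j) = fst (es ! e)" for j
  proof (rule ccontr)
    assume "j \<notin> set L"
    moreover have "(fst (es ! j), z) \<in> set es" using that e by (metis nth_mem prod.collapse)
    ultimately show False using zmin[of "fst (es ! j)"] that by blast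
  qed
  then show ?thesis using e by (auto simp: ready_def)
qed

text \<open>Every scan of an incomplete list adds at least one arc, so as many scans as arcs
  suffice.\<close>

lemma passes_complete:
  assumes "acyclic (set es)" "topo es L"
  shows "topo es ((pass es ^^ k) L) \<and> min (length es) (length L + k) \<le> length ((pass es ^^ k) L)"
proof (induction k)
  case 0
  then show ?case using assms by simp
next
  case (Suc k)
  let ?L = "(pass es ^^ k) L"
  have t: "topo es ?L" using Suc by simp
  have sub: "set ?L \<subseteq> {..<length es}" and dist: "distinct ?L" using t by (auto simp: topo_def)
  have "min (length es) (length L + Suc k) \<le> length (pass es ?L)"
  proof (cases "set ?L = {..<length es}")
    case True
    then have "length ?L = length es" using dist by (metis card_lessThan distinct_card)
    then show ?thesis using foldl_visit_mono[of ?L es "[0..<length es]"] by (auto simp: pass_def)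
  next
    case False
    then obtain e where "e < length es" "ready es ?L e"
      using ready_exists[OF assms(1), of ?L] sub by auto
    then have "length ?L < length (pass es ?L)" using pass_progress t by blast
    then show ?thesis using Suc by linarith
  qed
  then show ?case using topo_pass[OF t] by simp
qed

lemma passes_all:
  assumes "acyclic (set es)"
  defines "L \<equiv> (pass es ^^ length es) []"
  shows "topo es L" "length L = length es" "set L = {..<length es}"
proof -
  show t: "topo es L" using passes_complete[OF assms(1) topo_Nil] by (simp add: L_def)
  then have d: "distinct L" "set L \<subseteq> {..<length es}" by (auto simp: topo_def)
  have "length es \<le> length L"
    using passes_complete[OF assms(1) topo_Nil, of "length es"] by (simp add: L_def)
  moreover have "length L \<le> length es"
    using d card_mono[of "{..<length es}" "set L"] by (simp add: distinct_card)
  ultimately show l: "length L = length es" by simp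
  show "set L = {..<length es}"
    using d l by (intro card_subset_eq) (auto simp: distinct_card)
qed

section \<open>Reliability as a hitting probability\<close>

primrec reached :: "('a \<times> 'a) list \<Rightarrow> ('a \<times> 'a \<Rightarrow> bool) \<Rightarrow> 'a set \<Rightarrow> 'a set" where
  "reached [] X A = A"
| "reached (e # es) X A = reached es X (if X e \<and> fst e \<in> A then insert (snd e) A else A)"

lemma reached_append: "reached (es @ fs) X A = reached fs X (reached es X A)"
  by (induction es arbitrary: A) auto

lemma reached_cong: "(\<And>e. e \<in> set es \<Longrightarrow> X e = Y e) \<Longrightarrow> reached es X A = reached es Y A"
  by (induction es arbitrary: A) auto

text \<open>In sorted order no earlier arc leaves the head \<open>w\<close> of the last arc. A path
  can therefore use the last arc only as its final step, and it enlarges the closure by at most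
  \<open>w\<close>; so one scan computes reachability.\<close>

lemma reached_eq_rtrancl:
  assumes "distinct es"
    "\<And>i e. i < length es \<Longrightarrow> e \<in> set es \<Longrightarrow> snd e = fst (es ! i) \<Longrightarrow> e \<in> set (take i es)"
  shows "reached es X {s} = {v. (s, v) \<in> {e \<in> set es. X e}\<^sup>*}"
  using assms
proof (induction es rule: rev_induct)
  case Nil
  then show ?case by auto
next
  case (snoc e es)
  obtain u w where e: "e = (u, w)" by (cases e)
  have top: "f \<in> set (take i es)" if "i < length es" "f \<in> set es" "snd f = fst (es ! i)" for i f
    using snoc.prems(2)[of i f] that by (simp add: nth_append)
  let ?E = "{f \<in> set es. X f}"
  let ?E' = "{f \<in> set (es @ [e]). X f}"
  have IH: "reached es X {s} = {v. (s, v) \<in> ?E\<^sup>*}" using snoc.IH snoc.prems(1) top by auto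
  have no_out: "(w, x) \<notin> set es" for x
  proof
    assume "(w, x) \<in> set es"
    then obtain i where i: "i < length es" "es ! i = (w, x)" by (meson in_set_conv_nth)
    then have "e \<in> set (take i es)" using snoc.prems(2)[of i e] e by (simp add: nth_append)
    then show False using snoc.prems(1) by (auto dest: in_set_takeD)
  qed
  have uw: "u \<noteq> w"
    using snoc.prems(2)[of "length es" e] snoc.prems(1) by (auto simp: e)
  show ?case
  proof (cases "X e")
    case False
    then have "?E' = ?E" by auto
    then show ?thesis using False by (simp add: reached_append IH)
  next
    case True
    then have E': "?E' = insert (u, w) ?E" by (auto simp: e)
    have sub: "?E\<^sup>* \<subseteq> ?E'\<^sup>*" unfolding E' by (intro rtrancl_mono) auto
    have fwd: "v \<in> (if (s, u) \<in> ?E\<^sup>* then insert w {v. (s, v) \<in> ?E\<^sup>*} else {v. (s, v) \<in> ?E\<^sup>*})"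
      if "(s, v) \<in> ?E'\<^sup>*" for v
      using that
    proof (induction rule: rtrancl_induct)
      case (step y z)
      show ?case
      proof (cases "(y, z) = (u, w)")
        case True
        then show ?thesis using step.IH uw by (auto split: if_splits)
      next
        case False
        then have "(y, z) \<in> ?E" using step E' by blast
        moreover then have "y \<noteq> w" using no_out by auto
        ultimately show ?thesis using step.IH by (auto split: if_splits intro: rtrancl_into_rtrancl)
      qed
    qed auto
    have bwd: "(s, w) \<in> ?E'\<^sup>*" if "(s, u) \<in> ?E\<^sup>*"
    proof -
      have "(u, w) \<in> ?E'" unfolding E' by simp
      moreover have "(s, u) \<in> ?E'\<^sup>*" using that sub by blast
      ultimately show ?thesis by (rule rtrancl_into_rtrancl[rotated])
    qed
    have "{v. (s, v) \<in> ?E'\<^sup>*} = (if (s, u) \<in> ?E\<^sup>* then insert w {v. (s, v) \<in> ?E\<^sup>*} else {v. (s, v) \<in> ?E\<^sup>*})"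
    proof (rule subset_antisym)
      show "{v. (s, v) \<in> ?E'\<^sup>*} \<subseteq> (if (s, u) \<in> ?E\<^sup>* then insert w {v. (s, v) \<in> ?E\<^sup>*} else {v. (s, v) \<in>
          ?E\<^sup>*})"
        using fwd by blast
      show "(if (s, u) \<in> ?E\<^sup>* then insert w {v. (s, v) \<in> ?E\<^sup>*} else {v. (s, v) \<in> ?E\<^sup>*}) \<subseteq> {v. (s, v) \<in>
          ?E'\<^sup>*}"
        using sub bwd by (simp split: if_splits) blast
    qed
    then show ?thesis using True by (simp add: reached_append IH e)
  qed
qed

text \<open>The coin of the first arc is split off from the product distribution; since the arcs are
  distinct, the remaining scan never looks at it again.\<close>

lemma hit_eq_prob:
  fixes num :: "'a \<Rightarrow> nat"
  assumes "distinct es" "\<And>e. e \<in> set es \<Longrightarrow> 0 \<le> q e \<and> q e \<le> 1" "inj_on num V"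
    "\<And>e. e \<in> set es \<Longrightarrow> fst e \<in> V \<and> snd e \<in> V" "A \<subseteq> V" "t \<in> V"
  shows "hit (num t) (map (\<lambda>e. (num (fst e), num (snd e), 1 - q e)) es) (num ` A) =
    measure_pmf.prob (Pi_pmf (set es) False (\<lambda>e. bernoulli_pmf (1 - q e))) {X. t \<in> reached es X A}"
  using assms
proof (induction es arbitrary: A)
  case Nil
  then show ?case by (auto simp: indicator_def inj_on_image_mem_iff)
next
  case (Cons e es)
  obtain u w where e: "e = (u, w)" by (cases e)
  let ?P = "Pi_pmf (set es) False (\<lambda>e. bernoulli_pmf (1 - q e))"
  let ?f = "\<lambda>B. measure_pmf.prob ?P {X. t \<in> reached es X B}"
  let ?B = "if u \<in> A then insert w A else A"
  have V: "u \<in> V" "w \<in> V" and q: "0 \<le> q e" "q e \<le> 1" using Cons.prems(2,4)[of e] e by auto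
  have IH: "hit (num t) (map (\<lambda>e. (num (fst e), num (snd e), 1 - q e)) es) (num ` B) = ?f B"
    if "B \<subseteq> V" for B using Cons.prems that by (intro Cons.IH) auto
  have notin: "e \<notin> set es" using Cons.prems by simp
  have upd: "reached es (X(e := y)) B = reached es X B" for X y B
    using notin by (intro reached_cong) auto
  have pr: "measure_pmf.prob (map_pmf (\<lambda>X. X(e := y)) ?P) {X. t \<in> reached (e # es) X A} = ?f (if y then ?B
      else A)" for y
    by (simp add: vimage_def upd[unfolded e] e)
  have "Pi_pmf (set (e # es)) False (\<lambda>e. bernoulli_pmf (1 - q e))
      = bernoulli_pmf (1 - q e) \<bind> (\<lambda>y. map_pmf (\<lambda>X. X(e := y)) ?P)"
    using notin by (simp add: Pi_pmf_insert' map_pmf_def)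
  then have "measure_pmf.prob (Pi_pmf (set (e # es)) False (\<lambda>e. bernoulli_pmf (1 - q e))) {X. t \<in> reached
      (e # es) X A}
     = measure_pmf.expectation (bernoulli_pmf (1 - q e)) (\<lambda>y. ?f (if y then ?B else A))"
    unfolding pr[symmetric]
    by (simp add: measure_pmf_bind measure_pmf.measure_bind[where N = "count_space UNIV"]
        measure_pmf_in_subprob_algebra
        del: measure_map_pmf integral_bernoulli_pmf reached.simps)
  also have "\<dots> = (1 - q e) * ?f ?B + q e * ?f A" using q by simp
  also have "\<dots> = hit (num t) (map (\<lambda>e. (num (fst e), num (snd e), 1 - q e)) (e # es)) (num ` A)"
  proof -
    have "grow (num u, num w, 1 - q e) (num ` A) = num ` ?B"
      using V Cons.prems by (auto simp: inj_on_image_mem_iff)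
    then show ?thesis using IH[of A] IH[of ?B] V Cons.prems(5)
      by (simp add: e del: grow.simps split: if_splits)
  qed
  finally show ?case ..
qed

lemma dag_acyclic: assumes "dag G" shows "acyclic (parcs G)"
proof -
  interpret pair_fin_digraph G using assms by (simp add: dag_def)
  have nc: "\<nexists>c. cycle c" using assms by (simp add: dag_def)
  show ?thesis unfolding acyclic_def
  proof (intro allI notI)
    fix v assume "(v, v) \<in> (parcs G)\<^sup>+"
    then obtain p where "awalk v p v" "p \<noteq> []" using reachable1_awalk[of v v] by auto
    then have "closed_w p" by (auto simp: closed_w_def)
    then show False using closed_w_imp_cycle nc by blast
  qed
qed

lemma reliability_eq_hit:
  assumes dag: "dag G" and st: "s \<in> pverts G" "t \<in> pverts G" and q: "\<And>e. e \<in> parcs G \<Longrightarrow> 0 \<le> q e \<and> q e \<le> 1"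
    and num: "inj_on num (pverts G)" and es: "distinct es" "set es = parcs G"
    and top: "\<And>i e. i < length es \<Longrightarrow> e \<in> set es \<Longrightarrow> snd e = fst (es ! i) \<Longrightarrow> e \<in> set (take i es)"
  shows "hit (num t) (map (\<lambda>e. (num (fst e), num (snd e), 1 - q e)) es) {num s} = reliability G q s t"
proof -
  interpret pair_fin_digraph G using dag by (simp add: dag_def)
  have V: "fst e \<in> pverts G \<and> snd e \<in> pverts G" if "e \<in> set es" for e
    using that es arc_fst_in_verts arc_snd_in_verts by auto
  have path: "(\<exists>p. pre_digraph.apath (with_proj \<lparr>pverts = pverts G, parcs = {e \<in> parcs G. X e}\<rparr>) s p t)
      \<longleftrightarrow> t \<in> reached es X {s}" for X
  proof -
    let ?H = "\<lparr>pverts = pverts G, parcs = {e \<in> parcs G. X e}\<rparr>"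
    interpret H: pair_wf_digraph ?H
      by unfold_locales (auto dest: arc_fst_in_verts arc_snd_in_verts)
    have "(\<exists>p. H.apath s p t) \<longleftrightarrow> s \<rightarrow>\<^sup>*\<^bsub>with_proj ?H\<^esub> t" by (simp add: H.reachable_apath)
    also have "\<dots> \<longleftrightarrow> (s, t) \<in> {e \<in> parcs G. X e}\<^sup>*"
    proof
      assume "(s, t) \<in> {e \<in> parcs G. X e}\<^sup>*"
      then have "(s, t) \<in> rtrancl_on (pverts G) {e \<in> parcs G. X e}"
        using st by (rule rtrancl_consistent_rtrancl_on) (auto dest: arc_snd_in_verts)
      then show "s \<rightarrow>\<^sup>*\<^bsub>with_proj ?H\<^esub> t" by (simp add: reachable_def)
    qed (auto simp: reachable_def dest: rtrancl_on_rtranclI)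
    also have "\<dots> \<longleftrightarrow> t \<in> reached es X {s}"
    proof -
      have "reached es X {s} = {v. (s, v) \<in> {e \<in> set es. X e}\<^sup>*}"
        using es(1) top by (rule reached_eq_rtrancl)
      then show ?thesis unfolding es(2) by simp
    qed
    finally show ?thesis .
  qed
  have "hit (num t) (map (\<lambda>e. (num (fst e), num (snd e), 1 - q e)) es) (num ` {s}) =
     measure_pmf.prob (Pi_pmf (set es) False (\<lambda>e. bernoulli_pmf (1 - q e))) {X. t \<in> reached es X {s}}"
    by (rule hit_eq_prob[OF es(1) _ num V]) (use st q es(2) in auto)
  also have "\<dots> = reliability G q s t"
    by (simp add: reliability_def random_subgraph_def vimage_def path es(2))
  finally show ?thesis by simp
qed

section \<open>The sampling program\<close>

text \<open>
  Index registers: 0 to 3 hold \<open>n\<close>, \<open>m\<close>, \<open>s\<close>, \<open>t\<close>; 4 and 5 hold 1 and 0; 6 to 9 hold the base addresses \<open>2 m\<close>,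
  \<open>3 m\<close>, \<open>3 m + n\<close>, \<open>4 m + n\<close>; 10 the size \<open>n + 2\<close> of a stack entry; 11 the address of the top of the stack;
  12 the number of particles counted; 13 the number of roots still to be started; 14 the number of stages; 15 the
  target vertex; 16 the number of roots; 17 the number of completed phases.

  The index memory contains the arcs, then from \<open>2 m\<close> on their sorted order, from \<open>3 m\<close> on the number of pending
  arcs into each vertex, from \<open>3 m + n\<close> on a flag for each arc already sorted, and from \<open>4 m + n\<close> on the stack.
  A stack entry consists of the level, the location and one cell per vertex for the set of reached vertices;
  the entry at the bottom is never processed and serves as a template for the roots.

  The real memory contains the failure probabilities, then from \<open>m\<close> on the survival probabilities of the stages,
  from \<open>2 m\<close> on their branching probabilities, and from \<open>3 m\<close> on the current estimates.
\<close>

definition copy_body :: "instr list" where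
  "copy_body = [IAdd 32 29 31, ILoad 33 32, IAdd 32 30 31, IStore 32 33, IAdd 31 31 4]"

definition copy_prog :: prog where
  "copy_prog = Seq (block [IConst 31 0]) (While (ILess 31 10) (block copy_body))"

definition push_code :: "instr list" where
  "push_code = [ISub 13 13 4, IAdd 29 9 5, IAdd 30 9 10]"

definition push_root :: prog where
  "push_root = Cond (ILe 11 9) (Cond (ILe 13 5) Skip
     (Seq (block push_code)
     (Seq copy_prog (block [IAdd 11 30 5])))) Skip"

definition finish_prog :: prog where
  "finish_prog = Seq (Cond (ILe 22 15) (Cond (ILe 15 22) (block [IAdd 12 12 4]) Skip) Skip)
     (block [ISub 11 11 10])"

text \<open>Equality of naturals is tested by \<open>(x - y) + (y - x) = 0\<close>. The bit of
  \<open>w\<close> is added in register 37, which is thus 0 iff the particle is at the tail and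
  \<open>w\<close> is new.\<close>

definition fetch_code :: "instr list" where
  "fetch_code = [IAdd 23 6 20, ILoad 23 23, IAdd 24 23 23, ILoad 25 24, IAdd 24 24 4, ILoad 26 24,
     RLoad 20 23, RSub 20 1 20, IAdd 24 1 20, RLoad 21 24, IAdd 24 6 20, RLoad 22 24,
     IAdd 27 21 4, IAdd 24 27 25, ILoad 24 24, IAdd 27 27 26, ILoad 34 27,
     ISub 36 22 26, ISub 37 26 22, IAdd 36 36 37, ISub 37 22 25, ISub 38 25 22, IAdd 37 37 38, IAdd 37 37
         34,
     IAdd 20 20 4, IStore 11 20]"

text \<open>
  On bits, truncated subtraction expresses conjunction as \<open>x + y - 1\<close> and disjunction as \<open>x + (y - x)\<close>.
\<close>

definition new_bit_code :: "instr list" where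
  "new_bit_code = [IAdd 39 35 24, ISub 39 39 4, ISub 40 34 39, IAdd 39 39 40]"

definition stay_prog :: prog where
  "stay_prog = Seq (Do (Flip 41 21)) (Seq (block [IStore 27 39])
     (Cond (ILe 41 5) (block [ISub 11 11 10]) Skip))"

definition spawn_prog :: prog where
  "spawn_prog = Seq (block [IAdd 29 11 5, IAdd 30 11 10])
     (Seq copy_prog (block [IStore 27 39, IAdd 11 30 5, IAdd 40 11 4, IStore 40 26, IAdd 40 40 4,
        IAdd 40 40 26, IStore 40 4]))"

text \<open>The complement of the coin is added to register 37, so that one test for 0 decides
  whether an offspring is born.\<close>

definition move_prog :: prog where
  "move_prog = Seq (Do (Flip 41 22)) (Seq (block [ISub 41 4 41, IAdd 37 37 41])
     (Cond (ILe 37 5) spawn_prog (block [IStore 27 39])))"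

definition advance_prog :: prog where
  "advance_prog = Seq (block fetch_code) (Seq (Do (Flip 35 20)) (Seq (block new_bit_code)
     (Cond (ILe 36 5) stay_prog move_prog)))"

definition process_prog :: prog where
  "process_prog = Cond (ILe 11 9) Skip (Seq (block [ILoad 20 11, IAdd 21 11 4, ILoad 22 21])
     (Cond (ILe 14 20) finish_prog advance_prog))"

definition micro_prog :: prog where
  "micro_prog = Seq push_root process_prog"

lemma copy_spec:
  fixes \<sigma> :: state
  assumes sz: "ireg \<sigma> 10 = sz" and one: "ireg \<sigma> 4 = 1" and src: "ireg \<sigma> 29 = src" and dst: "ireg \<sigma> 30 = dst"
    and le: "src + sz \<le> dst"
  shows "runs (12 * sz + 4) copy_prog \<sigma> (\<lambda>\<sigma>'. \<exists>g.
    \<sigma>' = \<sigma>\<lparr>ireg := g, imem := (\<lambda>a. if dst \<le> a \<and> a < dst + sz then imem \<sigma> (a - dst + src) else imem \<sigma> a)\<rparr> \<and>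
    (\<forall>r. r \<notin> {31, 32, 33} \<longrightarrow> g r = ireg \<sigma> r))"
proof -
  define J where "J i \<sigma>' \<longleftrightarrow> (\<exists>g.
    \<sigma>' = \<sigma>\<lparr>ireg := g, imem := (\<lambda>a. if dst \<le> a \<and> a < dst + i then imem \<sigma> (a - dst + src) else imem \<sigma> a)\<rparr> \<and>
    g 31 = i \<and> (\<forall>r. r \<notin> {31, 32, 33} \<longrightarrow> g r = ireg \<sigma> r))" for i \<sigma>'
  define I where "I k \<sigma>' \<longleftrightarrow> k \<le> sz \<and> J (sz - k) \<sigma>'" for k \<sigma>'
  have step: "holds (ILess 31 10) \<sigma>' \<and> runs 10 (block copy_body) \<sigma>' (I k)" if I: "I (Suc k) \<sigma>'" for k \<sigma>'
  proof -
    define i where "i = sz - Suc k"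
    have k: "Suc k \<le> sz" and i: "sz - k = Suc i" "i < sz" using I by (auto simp: I_def i_def)
    obtain g where \<sigma>': "\<sigma>' = \<sigma>\<lparr>ireg := g, imem := (\<lambda>a. if dst \<le> a \<and> a < dst + i then imem \<sigma> (a - dst +
        src) else imem \<sigma> a)\<rparr>"
      and g: "g 31 = i" "\<And>r. r \<notin> {31, 32, 33} \<Longrightarrow> g r = ireg \<sigma> r"
      using I by (auto simp: I_def J_def i_def)
    have gs: "g 29 = src" "g 30 = dst" "g 4 = 1" "g 10 = sz" using g(2) assms by auto
    have "J (Suc i) (fold det_exec copy_body \<sigma>')"
      unfolding J_def
    proof (intro exI conjI)
      show "fold det_exec copy_body \<sigma>' = \<sigma>\<lparr>ireg := ireg (fold det_exec copy_body \<sigma>'),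
         imem := (\<lambda>a. if dst \<le> a \<and> a < dst + Suc i then imem \<sigma> (a - dst + src) else imem \<sigma> a)\<rparr>"
        using i le by (intro state.equality)
          (auto simp: copy_body_def \<sigma>' g gs fun_eq_iff intro!: arg_cong[where f = "imem \<sigma>"])
      show "ireg (fold det_exec copy_body \<sigma>') 31 = Suc i"
        by (simp add: copy_body_def \<sigma>' g gs)
      show "\<forall>r. r \<notin> {31, 32, 33} \<longrightarrow> ireg (fold det_exec copy_body \<sigma>') r = ireg \<sigma> r"
        using g(2) by (simp add: copy_body_def \<sigma>')
    qed
    then have "I k (fold det_exec copy_body \<sigma>')" using k i by (simp add: I_def)
    then have "runs 10 (block copy_body) \<sigma>' (I k)"
      by (intro refines_block) (auto simp: copy_body_def)
    then show ?thesis using i g gs by (simp add: \<sigma>')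
  qed
  have init: "I sz (fold det_exec [IConst 31 0] \<sigma>)"
    unfolding I_def J_def by (auto intro!: exI[of _ "(ireg \<sigma>)(31 := 0)"] state.equality)
  have "runs (sz * (10 + 2) + 1) (While (ILess 31 10) (block copy_body)) (fold det_exec [IConst 31 0] \<sigma>)
      (I 0)"
  proof (rule runs_While)
    show "\<not> holds (ILess 31 10) \<sigma>'" if "I 0 \<sigma>'" for \<sigma>'
      using that sz by (auto simp: I_def J_def)
  qed (use step init in auto)
  then have "runs (2 * length [IConst 31 0] + Suc (sz * (10 + 2) + 1)) copy_prog \<sigma> (I 0)"
    unfolding copy_prog_def by (intro refines_block_Seq) auto
  then show ?thesis by (rule refines_mono) (auto simp: I_def J_def)
qed

text \<open>\<open>\<sigma>0\<close> is the state in which sampling starts; later states are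
  compared with it by \<open>frame\<close>. \<open>fuel\<close> is the content of the loop counter:
  constant during a machine step, it is lowered between steps by changing the locale
  parameter.\<close>

locale sampler =
  fixes \<sigma>0 :: state and n m s v len :: nat and xs :: "stage list" and fuel :: real
  assumes regs: "ireg \<sigma>0 0 = n" "ireg \<sigma>0 1 = m" "ireg \<sigma>0 4 = 1" "ireg \<sigma>0 5 = 0" "ireg \<sigma>0 6 = 2 * m"
      "ireg \<sigma>0 9 = 4 * m + n" "ireg \<sigma>0 10 = n + 2" "ireg \<sigma>0 14 = len" "ireg \<sigma>0 15 = v"
      "rreg \<sigma>0 1 = 1"
    and len: "length xs = len" "len \<le> m"
    and stages: "\<And>j. j < len \<Longrightarrow> \<exists>e u w \<kappa>. e < m \<and> u < n \<and> w < n \<and> imem \<sigma>0 (2 * m + j) = e \<and>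
      imem \<sigma>0 (2 * e) = u \<and> imem \<sigma>0 (2 * e + 1) = w \<and>
      xs ! j = Stage (u, w, 1 - rmem \<sigma>0 e) (rmem \<sigma>0 (m + j)) (rmem \<sigma>0 (2 * m + j)) \<kappa>"
    and root: "imem \<sigma>0 (4 * m + n) = 0" "imem \<sigma>0 (4 * m + n + 1) = s"
      "\<And>x. x < n \<Longrightarrow> imem \<sigma>0 (4 * m + n + 2 + x) = of_bool (x = s)"
begin

text \<open>Slot 0 is the template of the roots, and the head of a stored stack \<open>S\<close>
  lies in slot \<open>length S\<close>.\<close>

definition addr :: "nat \<Rightarrow> nat" where
  "addr d = 4 * m + n + d * (n + 2)"

lemma addr_Suc: "addr (Suc d) = addr d + (n + 2)"
  by (simp add: addr_def)

definition frame :: "state \<Rightarrow> bool" where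
  "frame \<sigma> \<longleftrightarrow> (\<forall>r. r \<notin> {11, 12, 13} \<and> \<not> (20 \<le> r \<and> r < 42) \<longrightarrow> ireg \<sigma> r = ireg \<sigma>0 r) \<and>
     (\<forall>r. r \<notin> {4, 20, 21, 22} \<longrightarrow> rreg \<sigma> r = rreg \<sigma>0 r) \<and> rreg \<sigma> 4 = fuel \<and> rmem \<sigma> = rmem \<sigma>0 \<and>
     (\<forall>a < addr 1. imem \<sigma> a = imem \<sigma>0 a)"

definition entry :: "(nat \<Rightarrow> nat) \<Rightarrow> nat \<Rightarrow> stage list \<times> particle \<Rightarrow> bool" where
  "entry M a y \<longleftrightarrow> (\<exists>j\<le>len. M a = j \<and> fst y = drop j xs) \<and> M (a + 1) = fst (snd y) \<and>
     (\<forall>x<n. M (a + 2 + x) = of_bool (x \<in> snd (snd y)))"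

primrec stack :: "(nat \<Rightarrow> nat) \<Rightarrow> (stage list \<times> particle) list \<Rightarrow> bool" where
  "stack M [] \<longleftrightarrow> True"
| "stack M (y # S) \<longleftrightarrow> entry M (addr (Suc (length S))) y \<and> stack M S"

lemma entry_cong: "(\<And>b. a \<le> b \<Longrightarrow> b < a + (n + 2) \<Longrightarrow> M b = M' b) \<Longrightarrow> entry M a y = entry M' a y"
  unfolding entry_def by simp

lemma entry_copy:
  assumes eq: "\<And>i. i < n + 2 \<Longrightarrow> M' (a' + i) = M (a + i)" and en: "entry M a y"
  shows "entry M' a' y"
proof -
  have "M' a' = M a" "M' (a' + 1) = M (a + 1)" "\<And>x. x < n \<Longrightarrow> M' (a' + 2 + x) = M (a + 2 + x)"
    using eq[of 0] eq[of 1] eq[of "2 + x" for x] by (simp_all add: add.assoc)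
  then show ?thesis using en by (simp add: entry_def)
qed

lemma entry_set_bit:
  assumes "entry M a (ys, (z, A))" "\<And>x. x \<noteq> w \<Longrightarrow> x \<in> A' \<longleftrightarrow> x \<in> A"
  shows "entry (M(a + 2 + w := of_bool (w \<in> A'))) a (ys, (z, A'))"
  using assms by (auto simp: entry_def)

lemma stack_cong: "(\<And>b. b < addr (Suc (length S)) \<Longrightarrow> M b = M' b) \<Longrightarrow> stack M S = stack M' S"
proof (induction S)
  case (Cons y S)
  have "stack M S = stack M' S" using Cons.prems by (intro Cons.IH) (simp add: addr_def)
  moreover have "entry M (addr (Suc (length S))) y = entry M' (addr (Suc (length S))) y"
    using Cons.prems by (intro entry_cong) (simp add: addr_Suc)
  ultimately show ?case by simp
qed simp

text \<open>The roots still to be started form the bottom of the abstract stack, but in the machine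
  they exist only as the counter \<open>r\<close> in register 13.\<close>

definition rel :: "config \<Rightarrow> state \<Rightarrow> bool" where
  "rel x \<sigma> \<longleftrightarrow> (\<exists>S r. fst x = S @ replicate r (xs, (s, {s})) \<and> frame \<sigma> \<and> stack (imem \<sigma>) S \<and>
     ireg \<sigma> 11 = addr (length S) \<and> ireg \<sigma> 12 = snd x \<and> ireg \<sigma> 13 = r)"

lemma frame_regs:
  assumes "frame \<sigma>"
  shows "ireg \<sigma> 0 = n" "ireg \<sigma> (Suc 0) = m" "ireg \<sigma> 4 = 1" "ireg \<sigma> 5 = 0" "ireg \<sigma> 6 = 2 * m"
    "ireg \<sigma> 9 = 4 * m + n" "ireg \<sigma> 10 = n + 2" "ireg \<sigma> 14 = len" "ireg \<sigma> 15 = v" "rreg \<sigma> (Suc 0) = 1"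
  using assms regs unfolding frame_def by auto

lemma addr_simps: "addr 0 = 4 * m + n" "addr (Suc 0) = 4 * m + n + (n + 2)" "4 * m + n \<le> addr d"
  "addr (Suc d) \<le> 4 * m + n \<longleftrightarrow> False" "addr (Suc 0) \<le> addr (Suc d)"
  by (simp_all add: addr_def)

lemma entry_root: "frame \<sigma> \<Longrightarrow> entry (imem \<sigma>) (addr 0) (xs, (s, {s}))"
proof -
  assume "frame \<sigma>"
  then have "imem \<sigma> a = imem \<sigma>0 a" if "a < 4 * m + n + (n + 2)" for a
    using that by (simp add: frame_def addr_simps)
  then show ?thesis using root by (simp add: entry_def addr_simps)
qed

text \<open>Invisible to the abstract machine: if no entry is stored, one unit of the counter
  becomes a copy of the template. Afterwards a nonempty abstract stack has its top in
  memory.\<close>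

lemma push_root_spec:
  assumes "rel x \<sigma>"
  shows "runs (12 * n + 40) push_root \<sigma> (\<lambda>\<sigma>'. rel x \<sigma>' \<and> (fst x \<noteq> [] \<longrightarrow> addr 0 < ireg \<sigma>' 11))"
proof -
  obtain S r c where x: "x = (S @ replicate r (xs, (s, {s})), c)" and fr: "frame \<sigma>"
    and st: "stack (imem \<sigma>) S" and regs': "ireg \<sigma> 11 = addr (length S)" "ireg \<sigma> 12 = c" "ireg \<sigma> 13 = r"
    using assms by (cases x) (auto simp: rel_def)
  note fregs = frame_regs[OF fr]
  show ?thesis
  proof (cases "S = [] \<and> r \<noteq> 0")
    case False
    have "runs (Suc (Suc 0)) push_root \<sigma> (\<lambda>\<sigma>'. rel x \<sigma>' \<and> (fst x \<noteq> [] \<longrightarrow> addr 0 < ireg \<sigma>' 11))"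
      unfolding push_root_def
    proof (intro refines_Cond)
      assume "\<not> holds (ILe 11 9) \<sigma>"
      then show "runs (Suc 0) Skip \<sigma> (\<lambda>\<sigma>'. rel x \<sigma>' \<and> (fst x \<noteq> [] \<longrightarrow> addr 0 < ireg \<sigma>' 11))"
        using assms fregs by (intro refines_Skip) (simp add: addr_simps)
    next
      assume "holds (ILe 11 9) \<sigma>" "\<not> holds (ILe 13 5) \<sigma>"
      then have "addr (length S) \<le> addr 0" "r \<noteq> 0" using fregs regs' by (simp_all add: addr_simps)
      with False have False by (cases S) (auto simp: addr_def)
      then show "runs 0 (Seq (block push_code) (Seq copy_prog (block [IAdd 11 30 5])))
        \<sigma> (\<lambda>\<sigma>'. rel x \<sigma>' \<and> (fst x \<noteq> [] \<longrightarrow> addr 0 < ireg \<sigma>' 11))" ..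
    next
      assume "holds (ILe 11 9) \<sigma>" "holds (ILe 13 5) \<sigma>"
      then have "addr (length S) \<le> addr 0" "r = 0" using fregs regs' by (simp_all add: addr_simps)
      then have "fst x = []" by (cases S) (auto simp: addr_def x)
      then show "runs 0 Skip \<sigma> (\<lambda>\<sigma>'. rel x \<sigma>' \<and> (fst x \<noteq> [] \<longrightarrow> addr 0 < ireg \<sigma>' 11))"
        using assms by (intro refines_Skip) simp
    qed
    then show ?thesis by (rule refines_mono) auto
  next
    case True
    then obtain r' where r': "r = Suc r'" and S: "S = []" by (cases r) auto
    let ?\<sigma>1 = "fold det_exec push_code \<sigma>"
    let ?Q = "\<lambda>\<sigma>'. rel x \<sigma>' \<and> (fst x \<noteq> [] \<longrightarrow> addr 0 < ireg \<sigma>' 11)"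
    let ?M = "\<lambda>a. if addr 1 \<le> a \<and> a < addr 1 + (n + 2) then imem \<sigma> (a - addr 1 + addr 0) else imem \<sigma> a"
    have im1: "imem ?\<sigma>1 = imem \<sigma>" by (simp add: push_code_def)
    have copy: "runs (12 * (n + 2) + 4) copy_prog ?\<sigma>1 (\<lambda>\<sigma>'. \<exists>g.
      \<sigma>' = ?\<sigma>1\<lparr>ireg := g, imem := ?M\<rparr> \<and> (\<forall>r. r \<notin> {31, 32, 33} \<longrightarrow> g r = ireg ?\<sigma>1 r))"
      unfolding im1[symmetric] using fregs by (intro copy_spec) (simp_all add: addr_simps push_code_def)
    have "runs (2 * length push_code + Suc (12 * (n + 2) + 4 + Suc 2))
      (Seq (block push_code) (Seq copy_prog (block [IAdd 11 30 5]))) \<sigma> ?Q"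
    proof (intro refines_block_Seq runs_Seq[OF copy])
      fix \<sigma>' assume "\<exists>g. \<sigma>' = ?\<sigma>1\<lparr>ireg := g, imem := ?M\<rparr> \<and> (\<forall>r. r \<notin> {31, 32, 33} \<longrightarrow> g r = ireg ?\<sigma>1 r)"
      then obtain g where \<sigma>': "\<sigma>' = ?\<sigma>1\<lparr>ireg := g, imem := ?M\<rparr>"
        and g: "\<And>r. r \<notin> {31, 32, 33} \<Longrightarrow> g r = ireg ?\<sigma>1 r" by blast
      let ?\<sigma>2 = "fold det_exec [IAdd 11 30 5] \<sigma>'"
      have "frame ?\<sigma>2" using fr g unfolding frame_def \<sigma>' by (auto simp: push_code_def)
      moreover have "entry (imem ?\<sigma>2) (addr 1) (xs, (s, {s}))"
        by (rule entry_copy[OF _ entry_root[OF fr]]) (simp add: \<sigma>' add.commute)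
      moreover have "ireg ?\<sigma>2 11 = addr 1" "ireg ?\<sigma>2 12 = c" "ireg ?\<sigma>2 13 = r'"
        using fregs regs' r' by (simp_all add: \<sigma>' g addr_simps push_code_def)
      ultimately have "?Q ?\<sigma>2"
        unfolding rel_def x S r' by (auto intro!: exI[of _ "[(xs, (s, {s}))]"] exI[of _ r'] simp:
            addr_simps)
      then show "runs 2 (block [IAdd 11 30 5]) \<sigma>' ?Q" by (intro refines_block) auto
    qed (simp add: push_code_def)
    then have "runs (Suc (Suc (2 * length push_code + Suc (12 * (n + 2) + 4 + Suc 2)))) push_root \<sigma> ?Q"
      unfolding push_root_def using fregs regs' S r'
      by (intro refines_Cond) (auto simp: addr_simps intro!: refines_mono)
    then show ?thesis by (rule refines_mono) (auto simp: push_code_def)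
  qed
qed

lemma finish_spec:
  assumes fr: "frame \<sigma>" and st: "stack (imem \<sigma>) S" and z: "ireg \<sigma> 22 = z"
    and regs': "ireg \<sigma> 11 = addr (Suc (length S))" "ireg \<sigma> 12 = c" "ireg \<sigma> 13 = r"
  shows "refines 20 finish_prog \<sigma> (return_pmf (S @ replicate r (xs, (s, {s})), c + of_bool (z = v))) rel"
proof -
  note fregs = frame_regs[OF fr]
  let ?P = "Cond (ILe 22 15) (Cond (ILe 15 22) (block [IAdd 12 12 4]) Skip) Skip"
  have 1: "runs (Suc (Suc 2)) ?P \<sigma>
      (\<lambda>\<sigma>'. \<sigma>' = \<sigma>\<lparr>ireg := (ireg \<sigma>)(12 := c + of_bool (z = v))\<rparr>)"
    using fregs regs' z
    by (intro refines_Cond refines_block refines_Skip)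
      (auto intro!: state.equality simp: fun_eq_iff)
  have 2: "refines 2 (block [ISub 11 11 10]) \<sigma>' (return_pmf (S @ replicate r (xs, (s, {s})), c + of_bool
      (z = v))) rel"
    if \<sigma>': "\<sigma>' = \<sigma>\<lparr>ireg := (ireg \<sigma>)(12 := c + of_bool (z = v))\<rparr>" for \<sigma>'
  proof (intro refines_block)
    have "frame (fold det_exec [ISub 11 11 10] \<sigma>')" using fr by (auto simp: frame_def \<sigma>')
    then show "rel (S @ replicate r (xs, (s, {s})), c + of_bool (z = v)) (fold det_exec [ISub 11 11 10] \<sigma>')"
      unfolding rel_def using st regs' fregs
      by (intro exI[of _ S] exI[of _ r]) (simp add: \<sigma>' addr_Suc)
  qed auto
  show ?thesis unfolding finish_prog_def
    by (rule refines_mono[OF runs_Seq[OF 1 2]]) auto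
qed

definition fetch_post ::
  "nat \<Rightarrow> nat \<Rightarrow> nat \<Rightarrow> nat set \<Rightarrow> arc \<Rightarrow> real \<Rightarrow> real \<Rightarrow> state \<Rightarrow> state \<Rightarrow> bool" where
  "fetch_post sp j z A e a b \<sigma> \<sigma>' \<longleftrightarrow> (case e of (u, w, p) \<Rightarrow> w < n \<and>
    \<sigma>' = \<sigma>\<lparr>ireg := ireg \<sigma>', rreg := rreg \<sigma>', imem := (imem \<sigma>)(sp := Suc j)\<rparr> \<and>
    (\<forall>r. \<not> (20 \<le> r \<and> r < 42) \<longrightarrow> ireg \<sigma>' r = ireg \<sigma> r) \<and>
    (\<forall>r. r \<notin> {20, 21, 22} \<longrightarrow> rreg \<sigma>' r = rreg \<sigma> r) \<and>
    rreg \<sigma>' 20 = p \<and> rreg \<sigma>' 21 = a \<and> rreg \<sigma>' 22 = b \<and>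
    ireg \<sigma>' 24 = of_bool (u \<in> A) \<and> ireg \<sigma>' 26 = w \<and> ireg \<sigma>' 27 = sp + 2 + w \<and> ireg \<sigma>' 34 = of_bool (w \<in> A) \<and>
    (ireg \<sigma>' 36 = 0 \<longleftrightarrow> z = w) \<and> (ireg \<sigma>' 37 = 0 \<longleftrightarrow> z = u \<and> w \<notin> A))"

lemma fetch_spec:
  assumes fr: "frame \<sigma>" and j: "j < len" and x: "xs ! j = Stage (u, w, p) a b \<kappa>"
    and en: "entry (imem \<sigma>) sp (drop j xs, (z, A))" and lev: "imem \<sigma> sp = j"
    and regs': "ireg \<sigma> 11 = sp" "ireg \<sigma> 20 = j" "ireg \<sigma> 21 = sp + 1" "ireg \<sigma> 22 = z"
    and sp: "addr 1 \<le> sp"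
  shows "runs 52 (block fetch_code) \<sigma> (fetch_post sp j z A (u, w, p) a b \<sigma>)"
proof -
  note fregs = frame_regs[OF fr]
  obtain e u' w' \<kappa>' where e': "e < m" "u' < n" "w' < n" "imem \<sigma>0 (2 * m + j) = e" "imem \<sigma>0 (2 * e) = u'"
      "imem \<sigma>0 (2 * e + 1) = w'"
    and x': "xs ! j = Stage (u', w', 1 - rmem \<sigma>0 e) (rmem \<sigma>0 (m + j)) (rmem \<sigma>0 (2 * m + j)) \<kappa>'"
    using stages[OF j] by blast
  have "u' = u" "w' = w" using x x' by simp_all
  note e = e'[unfolded this]
  have pab: "p = 1 - rmem \<sigma>0 e" "a = rmem \<sigma>0 (m + j)" "b = rmem \<sigma>0 (2 * m + j)"
    using x x' by simp_all
  have fixed: "imem \<sigma> (2 * m + j) = e" "imem \<sigma> (e + e) = u" "imem \<sigma> (Suc (e + e)) = w" "rmem \<sigma> = rmem \<sigma>0"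
    using fr e j len unfolding frame_def by (simp_all add: addr_simps flip: mult_2)
  have bits: "imem \<sigma> (Suc (Suc (sp + u))) = of_bool (u \<in> A)" "imem \<sigma> (Suc (Suc (sp + w))) = of_bool (w \<in> A)"
    using en e(2,3) by (simp_all add: entry_def)
  define f where "f = (ireg \<sigma>)(23 := e, 25 := u, 26 := w, 24 := of_bool (u \<in> A), 27 := sp + 2 + w, 34 :=
      of_bool (w \<in> A),
    36 := z - w + (w - z), 38 := u - z, 37 := z - u + (u - z) + of_bool (w \<in> A), 20 := Suc j)"
  define g where "g = (rreg \<sigma>)(20 := p, 21 := a, 22 := b)"
  have eq: "fold det_exec fetch_code \<sigma> = \<sigma>\<lparr>ireg := f, rreg := g, imem := (imem \<sigma>)(sp := Suc j)\<rparr>"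
  proof (rule state.equality)
    show "ireg (fold det_exec fetch_code \<sigma>) = ireg (\<sigma>\<lparr>ireg := f, rreg := g, imem := (imem \<sigma>)(sp := Suc j)\<rparr>)"
      by (rule ext) (simp add: fetch_code_def fregs regs' fixed bits f_def)
    show "rreg (fold det_exec fetch_code \<sigma>) = rreg (\<sigma>\<lparr>ireg := f, rreg := g, imem := (imem \<sigma>)(sp := Suc j)\<rparr>)"
      by (rule ext) (simp add: fetch_code_def fregs regs' fixed g_def pab)
  qed (simp_all add: fetch_code_def regs' fregs)
  have nth: "\<forall>r. \<not> (20 \<le> r \<and> r < 42) \<longrightarrow> f r = ireg \<sigma> r" "\<forall>r. r \<notin> {20, 21, 22} \<longrightarrow> g r = rreg \<sigma> r"
    "g 20 = p" "g 21 = a" "g 22 = b" "f 24 = of_bool (u \<in> A)" "f 26 = w" "f 27 = sp + 2 + w" "f 34 =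
        of_bool (w \<in> A)"
    "f 36 = 0 \<longleftrightarrow> z = w" "f 37 = 0 \<longleftrightarrow> z = u \<and> w \<notin> A"
    by (auto simp: f_def g_def)
  show ?thesis
  proof (rule refines_block, goal_cases)
    case 2
    show ?case unfolding eq using e(3) nth by (simp add: fetch_post_def)
  qed (simp_all add: fetch_code_def)
qed

definition fetched ::
  "nat \<Rightarrow> nat set \<Rightarrow> nat \<Rightarrow> stage list \<Rightarrow> (stage list \<times> particle) list \<Rightarrow> nat \<Rightarrow> nat \<Rightarrow> real \<Rightarrow> real \<Rightarrow> bool \<Rightarrow> bool
    \<Rightarrow> state \<Rightarrow> bool" where
  "fetched z A w ys S c r a b t branch \<sigma> \<longleftrightarrow> frame \<sigma> \<and> stack (imem \<sigma>) S \<and>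
     entry (imem \<sigma>) (addr (Suc (length S))) (ys, (z, A)) \<and> ireg \<sigma> 11 = addr (Suc (length S)) \<and>
     ireg \<sigma> 12 = c \<and> ireg \<sigma> 13 = r \<and> ireg \<sigma> 26 = w \<and> w < n \<and> ireg \<sigma> 27 = addr (Suc (length S)) + 2 + w \<and>
     ireg \<sigma> 39 = of_bool t \<and> (ireg \<sigma> 36 = 0 \<longleftrightarrow> z = w) \<and> (ireg \<sigma> 37 = 0 \<longleftrightarrow> branch) \<and>
     rreg \<sigma> 21 = a \<and> rreg \<sigma> 22 = b"

lemma frame_write:
  assumes "frame \<sigma>" "\<And>r. r \<notin> {11, 12, 13} \<Longrightarrow> \<not> (20 \<le> r \<and> r < 42) \<Longrightarrow> ireg \<sigma>' r = ireg \<sigma> r"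
    "\<And>r. r \<notin> {20, 21, 22} \<Longrightarrow> rreg \<sigma>' r = rreg \<sigma> r" "rmem \<sigma>' = rmem \<sigma>"
    "\<And>b. b < addr 1 \<Longrightarrow> imem \<sigma>' b = imem \<sigma> b"
  shows "frame \<sigma>'"
  using assms unfolding frame_def by auto

text \<open>The new vertex set differs from the old one at most in \<open>w\<close>, so one store
  updates the entry. The two conclusions cover the death and the survival of the particle.\<close>

lemma rel_replace_top:
  assumes f: "fetched z A w ys S c r a b (w \<in> A') branch \<sigma>" and A': "\<And>x. x \<noteq> w \<Longrightarrow> x \<in> A' \<longleftrightarrow> x \<in> A"
    and \<sigma>': "\<And>q. q \<notin> {11, 12, 13} \<Longrightarrow> \<not> (20 \<le> q \<and> q < 42) \<Longrightarrow> ireg \<sigma>' q = ireg \<sigma> q"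
      "rreg \<sigma>' = rreg \<sigma>" "rmem \<sigma>' = rmem \<sigma>"
      "imem \<sigma>' = (imem \<sigma>)(addr (Suc (length S)) + 2 + w := of_bool (w \<in> A'))"
      "ireg \<sigma>' 12 = c" "ireg \<sigma>' 13 = r" and R: "R = replicate r (xs, (s, {s}))"
  shows "ireg \<sigma>' 11 = addr (length S) \<Longrightarrow> rel (S @ R, c) \<sigma>'"
    "ireg \<sigma>' 11 = addr (Suc (length S)) \<Longrightarrow> rel ((ys, (z, A')) # S @ R, c) \<sigma>'"
proof -
  have fr: "frame \<sigma>'"
    using f \<sigma>' addr_simps(5)[of "length S"] by (intro frame_write[of \<sigma> \<sigma>']) (auto simp: fetched_def)
  have st: "stack (imem \<sigma>') S"
    using f \<sigma>' stack_cong[of S "imem \<sigma>'" "imem \<sigma>"] by (auto simp: fetched_def)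
  have en: "entry (imem \<sigma>') (addr (Suc (length S))) (ys, (z, A'))"
    unfolding \<sigma>' using f A' by (intro entry_set_bit[of _ _ _ _ A]) (auto simp: fetched_def)
  show "rel (S @ R, c) \<sigma>'" if "ireg \<sigma>' 11 = addr (length S)"
    unfolding rel_def using fr st that \<sigma>' R by auto
  show "rel ((ys, (z, A')) # S @ R, c) \<sigma>'" if "ireg \<sigma>' 11 = addr (Suc (length S))"
    unfolding rel_def using fr st that \<sigma>' en R by (auto intro!: exI[of _ "(ys, (z, A')) # S"])
qed

lemma stay_spec:
  assumes f: "fetched z A w ys S c r a b (w \<in> A') branch \<sigma>" and A': "\<And>x. x \<noteq> w \<Longrightarrow> x \<in> A' \<longleftrightarrow> x \<in> A"
    and R: "R = replicate r (xs, (s, {s}))"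
  shows "refines 10 stay_prog \<sigma>
    (map_pmf (\<lambda>k. (map (Pair ys) (if k then [(z, A')] else []) @ S @ R, c)) (bernoulli_pmf a)) rel"
proof -
  have fr: "frame \<sigma>" and regs': "ireg \<sigma> 11 = addr (Suc (length S))" "ireg \<sigma> 12 = c" "ireg \<sigma> 13 = r"
    "ireg \<sigma> 27 = addr (Suc (length S)) + 2 + w" "ireg \<sigma> 39 = of_bool (w \<in> A')" "rreg \<sigma> 21 = a"
    using f by (auto simp: fetched_def)
  note fregs = frame_regs[OF fr]
  have "refines (2 + (2 * length [IStore 27 39] + Suc (Suc 2))) stay_prog \<sigma>
    (bernoulli_pmf a \<bind> (\<lambda>k. return_pmf (map (Pair ys) (if k then [(z, A')] else []) @ S @ R, c))) rel"
    unfolding stay_prog_def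
  proof (intro refines_Flip_Seq refines_block_Seq refines_Cond regs')
    fix k
    let ?\<sigma>1 = "\<sigma>\<lparr>ireg := (ireg \<sigma>)(41 := if k then 1 else 0)\<rparr>"
    let ?\<sigma>2 = "fold det_exec [IStore 27 39] ?\<sigma>1"
    show "refines 2 (block [ISub 11 11 10]) ?\<sigma>2
        (return_pmf (map (Pair ys) (if k then [(z, A')] else []) @ S @ R, c)) rel" if "holds (ILe 41 5) ?\<sigma>2"
    proof -
      have k: "\<not> k" using that fregs by (auto split: if_splits)
      have "rel (S @ R, c) (fold det_exec [ISub 11 11 10] ?\<sigma>2)"
        by (rule rel_replace_top(1)[OF f A' _ _ _ _ _ _ R]) (auto simp: regs' fregs addr_Suc)
      then show ?thesis using k by (intro refines_block) auto
    qed
    show "refines 2 Skip ?\<sigma>2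
        (return_pmf (map (Pair ys) (if k then [(z, A')] else []) @ S @ R, c)) rel" if "\<not> holds (ILe 41 5)
            ?\<sigma>2"
    proof -
      have k: "k" using that fregs by (auto split: if_splits)
      have "rel ((ys, (z, A')) # S @ R, c) ?\<sigma>2"
        by (rule rel_replace_top(2)[OF f A' _ _ _ _ _ _ R]) (auto simp: regs' fregs)
      then show ?thesis using k by (intro refines_Skip) auto
    qed
  qed auto
  then show ?thesis unfolding map_pmf_def by (rule refines_mono) auto
qed

lemma spawn_spec:
  assumes f: "fetched z A w ys S c r a b (w \<in> A') branch \<sigma>" and A': "\<And>x. x \<noteq> w \<Longrightarrow> x \<in> A' \<longleftrightarrow> x \<in> A"
    and R: "R = replicate r (xs, (s, {s}))"
  shows "refines (12 * n + 60) spawn_prog \<sigma>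
    (return_pmf ((ys, (w, insert w A)) # (ys, (z, A')) # S @ R, c)) rel"
proof -
  let ?sp = "addr (Suc (length S))"
  let ?sp' = "addr (Suc (Suc (length S)))"
  let ?I = "[IAdd 29 11 5, IAdd 30 11 10]"
  let ?J = "[IStore 27 39, IAdd 11 30 5, IAdd 40 11 4, IStore 40 26, IAdd 40 40 4, IAdd 40 40 26, IStore
      40 4]"
  let ?x = "((ys, (w, insert w A)) # (ys, (z, A')) # S @ R, c)"
  have fr: "frame \<sigma>" and regs': "ireg \<sigma> 11 = ?sp" "ireg \<sigma> 12 = c" "ireg \<sigma> 13 = r" "ireg \<sigma> 26 = w"
    "ireg \<sigma> 27 = ?sp + 2 + w" "ireg \<sigma> 39 = of_bool (w \<in> A')"
    and wn: "w < n" and st: "stack (imem \<sigma>) S" and en: "entry (imem \<sigma>) ?sp (ys, (z, A))"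
    using f by (auto simp: fetched_def)
  note fregs = frame_regs[OF fr]
  let ?\<sigma>1 = "fold det_exec ?I \<sigma>"
  let ?M = "\<lambda>a. if ?sp' \<le> a \<and> a < ?sp' + (n + 2) then imem \<sigma> (a - ?sp' + ?sp) else imem \<sigma> a"
  have im1: "imem ?\<sigma>1 = imem \<sigma>" by simp
  have copy: "runs (12 * (n + 2) + 4) copy_prog ?\<sigma>1 (\<lambda>\<sigma>'. \<exists>g.
    \<sigma>' = ?\<sigma>1\<lparr>ireg := g, imem := ?M\<rparr> \<and> (\<forall>r. r \<notin> {31, 32, 33} \<longrightarrow> g r = ireg ?\<sigma>1 r))"
    unfolding im1[symmetric] using fregs regs' by (intro copy_spec) (simp_all add: addr_Suc)
  have "refines (2 * length ?I + Suc (12 * (n + 2) + 4 + Suc 14)) spawn_prog \<sigma> (return_pmf ?x) rel"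
    unfolding spawn_prog_def
  proof (intro refines_block_Seq runs_Seq[OF copy])
    fix \<sigma>' assume "\<exists>g. \<sigma>' = ?\<sigma>1\<lparr>ireg := g, imem := ?M\<rparr> \<and> (\<forall>r. r \<notin> {31, 32, 33} \<longrightarrow> g r = ireg ?\<sigma>1 r)"
    then obtain g where \<sigma>': "\<sigma>' = ?\<sigma>1\<lparr>ireg := g, imem := ?M\<rparr>"
      and g: "\<And>r. r \<notin> {31, 32, 33} \<Longrightarrow> g r = ireg ?\<sigma>1 r" by blast
    have gr: "g 11 = ?sp" "g 12 = c" "g 13 = r" "g 26 = w" "g 27 = ?sp + 2 + w" "g 39 = of_bool (w \<in> A')"
      "g 30 = ?sp'" "g 4 = 1" "g 5 = 0"
      by (simp_all add: g regs' fregs addr_Suc)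
    define \<sigma>2 where "\<sigma>2 = fold det_exec ?J \<sigma>'"
    have im: "imem \<sigma>2 = ?M(?sp + 2 + w := of_bool (w \<in> A'), ?sp' + 1 := w, ?sp' + 2 + w := 1)"
      by (simp add: \<sigma>2_def \<sigma>' gr)
    have fr2: "frame \<sigma>2"
      by (rule frame_write[OF fr]) (use addr_simps(5)[of "length S"] in \<open>auto simp: \<sigma>2_def \<sigma>' gr g fregs
          regs' addr_Suc\<close>)
    have "stack (imem \<sigma>2) S = stack (imem \<sigma>) S"
      by (intro stack_cong) (auto simp: im addr_Suc)
    then have st2: "stack (imem \<sigma>2) S" using st by simp
    have "entry (imem \<sigma>2) ?sp (ys, (z, A')) =
        entry ((imem \<sigma>)(?sp + 2 + w := of_bool (w \<in> A'))) ?sp (ys, (z, A'))"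
      using wn by (intro entry_cong) (auto simp: im addr_Suc)
    then have e1: "entry (imem \<sigma>2) ?sp (ys, (z, A'))"
      using entry_set_bit[OF en A'] by simp
    have "entry ?M ?sp' (ys, (z, A))"
      by (rule entry_copy[OF _ en]) (simp add: add.commute)
    then have "entry (?M(?sp' + 1 := w)) ?sp' (ys, (w, A))"
      by (simp add: entry_def)
    then have "entry (?M(?sp' + 1 := w, ?sp' + 2 + w := of_bool (w \<in> insert w A))) ?sp' (ys, (w, insert w
        A))"
      by (rule entry_set_bit) auto
    moreover have "entry (imem \<sigma>2) ?sp' (ys, (w, insert w A)) =
      entry (?M(?sp' + 1 := w, ?sp' + 2 + w := of_bool (w \<in> insert w A))) ?sp' (ys, (w, insert w A))"
      using wn by (intro entry_cong) (auto simp: im addr_Suc)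
    ultimately have e2: "entry (imem \<sigma>2) ?sp' (ys, (w, insert w A))" by simp
    have "ireg \<sigma>2 11 = ?sp'" "ireg \<sigma>2 12 = c" "ireg \<sigma>2 13 = r" by (simp_all add: \<sigma>2_def \<sigma>' gr)
    then have "rel ?x \<sigma>2"
      unfolding rel_def using fr2 st2 e1 e2 R
      by (intro exI[of _ "(ys, (w, insert w A)) # (ys, (z, A')) # S"] exI[of _ r])
        simp
    then show "refines 14 (block ?J) \<sigma>' (return_pmf ?x) rel" unfolding \<sigma>2_def by (intro refines_block) auto
  qed auto
  then show ?thesis by (rule refines_mono) auto
qed

lemma move_spec:
  assumes f: "fetched z A w ys S c r a b (w \<in> A') branch \<sigma>" and A': "\<And>x. x \<noteq> w \<Longrightarrow> x \<in> A' \<longleftrightarrow> x \<in> A"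
    and R: "R = replicate r (xs, (s, {s}))"
  shows "refines (12 * n + 70) move_prog \<sigma>
    (map_pmf (\<lambda>k. (map (Pair ys) ((if k \<and> branch then [(w, insert w A)] else []) @ [(z, A')]) @ S @ R, c))
      (bernoulli_pmf b)) rel"
proof -
  have fr: "frame \<sigma>" and regs': "rreg \<sigma> 22 = b" and br: "ireg \<sigma> 37 = 0 \<longleftrightarrow> branch"
    using f by (auto simp: fetched_def)
  note fregs = frame_regs[OF fr]
  let ?I = "[ISub 41 4 41, IAdd 37 37 41]"
  have "refines (2 + (2 * length ?I + Suc (Suc (12 * n + 60)))) move_prog \<sigma>
    (bernoulli_pmf b \<bind> (\<lambda>k. return_pmf (map (Pair ys) ((if k \<and> branch then [(w, insert w A)] else []) @
        [(z, A')]) @ S @ R, c))) rel"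
    unfolding move_prog_def
  proof (intro refines_Flip_Seq refines_block_Seq refines_Cond regs')
    fix k
    let ?\<sigma>2 = "fold det_exec ?I (\<sigma>\<lparr>ireg := (ireg \<sigma>)(41 := if k then 1 else 0)\<rparr>)"
    let ?y = "(map (Pair ys) ((if k \<and> branch then [(w, insert w A)] else []) @ [(z, A')]) @ S @ R, c)"
    obtain g where \<sigma>2: "?\<sigma>2 = \<sigma>\<lparr>ireg := g\<rparr>" and g: "\<And>q. q \<notin> {37, 41} \<Longrightarrow> g q = ireg \<sigma> q"
      and g37: "g 37 = ireg \<sigma> 37 + (1 - (if k then 1 else 0))"
      using fregs by simp
    have "frame (\<sigma>\<lparr>ireg := g\<rparr>)" by (rule frame_write[OF fr]) (auto simp: g)
    then have f2: "fetched z A w ys S c r a b (w \<in> A') (g 37 = 0) (\<sigma>\<lparr>ireg := g\<rparr>)"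
      using f by (simp add: fetched_def g)
    have z: "g 37 = 0 \<longleftrightarrow> k \<and> branch" and five: "g 5 = 0" using br fregs by (auto simp: g37 g)
    show "refines (12 * n + 60) spawn_prog ?\<sigma>2 (return_pmf ?y) rel" if "holds (ILe 37 5) ?\<sigma>2"
    proof -
      have "k \<and> branch" using that five z unfolding \<sigma>2 by simp
      then show ?thesis using spawn_spec[OF f2 A' R] unfolding \<sigma>2 by simp
    qed
    show "refines (12 * n + 60) (block [IStore 27 39]) ?\<sigma>2 (return_pmf ?y) rel" if "\<not> holds (ILe 37 5) ?\<sigma>2"
    proof -
      have k: "\<not> (k \<and> branch)" using that five z unfolding \<sigma>2 by simp
      have "rel ((ys, (z, A')) # S @ R, c) (fold det_exec [IStore 27 39] (\<sigma>\<lparr>ireg := g\<rparr>))"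
        by (rule rel_replace_top(2)[OF f2 A' _ _ _ _ _ _ R]) (use f2 in \<open>auto simp: fetched_def\<close>)
      then show ?thesis using k unfolding \<sigma>2 by (intro refines_block) auto
    qed
  qed auto
  then show ?thesis unfolding map_pmf_def by (rule refines_mono) auto
qed

lemma advance_spec:
  assumes fr: "frame \<sigma>" and st: "stack (imem \<sigma>) S" and j: "j < len"
    and en: "entry (imem \<sigma>) sp (drop j xs, (z, A))" and lev: "imem \<sigma> sp = j" and sp: "sp = addr (Suc
        (length S))"
    and regs': "ireg \<sigma> 11 = sp" "ireg \<sigma> 20 = j" "ireg \<sigma> 21 = sp + 1" "ireg \<sigma> 22 = z" "ireg \<sigma> 12 = c" "ireg
        \<sigma> 13 = r"
    and R: "R = replicate r (xs, (s, {s}))"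
  shows "refines (12 * n + 140) advance_prog \<sigma> (micro v ((drop j xs, (z, A)) # S @ R, c)) rel"
proof -
  note fregs = frame_regs[OF fr]
  obtain u w p a b \<kappa> where x: "xs ! j = Stage (u, w, p) a b \<kappa>" by (metis stage.exhaust prod.exhaust)
  define ys where "ys = drop (Suc j) xs"
  have dr: "drop j xs = Stage (u, w, p) a b \<kappa> # ys"
    using j len x by (simp add: ys_def Cons_nth_drop_Suc[symmetric])
  define A' where "A' x = (if x then grow (u, w, p) A else A)" for x
  define branch where "branch \<longleftrightarrow> z = u \<and> w \<notin> A"
  have A': "y \<in> A' x \<longleftrightarrow> y \<in> A" if "y \<noteq> w" for x y using that by (simp add: A'_def)
  let ?stay = "\<lambda>x. map_pmf (\<lambda>k. (map (Pair ys) (if k then [(z, A' x)] else []) @ S @ R, c)) (bernoulli_pmf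
      a)"
  let ?move = "\<lambda>x. map_pmf (\<lambda>k. (map (Pair ys) ((if k \<and> branch then [(w, insert w A)] else []) @ [(z, A'
      x)]) @ S @ R, c))
      (bernoulli_pmf b)"
  have mic: "micro v ((drop j xs, (z, A)) # S @ R, c) = bernoulli_pmf p \<bind> (\<lambda>x. if z = w then ?stay x else
      ?move x)"
    unfolding dr by (auto simp: map_bind_pmf pmf.map_comp o_def A'_def branch_def intro!: bind_pmf_cong
        map_pmf_cong)
  let ?F = "fetch_post sp j z A (u, w, p) a b \<sigma>"
  have fetch: "runs 52 (block fetch_code) \<sigma> ?F"
    using regs' sp addr_simps(5)[of "length S"] by (intro fetch_spec[OF fr j x en lev]) auto
  have rest: "refines (2 + (8 + Suc (Suc (12 * n + 70)))) (Seq (Do (Flip 35 20)) (Seq (block new_bit_code)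
     (Cond (ILe 36 5) stay_prog move_prog))) \<sigma>1 (bernoulli_pmf p \<bind> (\<lambda>x. if z = w then ?stay x else ?move
         x)) rel"
    if "?F \<sigma>1" for \<sigma>1
  proof (rule refines_Flip_Seq)
    note F = that[unfolded fetch_post_def, simplified]
    show "rreg \<sigma>1 20 = p" using F by simp
    fix t :: bool
    let ?\<sigma>t = "\<sigma>1\<lparr>ireg := (ireg \<sigma>1)(35 := if t then 1 else 0)\<rparr>"
    define f where "f = ireg (fold det_exec new_bit_code ?\<sigma>t)"
    have eq: "fold det_exec new_bit_code ?\<sigma>t = \<sigma>1\<lparr>ireg := f\<rparr>"
      by (rule state.equality) (simp_all add: new_bit_code_def f_def)
    have \<sigma>1: "\<sigma>1 = \<sigma>\<lparr>ireg := ireg \<sigma>1, rreg := rreg \<sigma>1, imem := (imem \<sigma>)(sp := Suc j)\<rparr>"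
      and wn: "w < n" using that by (auto simp: fetch_post_def)
    have im: "imem \<sigma>1 = (imem \<sigma>)(sp := Suc j)" and rm: "rmem \<sigma>1 = rmem \<sigma>"
      by (subst \<sigma>1; simp)+
    have f: "f q = ireg \<sigma>1 q" if "q \<notin> {35, 39, 40}" for q using that by (simp add: f_def new_bit_code_def)
    have one: "ireg \<sigma>1 4 = 1" using F fregs by simp
    have f39: "f 39 = of_bool (w \<in> A' t)"
      using F one by (auto simp: f_def new_bit_code_def A'_def of_bool_def split: if_splits)
    have fr1: "frame (\<sigma>1\<lparr>ireg := f\<rparr>)"
      by (rule frame_write[OF fr]) (use F f im rm sp addr_simps(5)[of "length S"] in auto)
    have st1: "stack (imem \<sigma>1) S"
      using st stack_cong[of S "imem \<sigma>1" "imem \<sigma>"] by (simp add: im sp)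
    have en1: "entry (imem \<sigma>1) sp (ys, (z, A))"
      using en j by (auto simp: entry_def im ys_def)
    have fet: "fetched z A w ys S c r a b (w \<in> A' t) branch (\<sigma>1\<lparr>ireg := f\<rparr>)"
      unfolding fetched_def using fr1 st1 en1 sp F f39 wn regs' by (simp add: f branch_def)
    have "refines (Suc (12 * n + 70)) (Cond (ILe 36 5) stay_prog move_prog) (\<sigma>1\<lparr>ireg := f\<rparr>) (if z = w then
        ?stay t else ?move t) rel"
    proof (rule refines_Cond)
      have 36: "f 36 = 0 \<longleftrightarrow> z = w" and five: "f 5 = 0" using F f fregs by auto
      show "refines (12 * n + 70) stay_prog (\<sigma>1\<lparr>ireg := f\<rparr>) (if z = w then ?stay t else ?move t) rel"
        if "holds (ILe 36 5) (\<sigma>1\<lparr>ireg := f\<rparr>)"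
      proof -
        have "z = w" using that 36 five by simp
        then show ?thesis using refines_mono[OF stay_spec[OF fet A' R], of "12 * n + 70"] by simp
      qed
      show "refines (12 * n + 70) move_prog (\<sigma>1\<lparr>ireg := f\<rparr>) (if z = w then ?stay t else ?move t) rel"
        if "\<not> holds (ILe 36 5) (\<sigma>1\<lparr>ireg := f\<rparr>)"
      proof -
        have "z \<noteq> w" using that 36 five by simp
        then show ?thesis using move_spec[OF fet A' R] by simp
      qed
    qed
    then have "refines (2 * length new_bit_code + Suc (Suc (12 * n + 70))) (Seq (block new_bit_code) (Cond
        (ILe 36 5) stay_prog move_prog))
       ?\<sigma>t (if z = w then ?stay t else ?move t) rel"
      unfolding eq[symmetric] by (intro refines_block_Seq) (simp_all add: new_bit_code_def)
    then show "refines (8 + Suc (Suc (12 * n + 70))) (Seq (block new_bit_code) (Cond (ILe 36 5) stay_prog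
        move_prog))
       ?\<sigma>t (if z = w then ?stay t else ?move t) rel" by (simp add: new_bit_code_def)
  qed
  show ?thesis unfolding mic advance_prog_def
    by (rule refines_mono[OF runs_Seq[OF fetch rest]]) auto
qed

lemma process_spec:
  assumes rel: "rel x \<sigma>" and ne: "fst x \<noteq> [] \<longrightarrow> addr 0 < ireg \<sigma> 11"
  shows "refines (12 * n + 150) process_prog \<sigma> (micro v x) rel"
proof -
  obtain S r c where x: "x = (S @ replicate r (xs, (s, {s})), c)" and fr: "frame \<sigma>"
    and st: "stack (imem \<sigma>) S" and regs': "ireg \<sigma> 11 = addr (length S)" "ireg \<sigma> 12 = c" "ireg \<sigma> 13 = r"
    using rel by (cases x) (auto simp: rel_def)
  note fregs = frame_regs[OF fr]
  let ?I = "[ILoad 20 11, IAdd 21 11 4, ILoad 22 21]"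
  let ?R = "replicate r (xs, (s, {s}))"
  have "refines (Suc (2 * length ?I + Suc (Suc (12 * n + 140)))) process_prog \<sigma> (micro v x) rel"
    unfolding process_prog_def
  proof (rule refines_Cond)
    assume "holds (ILe 11 9) \<sigma>"
    then have "fst x = []" using ne fregs addr_simps by auto
    then show "refines (2 * length ?I + Suc (Suc (12 * n + 140))) Skip \<sigma> (micro v x) rel"
      using rel by (cases x) (auto intro!: refines_Skip)
  next
    assume "\<not> holds (ILe 11 9) \<sigma>"
    then have "S \<noteq> []" using fregs regs' addr_simps by auto
    then obtain ys z A S' where S: "S = (ys, (z, A)) # S'" by (metis list.exhaust prod.exhaust)
    let ?sp = "addr (Suc (length S'))"
    let ?\<sigma>1 = "fold det_exec ?I \<sigma>"
    obtain j where j: "j \<le> len" "imem \<sigma> ?sp = j" "ys = drop j xs" and z: "imem \<sigma> (?sp + 1) = z"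
      and en: "entry (imem \<sigma>) ?sp (ys, (z, A))" and st': "stack (imem \<sigma>) S'"
      using st by (auto simp: S entry_def)
    obtain f where \<sigma>1: "?\<sigma>1 = \<sigma>\<lparr>ireg := f\<rparr>" and f: "\<And>q. q \<notin> {20, 21, 22} \<Longrightarrow> f q = ireg \<sigma> q"
      and f': "f 20 = j" "f 21 = ?sp + 1" "f 22 = z"
      using fregs regs' j z by (simp add: S)
    have fr1: "frame (\<sigma>\<lparr>ireg := f\<rparr>)" by (rule frame_write[OF fr]) (auto simp: f)
    have mx: "micro v x = micro v ((drop j xs, (z, A)) # S' @ ?R, c)" by (simp add: x S j)
    have "refines (Suc (12 * n + 140)) (Cond (ILe 14 20) finish_prog advance_prog) (\<sigma>\<lparr>ireg := f\<rparr>) (micro v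
        x) rel"
    proof (rule refines_Cond)
      assume "holds (ILe 14 20) (\<sigma>\<lparr>ireg := f\<rparr>)"
      then have "drop j xs = []" using f f' fregs len by simp
      then have "micro v x = return_pmf (S' @ ?R, c + of_bool (z = v))" by (simp add: mx)
      moreover have "refines 20 finish_prog (\<sigma>\<lparr>ireg := f\<rparr>) (return_pmf (S' @ ?R, c + of_bool (z = v))) rel"
        using st' f' regs' by (intro finish_spec[OF fr1]) (auto simp: f S)
      ultimately show "refines (12 * n + 140) finish_prog (\<sigma>\<lparr>ireg := f\<rparr>) (micro v x) rel"
        by (auto intro: refines_mono)
    next
      assume "\<not> holds (ILe 14 20) (\<sigma>\<lparr>ireg := f\<rparr>)"
      then have "j < len" using f f' fregs by simp
      then show "refines (12 * n + 140) advance_prog (\<sigma>\<lparr>ireg := f\<rparr>) (micro v x) rel"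
        unfolding mx using st' f' regs' en j
        by (intro advance_spec[OF fr1 _ _ _ _ refl]) (auto simp: f S)
    qed
    then have "refines (Suc (12 * n + 140)) (Cond (ILe 14 20) finish_prog advance_prog) ?\<sigma>1 (micro v x) rel"
      unfolding \<sigma>1 .
    then show "refines (2 * length ?I + Suc (Suc (12 * n + 140)))
      (Seq (block ?I) (Cond (ILe 14 20) finish_prog advance_prog)) \<sigma> (micro v x) rel"
      by (intro refines_block_Seq) auto
  qed
  then show ?thesis by (rule refines_mono) auto
qed

lemma micro_spec:
  assumes "rel x \<sigma>"
  shows "refines (24 * n + 200) micro_prog \<sigma> (micro v x) rel"
  unfolding micro_prog_def
  by (rule refines_mono[OF runs_Seq[OF push_root_spec[OF assms] process_spec]]) auto

end

text \<open>The budget is counted down in a real register: it is a product, and naturals have no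
  multiplication. Register 2 holds 0 and register 1 holds 1.\<close>

definition micro_loop :: prog where
  "micro_loop = While (RLess 2 4) (Seq micro_prog (block [RSub 4 4 1]))"

lemma micro_loop_spec:
  assumes sam: "sampler \<sigma>0 n m s v len xs" and zero: "rreg \<sigma>0 2 = 0"
    and init: "sampler.rel \<sigma>0 n m s len xs (real F) x \<sigma>"
  shows "refines (F * (24 * n + 210) + 1) micro_loop \<sigma>
    (iterate_pmf F (micro v) x) (sampler.rel \<sigma>0 n m s len xs 0)"
proof -
  interpret S: sampler \<sigma>0 n m s v len xs \<phi> for \<phi> by (rule sam)
  have regs: "rreg \<sigma> 4 = \<phi>" "rreg \<sigma> 1 = 1" "rreg \<sigma> 2 = 0" if "S.rel \<phi> x \<sigma>" for \<phi> x \<sigma>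
    using that zero S.regs by (auto simp: S.rel_def S.frame_def)
  have dec: "S.rel (real k) x (fold det_exec [RSub 4 4 1] \<sigma>)" if "S.rel (real (Suc k)) x \<sigma>" for k x \<sigma>
    using that regs[OF that] unfolding S.rel_def S.frame_def by auto
  have "refines (F * (24 * n + 203 + 2) + 1) micro_loop \<sigma>
    (iterate_pmf F (micro v) x) (S.rel (real 0))"
    unfolding micro_loop_def
  proof (rule refines_While[where I = "\<lambda>k. S.rel (real k)"])
    fix k x \<sigma> assume r: "S.rel (real (Suc k)) x \<sigma>"
    have "refines (24 * n + 200 + Suc 2) (Seq micro_prog (block [RSub 4 4 1])) \<sigma> (micro v x \<bind> return_pmf)
        (S.rel (real k))"
      by (rule refines_Seq[OF S.micro_spec[OF r]], rule refines_block) (use dec in auto)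
    then show "holds (RLess 2 4) \<sigma> \<and> refines (24 * n + 203) (Seq micro_prog (block [RSub 4 4 1])) \<sigma> (micro
        v x) (S.rel (real k))"
      using regs[OF r] by (simp add: bind_return_pmf' add.commute)
  next
    show "\<not> holds (RLess 2 4) \<sigma>" if "S.rel (real 0) x \<sigma>" for x \<sigma> using regs[OF that] by simp
  qed (rule init)
  then show ?thesis by (rule refines_mono) auto
qed

section \<open>The sorting program\<close>

definition count_code :: "instr list" where
  "count_code = [IAdd 21 20 20, IAdd 21 21 4, ILoad 21 21, IAdd 21 7 21, ILoad 22 21, IAdd 22 22 4, IStore
      21 22,
     IAdd 20 20 4]"

text \<open>Register 22 receives the flag of the arc plus the number of pending arcs into its tail,
  which is 0 exactly for ready arcs.\<close>

definition probe_code :: "instr list" where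
  "probe_code = [IAdd 21 8 20, ILoad 22 21, IAdd 23 20 20, ILoad 24 23, IAdd 24 7 24, ILoad 24 24, IAdd 22
      22 24]"

definition select_code :: "instr list" where
  "select_code = [IAdd 25 6 18, IStore 25 20, IAdd 18 18 4, IStore 21 4, IAdd 23 23 4, ILoad 23 23, IAdd
      23 7 23,
     ILoad 24 23, ISub 24 24 4, IStore 23 24]"

definition visit_prog :: prog where
  "visit_prog = Seq (block probe_code) (Seq (Cond (ILe 22 5) (block select_code) Skip) (block [IAdd 20 20
      4]))"

definition pass_prog :: prog where
  "pass_prog = Seq (block [IConst 20 0]) (Seq (While (ILess 20 1) visit_prog) (block [IAdd 19 19 4]))"

definition sort_prog :: prog where
  "sort_prog = Seq (While (ILess 20 1) (block count_code)) (While (ILess 19 1) pass_prog)"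

text \<open>A closed form of the whole index memory, so that stores become updates of the order or
  of the counters. With empty order and zero counters it is the input memory.\<close>

definition layout :: "(nat \<times> nat) list \<Rightarrow> nat \<Rightarrow> nat list \<Rightarrow> (nat \<Rightarrow> nat) \<Rightarrow> nat \<Rightarrow> nat" where
  "layout es n L C a = (let m = length es in
     if a < 2 * m then (if even a then fst else snd) (es ! (a div 2))
     else if a < 3 * m then (if a - 2 * m < length L then L ! (a - 2 * m) else 0)
     else if a < 3 * m + n then C (a - 3 * m)
     else if a < 4 * m + n then of_bool (a - (3 * m + n) \<in> set L) else 0)"

text \<open>The counters of Kahn's algorithm: a test for 0 replaces the quantifier in
  \<open>ready\<close>, so that a pass takes time \<open>O(m)\<close>.\<close>

definition pending :: "(nat \<times> nat) list \<Rightarrow> nat set \<Rightarrow> nat \<Rightarrow> nat" where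
  "pending es D x = card {j. j < length es \<and> j \<notin> D \<and> snd (es ! j) = x}"

lemma layout_arc:
  assumes "e < length es"
  shows "layout es n L C (e + e) = fst (es ! e)" "layout es n L C (Suc (e + e)) = snd (es ! e)"
  using assms by (auto simp: layout_def simp flip: mult_2)

lemma layout_pending:
  "x < n \<Longrightarrow> layout es n L C (3 * length es + x) = C x"
  by (simp add: layout_def)

lemma layout_used: "e < length es \<Longrightarrow> layout es n L C (3 * length es + n + e) = of_bool (e \<in> set L)"
  by (simp add: layout_def)

lemma layout_update_pending:
  "x < n \<Longrightarrow> (layout es n L C)(3 * length es + x := y) = layout es n L (C(x := y))"
  by (auto simp: layout_def Let_def fun_eq_iff)

lemma layout_append:
  assumes "length L < length es" "e < length es"
  shows "(layout es n L C)(2 * length es + length L := e, 3 * length es + n + e := 1) = layout es n (L @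
      [e]) C"
  using assms by (auto simp: layout_def Let_def fun_eq_iff nth_append)

lemma pending_insert:
  assumes "e < length es" "e \<notin> D"
  shows "pending es (insert e D) = (pending es D)(snd (es ! e) := pending es D (snd (es ! e)) - 1)"
proof
  fix x
  let ?A = "\<lambda>D. {j. j < length es \<and> j \<notin> D \<and> snd (es ! j) = x}"
  show "pending es (insert e D) x = ((pending es D)(snd (es ! e) := pending es D (snd (es ! e)) - 1)) x"
  proof (cases "x = snd (es ! e)")
    case True
    then have "?A (insert e D) = ?A D - {e}" "e \<in> ?A D" using assms by auto
    then show ?thesis using True by (simp add: pending_def)
  next
    case False
    then have "?A (insert e D) = ?A D" by auto
    then show ?thesis using False by (simp add: pending_def)
  qed
qed

lemma pending_eq_0: "pending es D x = 0 \<longleftrightarrow> (\<forall>j<length es. snd (es ! j) = x \<longrightarrow> j \<in> D)"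
  unfolding pending_def by (auto simp: card_eq_0_iff)

locale sorting =
  fixes \<sigma>0 :: state and es :: "(nat \<times> nat) list" and n m :: nat
  assumes m: "m = length es"
    and arcs: "\<And>e. e < m \<Longrightarrow> fst (es ! e) < n \<and> snd (es ! e) < n"
    and regs: "ireg \<sigma>0 0 = n" "ireg \<sigma>0 1 = m" "ireg \<sigma>0 4 = 1" "ireg \<sigma>0 5 = 0" "ireg \<sigma>0 6 = 2 * m"
      "ireg \<sigma>0 7 = 3 * m" "ireg \<sigma>0 8 = 3 * m + n"
begin

definition inv :: "nat list \<Rightarrow> (nat \<Rightarrow> nat) \<Rightarrow> state \<Rightarrow> bool" where
  "inv L C \<sigma> \<longleftrightarrow> imem \<sigma> = layout es n L C \<and> ireg \<sigma> 18 = length L \<and>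
     (\<forall>r. \<not> (18 \<le> r \<and> r < 26) \<longrightarrow> ireg \<sigma> r = ireg \<sigma>0 r) \<and> rreg \<sigma> = rreg \<sigma>0 \<and> rmem \<sigma> = rmem \<sigma>0"

lemma inv_regs:
  assumes "inv L C \<sigma>"
  shows "ireg \<sigma> 0 = n" "ireg \<sigma> (Suc 0) = m" "ireg \<sigma> 4 = 1" "ireg \<sigma> 5 = 0" "ireg \<sigma> 6 = 2 * m"
      "ireg \<sigma> 7 = 3 * m" "ireg \<sigma> 8 = 3 * m + n" "ireg \<sigma> 18 = length L" "imem \<sigma> = layout es n L C"
  using assms regs by (auto simp: inv_def)

definition counts :: "nat \<Rightarrow> nat \<Rightarrow> nat" where
  "counts e x = card {j. j < e \<and> snd (es ! j) = x}"

lemma counts_Suc: "counts (Suc e) = (counts e)(snd (es ! e) := Suc (counts e (snd (es ! e))))"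
proof
  fix x
  have "{j. j < Suc e \<and> snd (es ! j) = x} =
    (if x = snd (es ! e) then insert e {j. j < e \<and> snd (es ! j) = x} else {j. j < e \<and> snd (es ! j) = x})"
    by (auto simp: less_Suc_eq)
  then show "counts (Suc e) x = ((counts e)(snd (es ! e) := Suc (counts e (snd (es ! e))))) x"
    by (simp add: counts_def)
qed

lemma count_loop_spec:
  assumes "inv [] (\<lambda>_. 0) \<sigma>" "ireg \<sigma> 20 = 0" "ireg \<sigma> 19 = 0"
  shows "runs (m * 18 + 1) (While (ILess 20 1) (block count_code)) \<sigma>
    (\<lambda>\<sigma>'. inv [] (pending es {}) \<sigma>' \<and> ireg \<sigma>' 19 = 0)"
proof -
  define I where "I k \<sigma> \<longleftrightarrow> k \<le> m \<and> inv [] (counts (m - k)) \<sigma> \<and> ireg \<sigma> 20 = m - k \<and> ireg \<sigma> 19 = 0" for k \<sigma>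
  have "runs (m * (16 + 2) + 1) (While (ILess 20 1) (block count_code)) \<sigma> (I 0)"
  proof (rule runs_While)
    fix k \<sigma> assume I: "I (Suc k) \<sigma>"
    define e where "e = m - Suc k"
    have k: "Suc k \<le> m" and e: "e < m" "m - k = Suc e" and i: "inv [] (counts e) \<sigma>" and r: "ireg \<sigma> 20 = e"
        "ireg \<sigma> 19 = 0"
      using I by (auto simp: I_def e_def)
    note ir = inv_regs[OF i]
    let ?w = "snd (es ! e)"
    have w: "?w < n" using arcs e by simp
    have im: "imem (fold det_exec count_code \<sigma>) = layout es n [] (counts (Suc e))"
      using e w unfolding counts_Suc
      by (simp add: count_code_def ir r m layout_arc layout_pending layout_update_pending)
    have "I k (fold det_exec count_code \<sigma>)"
      unfolding I_def inv_def im e(2) using k i ir r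
      by (auto simp: count_code_def inv_def)
    then have "runs 16 (block count_code) \<sigma> (I k)" by (intro refines_block) (auto simp: count_code_def)
    then show "holds (ILess 20 1) \<sigma> \<and> runs 16 (block count_code) \<sigma> (I k)" using e r ir by simp
  next
    show "\<not> holds (ILess 20 1) \<sigma>" if "I 0 \<sigma>" for \<sigma>
      using that inv_regs(2) by (auto simp: I_def)
    show "I m \<sigma>" using assms by (simp add: I_def counts_def[abs_def])
  qed
  moreover have "counts m = pending es {}" by (simp add: counts_def pending_def fun_eq_iff m)
  ultimately show ?thesis by (auto simp: I_def elim: refines_mono)
qed

lemma visit_spec:
  assumes i: "inv L (pending es (set L)) \<sigma>" and t: "topo es L" and e: "e < m" and r: "ireg \<sigma> 20 = e" "ireg
      \<sigma> 19 = i"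
  shows "runs 50 visit_prog \<sigma> (\<lambda>\<sigma>'. inv (visit es L e) (pending es (set (visit es L e))) \<sigma>' \<and> ireg \<sigma>' 20 =
      Suc e \<and> ireg \<sigma>' 19 = i)"
proof -
  note ir = inv_regs[OF i]
  let ?C = "pending es (set L)"
  let ?u = "fst (es ! e)" and ?w = "snd (es ! e)"
  have uw: "?u < n" "?w < n" using arcs e by auto
  have em: "e < length es" using e m by simp
  note lay = layout_arc[OF em, of n L ?C] layout_pending[OF uw(1), of es L ?C] layout_pending[OF uw(2), of
      es L ?C] layout_used[OF em, of n L ?C]
  define f where "f = (ireg \<sigma>)(21 := 3 * m + n + e, 22 := of_bool (e \<in> set L) + ?C ?u, 23 := e + e, 24 :=
      ?C ?u)"
  have eq: "fold det_exec probe_code \<sigma> = \<sigma>\<lparr>ireg := f\<rparr>"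
    using lay[folded m] by (intro state.equality) (auto simp: probe_code_def f_def ir r fun_eq_iff)
  have fr: "f 22 = 0 \<longleftrightarrow> ready es L e" "f 5 = 0"
    using ir by (auto simp: f_def ready_def pending_eq_0)
  let ?L = "visit es L e"
  let ?Q = "\<lambda>\<sigma>'. inv ?L (pending es (set ?L)) \<sigma>' \<and> ireg \<sigma>' 20 = e \<and> ireg \<sigma>' 19 = i"
  have "runs (Suc 20) (Cond (ILe 22 5) (block select_code) Skip) (\<sigma>\<lparr>ireg := f\<rparr>) ?Q"
  proof (rule refines_Cond)
    assume "\<not> holds (ILe 22 5) (\<sigma>\<lparr>ireg := f\<rparr>)"
    then have "?L = L" using fr by (simp add: visit_def)
    then show "runs 20 Skip (\<sigma>\<lparr>ireg := f\<rparr>) ?Q"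
      using i r by (intro refines_Skip) (auto simp: inv_def f_def)
  next
    assume "holds (ILe 22 5) (\<sigma>\<lparr>ireg := f\<rparr>)"
    then have rd: "ready es L e" using fr by simp
    then have L: "?L = L @ [e]" and eL: "e \<notin> set L" by (auto simp: visit_def ready_def)
    \<comment> \<open>As \<open>e\<close> is missing, the order is not yet full, and the next store
      stays inside its \<open>m\<close> cells.\<close>
    have "set L \<subset> {..<m}" using t eL e m by (auto simp: topo_def)
    then have "card (set L) < card {..<m}" by (intro psubset_card_mono) auto
    then have len: "length L < m" using t by (simp add: topo_def distinct_card)
    let ?M = "(layout es n L ?C)(2 * m + length L := e, 3 * m + n + e := 1)"
    have M: "?M = layout es n (L @ [e]) ?C"
      using layout_append[of L es e n ?C] len e m by simp
    have lay': "layout es n (L @ [e]) ?C (Suc (e + e)) = ?w" "layout es n (L @ [e]) ?C (3 * m + ?w) = ?C ?w"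
      using layout_arc[OF em, of n "L @ [e]" ?C] layout_pending[OF uw(2), of es "L @ [e]" ?C] m by auto
    define g where "g = f(25 := 2 * m + length L, 18 := Suc (length L), 23 := 3 * m + ?w, 24 := ?C ?w - 1)"
    have im: "imem (fold det_exec select_code (\<sigma>\<lparr>ireg := f\<rparr>)) = ?M(3 * m + ?w := ?C ?w - 1)"
      using lay' unfolding M[symmetric]
      by (simp add: select_code_def f_def ir r)
    have ig: "ireg (fold det_exec select_code (\<sigma>\<lparr>ireg := f\<rparr>)) = g"
      using lay' unfolding M[symmetric]
      by (auto simp: select_code_def f_def g_def ir r fun_eq_iff)
    have "?M(3 * m + ?w := ?C ?w - 1) = layout es n (L @ [e]) (pending es (set (L @ [e])))"
      unfolding M using layout_update_pending[OF uw(2), of es "L @ [e]" ?C "?C ?w - 1"] pending_insert[OF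
          em eL] m by simp
    then have "?Q (fold det_exec select_code (\<sigma>\<lparr>ireg := f\<rparr>))"
      unfolding L inv_def im ig using i r
      by (auto simp: g_def f_def inv_def select_code_def)
    then show "runs 20 (block select_code) (\<sigma>\<lparr>ireg := f\<rparr>) ?Q"
      by (intro refines_block) (auto simp: select_code_def)
  qed
  then have "runs (Suc 20 + Suc 2) (Seq (Cond (ILe 22 5) (block select_code) Skip) (block [IAdd 20 20 4]))
      (\<sigma>\<lparr>ireg := f\<rparr>)
    (\<lambda>\<sigma>'. inv ?L (pending es (set ?L)) \<sigma>' \<and> ireg \<sigma>' 20 = Suc e \<and> ireg \<sigma>' 19 = i)"
  proof (rule runs_Seq)
    fix \<sigma>' assume Q: "?Q \<sigma>'"
    then have "ireg \<sigma>' 4 = 1" using inv_regs(3) by blast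
    with Q show "runs 2 (block [IAdd 20 20 4]) \<sigma>' (\<lambda>\<sigma>'. inv ?L (pending es (set ?L)) \<sigma>' \<and> ireg \<sigma>' 20 = Suc
        e \<and> ireg \<sigma>' 19 = i)"
      by (intro refines_block) (auto simp: inv_def)
  qed
  then have "runs (2 * length probe_code + Suc (Suc 20 + Suc 2)) visit_prog \<sigma>
    (\<lambda>\<sigma>'. inv ?L (pending es (set ?L)) \<sigma>' \<and> ireg \<sigma>' 20 = Suc e \<and> ireg \<sigma>' 19 = i)"
    unfolding visit_prog_def eq[symmetric] by (intro refines_block_Seq) (simp_all add: probe_code_def)
  then show ?thesis by (rule refines_mono) (auto simp: probe_code_def)
qed

lemma pass_spec:
  assumes i: "inv L (pending es (set L)) \<sigma>" and t: "topo es L" and r: "ireg \<sigma> 19 = i"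
  shows "runs (52 * m + 10) pass_prog \<sigma> (\<lambda>\<sigma>'. inv (pass es L) (pending es (set (pass es L))) \<sigma>' \<and> ireg \<sigma>'
      19 = Suc i)"
proof -
  define V where "V e = foldl (visit es) L [0..<e]" for e
  define I where "I k \<sigma> \<longleftrightarrow> k \<le> m \<and> inv (V (m - k)) (pending es (set (V (m - k)))) \<sigma> \<and> ireg \<sigma> 20 = m - k \<and>
      ireg \<sigma> 19 = i" for k \<sigma>
  have V: "topo es (V e)" if "e \<le> m" for e
    unfolding V_def using that t m by (intro topo_foldl) auto
  have pass: "V m = pass es L" by (simp add: V_def pass_def m)
  have "I m (fold det_exec [IConst 20 0] \<sigma>)" using i r by (auto simp: I_def V_def inv_def)
  then have "runs (m * (50 + 2) + 1) (While (ILess 20 1) visit_prog) (fold det_exec [IConst 20 0] \<sigma>) (I 0)"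
  proof (rule runs_While[rotated 2])
    fix k \<sigma> assume I: "I (Suc k) \<sigma>"
    define e where "e = m - Suc k"
    have e: "e < m" "m - k = Suc e" "k \<le> m" and i: "inv (V e) (pending es (set (V e))) \<sigma>" and r: "ireg \<sigma>
        20 = e" "ireg \<sigma> 19 = i"
      using I by (auto simp: I_def e_def)
    have "runs 50 visit_prog \<sigma> (\<lambda>\<sigma>'. inv (visit es (V e) e) (pending es (set (visit es (V e) e))) \<sigma>' \<and>
        ireg \<sigma>' 20 = Suc e \<and> ireg \<sigma>' 19 = i)"
      using V[of e] e r by (intro visit_spec[OF i]) auto
    then have "runs 50 visit_prog \<sigma> (I k)"
      by (rule refines_mono) (use e in \<open>auto simp: I_def V_def\<close>)
    then show "holds (ILess 20 1) \<sigma> \<and> runs 50 visit_prog \<sigma> (I k)" using e r inv_regs[OF i] by simp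
  next
    show "\<not> holds (ILess 20 1) \<sigma>" if "I 0 \<sigma>" for \<sigma> using that inv_regs(2) by (auto simp: I_def)
  qed
  then have "runs (m * (50 + 2) + 1 + Suc 2) (Seq (While (ILess 20 1) visit_prog) (block [IAdd 19 19 4]))
      (fold det_exec [IConst 20 0] \<sigma>)
    (\<lambda>\<sigma>'. inv (pass es L) (pending es (set (pass es L))) \<sigma>' \<and> ireg \<sigma>' 19 = Suc i)"
  proof (rule runs_Seq)
    fix \<sigma>' assume I: "I 0 \<sigma>'"
    then have "ireg \<sigma>' 4 = 1" using inv_regs(3) by (auto simp: I_def)
    with I show "runs 2 (block [IAdd 19 19 4]) \<sigma>' (\<lambda>\<sigma>'. inv (pass es L) (pending es (set (pass es L))) \<sigma>'
        \<and> ireg \<sigma>' 19 = Suc i)"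
      by (intro refines_block) (auto simp: I_def inv_def pass)
  qed
  then have "runs (2 * length [IConst 20 0] + Suc (m * (50 + 2) + 1 + Suc 2)) pass_prog \<sigma>
    (\<lambda>\<sigma>'. inv (pass es L) (pending es (set (pass es L))) \<sigma>' \<and> ireg \<sigma>' 19 = Suc i)"
    unfolding pass_prog_def by (intro refines_block_Seq) auto
  then show ?thesis by (rule refines_mono) auto
qed

lemma sort_spec:
  assumes "inv [] (\<lambda>_. 0) \<sigma>" "ireg \<sigma> 20 = 0" "ireg \<sigma> 19 = 0"
  defines "L \<equiv> (pass es ^^ m) []"
  shows "runs (52 * m * m + 30 * m + 3) sort_prog \<sigma> (inv L (pending es (set L)))"
proof -
  define V where "V i = (pass es ^^ i) []" for i
  define I where "I k \<sigma> \<longleftrightarrow> k \<le> m \<and> inv (V (m - k)) (pending es (set (V (m - k)))) \<sigma> \<and> ireg \<sigma> 19 = m - k"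
      for k \<sigma>
  have V: "topo es (V i)" for i unfolding V_def by (induction i) (auto simp: topo_Nil topo_pass)
  have loop: "runs (m * (52 * m + 10 + 2) + 1) (While (ILess 19 1) pass_prog) \<sigma> (I 0)" if "I m \<sigma>" for \<sigma>
    using that
  proof (rule runs_While[rotated 2])
    fix k \<sigma> assume I: "I (Suc k) \<sigma>"
    define e where "e = m - Suc k"
    have e: "e < m" "m - k = Suc e" "k \<le> m" and i: "inv (V e) (pending es (set (V e))) \<sigma>" and r: "ireg \<sigma>
        19 = e"
      using I by (auto simp: I_def e_def)
    have "runs (52 * m + 10) pass_prog \<sigma> (I k)"
      by (rule refines_mono[OF pass_spec[OF i V r]]) (use e in \<open>auto simp: I_def V_def\<close>)
    then show "holds (ILess 19 1) \<sigma> \<and> runs (52 * m + 10) pass_prog \<sigma> (I k)" using e r inv_regs[OF i] by simp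
  next
    show "\<not> holds (ILess 19 1) \<sigma>" if "I 0 \<sigma>" for \<sigma> using that inv_regs(2) by (auto simp: I_def)
  qed
  have "runs (m * 18 + 1 + Suc (m * (52 * m + 10 + 2) + 1)) sort_prog \<sigma> (I 0)"
    unfolding sort_prog_def
    by (rule runs_Seq[OF count_loop_spec[OF assms(1-3)] loop]) (simp add: I_def V_def)
  then show ?thesis by (rule refines_mono) (auto simp: I_def V_def L_def algebra_simps)
qed

end

section \<open>The phases of the program\<close>

definition phase_enter_code :: "instr list" where
  "phase_enter_code = [IAdd 20 6 17, ILoad 23 20, IAdd 20 23 23, ILoad 25 20, IAdd 20 20 4, ILoad 15 20,
     RLoad 10 23, RSub 10 1 10, IAdd 20 7 25, RLoad 11 20, RMul 11 10 11, IAdd 42 7 15, RLoad 12 42, RAdd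
         13 12 11,
     RDiv 14 12 13, RDiv 15 11 13, IAdd 20 1 17, RStore 20 14, IAdd 20 6 17, RStore 20 15,
     IAdd 14 17 4, IAdd 13 16 5, IConst 12 0, IAdd 11 9 5, RAdd 4 3 2]"

definition estimate_code :: "instr list" where
  "estimate_code = [ROfNat 14 12, ROfNat 15 16, RDiv 14 14 15, RMul 14 13 14]"

definition phase_exit_code :: "instr list" where
  "phase_exit_code = [RDiv 15 12 14, IAdd 20 1 17, RStore 20 15, RDiv 15 11 14, IAdd 20 6 17, RStore 20 15,
     RStore 42 14, IAdd 17 17 4]"

text \<open>The two conditionals form the maximum of \<open>revised_wt\<close>. Register 2 holds 0,
  so adding it is a move between registers.\<close>

definition revise_prog :: prog where
  "revise_prog = Seq (block estimate_code) (Seq (Cond (RLess 14 12) (block [RAdd 14 12 2]) Skip)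
     (Seq (Cond (RLess 14 11) (block [RAdd 14 11 2]) Skip) (block phase_exit_code)))"

definition phase_prog :: prog where
  "phase_prog = Seq (block phase_enter_code)
     (Seq micro_loop revise_prog)"

locale phases =
  fixes es :: "(nat \<times> nat) list" and n m s t N F :: nat and L :: "nat list" and q :: "nat \<Rightarrow> real" and C ::
      "nat \<Rightarrow> nat"
  assumes m: "m = length es" and arcs: "\<And>e. e < m \<Longrightarrow> fst (es ! e) < n \<and> snd (es ! e) < n"
    and L: "length L = m" "set L = {..<m}"
begin

definition sorted_arcs :: "arc list" where
  "sorted_arcs = map (\<lambda>e. (fst (es ! e), snd (es ! e), 1 - q e)) L"

definition base :: nat where
  "base = 4 * m + n"

definition inv :: "(nat \<Rightarrow> real) \<times> stage list \<Rightarrow> state \<Rightarrow> bool" where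
  "inv x \<sigma> \<longleftrightarrow>
     ireg \<sigma> 0 = n \<and> ireg \<sigma> 1 = m \<and> ireg \<sigma> 3 = t \<and> ireg \<sigma> 4 = 1 \<and> ireg \<sigma> 5 = 0 \<and> ireg \<sigma> 6 = 2 * m \<and> ireg \<sigma>
         7 = 3 * m \<and>
     ireg \<sigma> 9 = base \<and> ireg \<sigma> 10 = n + 2 \<and> ireg \<sigma> 16 = N \<and> ireg \<sigma> 17 = length (snd x) \<and>
     rreg \<sigma> 1 = 1 \<and> rreg \<sigma> 2 = 0 \<and> rreg \<sigma> 3 = real F \<and>
     (\<forall>a<base. imem \<sigma> a = layout es n L C a) \<and> imem \<sigma> base = 0 \<and> imem \<sigma> (base + 1) = s \<and>
     (\<forall>y<n. imem \<sigma> (base + 2 + y) = of_bool (y = s)) \<and>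
     (\<forall>e<m. rmem \<sigma> e = q e) \<and> (\<forall>y<n. rmem \<sigma> (3 * m + y) = fst x y) \<and>
     (\<forall>j<length (snd x). rmem \<sigma> (m + j) = keep (snd x ! j) \<and> rmem \<sigma> (2 * m + j) = spawn (snd x ! j) \<and>
        stage_arc (snd x ! j) = sorted_arcs ! j)"

lemma inv_regs:
  assumes "inv x \<sigma>"
  shows "ireg \<sigma> 0 = n" "ireg \<sigma> (Suc 0) = m" "ireg \<sigma> 3 = t" "ireg \<sigma> 4 = Suc 0" "ireg \<sigma> 5 = 0" "ireg \<sigma> 6 = 2
      * m"
    "ireg \<sigma> 7 = 3 * m" "ireg \<sigma> 9 = base" "ireg \<sigma> 10 = n + 2" "ireg \<sigma> 16 = N" "ireg \<sigma> 17 = length (snd x)"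
    "rreg \<sigma> (Suc 0) = 1" "rreg \<sigma> 2 = 0" "rreg \<sigma> 3 = real F"
  using assms unfolding inv_def by simp_all

lemma inv_mem:
  assumes "inv x \<sigma>"
  shows "\<And>a. a < base \<Longrightarrow> imem \<sigma> a = layout es n L C a" "imem \<sigma> base = 0" "imem \<sigma> (base + 1) = s"
    "\<And>y. y < n \<Longrightarrow> imem \<sigma> (base + 2 + y) = of_bool (y = s)"
    "\<And>e. e < m \<Longrightarrow> rmem \<sigma> e = q e" "\<And>y. y < n \<Longrightarrow> rmem \<sigma> (3 * m + y) = fst x y"
    "\<And>j. j < length (snd x) \<Longrightarrow> rmem \<sigma> (m + j) = keep (snd x ! j) \<and> rmem \<sigma> (2 * m + j) = spawn (snd x ! j) \<and>
        stage_arc (snd x ! j) = sorted_arcs ! j"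
  using assms unfolding inv_def by simp_all

lemma inv_cong:
  assumes "inv x \<sigma>" "ireg \<sigma>' = ireg \<sigma>" "rreg \<sigma>' 1 = rreg \<sigma> 1" "rreg \<sigma>' 2 = rreg \<sigma> 2" "rreg \<sigma>' 3 = rreg \<sigma> 3"
    "imem \<sigma>' = imem \<sigma>" "rmem \<sigma>' = rmem \<sigma>"
  shows "inv x \<sigma>'"
  using assms(1) unfolding inv_def assms(2-) .

lemma layout_order:
  assumes "j < m"
  shows "layout es n L C (2 * m + j) = L ! j" "layout es n L C (2 * (L ! j)) = fst (es ! (L ! j))"
    "layout es n L C (2 * (L ! j) + 1) = snd (es ! (L ! j))" "L ! j < m" "fst (es ! (L ! j)) < n" "snd (es
        ! (L ! j)) < n"
proof -
  have "L ! j \<in> set L" using assms L(1) by (intro nth_mem) simp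
  then show j: "L ! j < m" using L by simp
  then show "fst (es ! (L ! j)) < n" "snd (es ! (L ! j)) < n" using arcs by auto
  show "layout es n L C (2 * m + j) = L ! j" using assms L m by (simp add: layout_def)
  show "layout es n L C (2 * (L ! j)) = fst (es ! (L ! j))" "layout es n L C (2 * (L ! j) + 1) = snd (es !
      (L ! j))"
    using layout_arc[of "L ! j" es n L C] j m by (simp_all add: mult_2)
qed

text \<open>The state after the entry code is itself the reference state of \<open>sampler\<close>;
  there the stored stack is empty and all \<open>N\<close> roots are still in the counter.\<close>

lemma enter_spec:
  assumes i: "inv (K, xs) \<sigma>" and len: "length xs = i" "i < m" and e: "sorted_arcs ! i = (u, w, p)"
  defines "M \<equiv> K w + p * K u"
  shows "runs 50 (block phase_enter_code) \<sigma> (\<lambda>\<sigma>'. inv (K, xs) \<sigma>' \<and>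
    sampler \<sigma>' n m s w (Suc i) (xs @ [mk_stage (u, w, p) K M]) \<and>
    sampler.rel \<sigma>' n m s (Suc i) (xs @ [mk_stage (u, w, p) K M]) (real F)
      (replicate N (xs @ [mk_stage (u, w, p) K M], (s, {s})), 0) \<sigma>' \<and>
    ireg \<sigma>' 42 = 3 * m + w \<and> w < n \<and> rreg \<sigma>' 11 = p * K u \<and> rreg \<sigma>' 12 = K w \<and> rreg \<sigma>' 13 = M)"
proof -
  note ir = inv_regs[OF i] and im = inv_mem[OF i]
  define d where "d = L ! i"
  have d: "d < m" "u = fst (es ! d)" "w = snd (es ! d)" "p = 1 - q d" and uw: "u < n" "w < n"
    using layout_order[OF len(2)] e len L by (auto simp: d_def sorted_arcs_def)
  have mem: "imem \<sigma> (2 * m + i) = d" "imem \<sigma> (d + d) = u" "imem \<sigma> (Suc (d + d)) = w" "rmem \<sigma> d = q d"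
    using im(1)[of "2 * m + i"] im(1)[of "2 * d"] im(1)[of "2 * d + 1"] im(5)[of d] layout_order[OF
        len(2)] len d
    by (simp_all add: base_def d_def mult_2)
  have Kuw: "rmem \<sigma> (3 * m + u) = K u" "rmem \<sigma> (3 * m + w) = K w"
    using im(6)[OF uw(1)] im(6)[OF uw(2)] by simp_all
  define f where "f = (ireg \<sigma>)(20 := 2 * m + i, 23 := d, 25 := u, 15 := w, 42 := 3 * m + w, 14 := Suc i,
      13 := N, 12 := 0, 11 := base)"
  define g where "g = (rreg \<sigma>)(10 := p, 11 := p * K u, 12 := K w, 13 := M, 14 := K w / M, 15 := p * K u /
      M, 4 := real F)"
  define R where "R = (rmem \<sigma>)(m + i := K w / M, 2 * m + i := p * K u / M)"
  define \<sigma>' where "\<sigma>' = fold det_exec phase_enter_code \<sigma>"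
  have i17: "ireg \<sigma> 17 = i" using ir len by simp
  have eqs: "ireg \<sigma>' = f" "rreg \<sigma>' = g" "imem \<sigma>' = imem \<sigma>" "rmem \<sigma>' = R"
    unfolding \<sigma>'_def
    by (auto simp: phase_enter_code_def f_def g_def R_def ir(1-10) ir(12-) i17 mem Kuw M_def d(4)
        fun_eq_iff)
  have inv': "inv (K, xs) \<sigma>'"
    using i len d(1) unfolding inv_def eqs by (auto simp: f_def g_def R_def)
  let ?ys = "xs @ [mk_stage (u, w, p) K M]"
  have stages: "\<exists>e u w \<kappa>. e < m \<and> u < n \<and> w < n \<and> imem \<sigma>' (2 * m + j) = e \<and>
      imem \<sigma>' (2 * e) = u \<and> imem \<sigma>' (2 * e + 1) = w \<and>
      ?ys ! j = Stage (u, w, 1 - rmem \<sigma>' e) (rmem \<sigma>' (m + j)) (rmem \<sigma>' (2 * m + j)) \<kappa>" if j: "j < Suc i"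
          for j
  proof -
    have jm: "j < m" using j len by simp
    note lo = layout_order[OF jm]
    have mem': "imem \<sigma>' (2 * m + j) = L ! j" "imem \<sigma>' (2 * (L ! j)) = fst (es ! (L ! j))"
      "imem \<sigma>' (2 * (L ! j) + 1) = snd (es ! (L ! j))" "rmem \<sigma>' (L ! j) = q (L ! j)"
      using inv_mem(1)[OF inv', of "2 * m + j"] inv_mem(1)[OF inv', of "2 * (L ! j)"]
        inv_mem(1)[OF inv', of "2 * (L ! j) + 1"] inv_mem(5)[OF inv', of "L ! j"] lo jm by (simp_all add:
            base_def)
    have arc: "stage_arc (?ys ! j) = (fst (es ! (L ! j)), snd (es ! (L ! j)), 1 - q (L ! j))"
    proof (cases "j = i")
      case True
      then show ?thesis using len d by (simp add: nth_append mk_stage_def d_def)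
    next
      case False
      then show ?thesis using inv_mem(7)[OF inv', of j] j len jm L by (simp add: nth_append sorted_arcs_def)
    qed
    have ks: "rmem \<sigma>' (m + j) = keep (?ys ! j)" "rmem \<sigma>' (2 * m + j) = spawn (?ys ! j)"
    proof -
      show "rmem \<sigma>' (m + j) = keep (?ys ! j)"
        using inv_mem(7)[OF inv', of j] j len by (cases "j = i") (auto simp: nth_append mk_stage_def eqs
            R_def)
      show "rmem \<sigma>' (2 * m + j) = spawn (?ys ! j)"
        using inv_mem(7)[OF inv', of j] j len by (cases "j = i") (auto simp: nth_append mk_stage_def eqs
            R_def)
    qed
    have "?ys ! j = Stage (stage_arc (?ys ! j)) (keep (?ys ! j)) (spawn (?ys ! j)) (wt (?ys ! j))" by simp
    then have "?ys ! j = Stage (fst (es ! (L ! j)), snd (es ! (L ! j)), 1 - rmem \<sigma>' (L ! j)) (rmem \<sigma>' (m +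
        j)) (rmem \<sigma>' (2 * m + j)) (wt (?ys ! j))"
      unfolding arc ks mem' .
    then show ?thesis using lo mem' by blast
  qed
  have sam: "sampler \<sigma>' n m s w (Suc i) ?ys"
  proof
    show "\<exists>e u w \<kappa>. e < m \<and> u < n \<and> w < n \<and> imem \<sigma>' (2 * m + j) = e \<and>
      imem \<sigma>' (2 * e) = u \<and> imem \<sigma>' (2 * e + 1) = w \<and>
      ?ys ! j = Stage (u, w, 1 - rmem \<sigma>' e) (rmem \<sigma>' (m + j)) (rmem \<sigma>' (2 * m + j)) \<kappa>" if "j < Suc i" for j
      using that by (rule stages)
    show "imem \<sigma>' (4 * m + n + 2 + y) = of_bool (y = s)" if "y < n" for y
      using inv_mem(4)[OF inv' that] by (simp add: base_def)
  qed (use inv_regs[OF inv'] inv_mem(2-3)[OF inv'] len in \<open>simp_all add: base_def eqs f_def\<close>)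
  interpret S: sampler \<sigma>' n m s w "Suc i" ?ys "real F" by (rule sam)
  have "S.rel (replicate N (?ys, (s, {s})), 0) \<sigma>'"
    unfolding S.rel_def S.frame_def
    by (intro exI[of _ "[]"] exI[of _ N]) (simp add: S.addr_def eqs f_def g_def base_def)
  then show ?thesis using inv' sam uw
    by (intro refines_block) (simp_all add: \<sigma>'_def[symmetric] eqs f_def g_def, simp_all add:
        phase_enter_code_def)
qed

lemma revise_spec:
  assumes i: "inv (K, xs) \<sigma>" and len: "length xs = i" "i < m" and e: "sorted_arcs ! i = (u, w, p)" and w:
      "w < n"
    and r: "ireg \<sigma> 42 = 3 * m + w" "rreg \<sigma> 11 = p * K u" "rreg \<sigma> 12 = K w" "rreg \<sigma> 13 = K w + p * K u"
        "ireg \<sigma> 12 = c"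
  defines "\<kappa> \<equiv> revised_wt (u, w, p) K (real c / real N)"
  shows "runs 50 revise_prog \<sigma> (inv (K(w := \<kappa>), xs @ [mk_stage (u, w, p) K \<kappa>]))"
proof -
  note ir = inv_regs[OF i] and im = inv_mem[OF i]
  let ?v0 = "(K w + p * K u) * (real c / real N)"
  let ?S = "\<lambda>\<sigma>' v. inv (K, xs) \<sigma>' \<and> ireg \<sigma>' 42 = 3 * m + w \<and> rreg \<sigma>' 11 = p * K u \<and> rreg \<sigma>' 12 = K w \<and>
      rreg \<sigma>' 14 = v"
  have 1: "runs 8 (block estimate_code) \<sigma> (\<lambda>\<sigma>'. ?S \<sigma>' ?v0)"
    using r ir by (intro refines_block) (simp_all add: estimate_code_def inv_cong[OF i])
  have 2: "runs (Suc 2) (Cond (RLess 14 12) (block [RAdd 14 12 2]) Skip) \<sigma>' (\<lambda>\<sigma>'. ?S \<sigma>' (max ?v0 (K w)))"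
      if S: "?S \<sigma>' ?v0" for \<sigma>'
  proof -
    have i': "inv (K, xs) \<sigma>'" using S by blast
    show ?thesis
      by (intro refines_Cond refines_block refines_Skip)
        (use S inv_regs(13)[OF i'] in \<open>simp_all add: inv_cong[OF i'] del: times_divide_eq_right\<close>)
  qed
  have 3: "runs (Suc 2) (Cond (RLess 14 11) (block [RAdd 14 11 2]) Skip) \<sigma>' (\<lambda>\<sigma>'. ?S \<sigma>' \<kappa>)" if S: "?S \<sigma>'
      (max ?v0 (K w))" for \<sigma>'
  proof -
    have i': "inv (K, xs) \<sigma>'" using S by blast
    have \<kappa>: "\<kappa> = max (max ?v0 (K w)) (p * K u)" by (simp add: \<kappa>_def revised_wt_def)
    show ?thesis unfolding \<kappa>
      by (intro refines_Cond refines_block refines_Skip)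
        (use S inv_regs(13)[OF i'] in \<open>auto simp: inv_cong[OF i'] max_def simp del: times_divide_eq_right\<close>)
  qed
  have 4: "runs 16 (block phase_exit_code) \<sigma>1 (inv (K(w := \<kappa>), xs @ [mk_stage (u, w, p) K \<kappa>]))" if S: "?S
      \<sigma>1 \<kappa>" for \<sigma>1
  proof -
    have i1: "inv (K, xs) \<sigma>1" using S by simp
    note ir = inv_regs[OF i1] and im = inv_mem[OF i1]
    define \<sigma>' where "\<sigma>' = fold det_exec phase_exit_code \<sigma>1"
    have i17: "ireg \<sigma>1 17 = i" using ir len by simp
    define f where "f = (ireg \<sigma>1)(20 := 2 * m + i, 17 := Suc i)"
    define R where "R = (rmem \<sigma>1)(m + i := K w / \<kappa>, 2 * m + i := p * K u / \<kappa>, 3 * m + w := \<kappa>)"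
    have eqs: "ireg \<sigma>' = f" "rreg \<sigma>' = (rreg \<sigma>1)(15 := p * K u / \<kappa>)" "imem \<sigma>' = imem \<sigma>1" "rmem \<sigma>' = R"
      unfolding \<sigma>'_def using S
      by (auto simp: phase_exit_code_def f_def R_def ir(1-10) ir(12-) i17 fun_eq_iff)
    have Rj: "R (m + j) = keep ((xs @ [mk_stage (u, w, p) K \<kappa>]) ! j)" "R (2 * m + j) = spawn ((xs @
        [mk_stage (u, w, p) K \<kappa>]) ! j)"
      "stage_arc ((xs @ [mk_stage (u, w, p) K \<kappa>]) ! j) = sorted_arcs ! j" if "j < Suc i" for j
      using that im(7)[of j] len e by (cases "j = i"; simp add: R_def nth_append mk_stage_def)+
    have RK: "R (3 * m + y) = (K(w := \<kappa>)) y" if "y < n" for y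
      using that im(6)[of y] len by (simp add: R_def)
    have Rq: "R a = q a" if "a < m" for a
      using that im(5)[of a] by (simp add: R_def)
    have "inv (K(w := \<kappa>), xs @ [mk_stage (u, w, p) K \<kappa>]) \<sigma>'"
      unfolding inv_def eqs using ir im(1-4) len Rj RK Rq by (simp add: f_def)
    then show ?thesis unfolding \<sigma>'_def by (intro refines_block) (simp_all add: phase_exit_code_def)
  qed
  have "runs (8 + Suc (Suc 2 + Suc (Suc 2 + Suc 16))) revise_prog \<sigma> (inv (K(w := \<kappa>), xs @ [mk_stage (u, w,
      p) K \<kappa>]))"
    unfolding revise_prog_def
    by (rule runs_Seq[OF 1], rule runs_Seq[OF 2], assumption, rule runs_Seq[OF 3], assumption, rule 4)
  then show ?thesis by (rule refines_mono) auto
qed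

lemma phase_spec:
  assumes i: "inv x \<sigma>" and len: "length (snd x) = i" "i < m"
  shows "refines (F * (24 * n + 210) + 110) phase_prog \<sigma> (sweep N F s sorted_arcs x)
    (\<lambda>y \<sigma>'. inv y \<sigma>' \<and> length (snd y) = Suc i)"
proof -
  obtain K xs where x: "x = (K, xs)" by (cases x)
  obtain u w p where e: "sorted_arcs ! i = (u, w, p)" by (cases "sorted_arcs ! i") auto
  have i': "inv (K, xs) \<sigma>" and len': "length xs = i" using i len x by auto
  let ?M = "K w + p * K u"
  let ?ys = "xs @ [mk_stage (u, w, p) K ?M]"
  let ?\<kappa> = "\<lambda>z. revised_wt (u, w, p) K (real (snd z) / real N)"
  let ?out = "\<lambda>z. (K(w := ?\<kappa> z), xs @ [mk_stage (u, w, p) K (?\<kappa> z)])"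
  let ?x0 = "(replicate N (?ys, (s, {s})), 0)"
  have sw: "sweep N F s sorted_arcs x = iterate_pmf F (micro w) ?x0 \<bind> (\<lambda>z. return_pmf (?out z))"
    by (simp add: sweep_def x len' e Let_def map_pmf_def)
  have body: "refines (F * (24 * n + 210) + 1 + Suc 50) (Seq micro_loop revise_prog) \<sigma>1
      (iterate_pmf F (micro w) ?x0 \<bind> (\<lambda>z. return_pmf (?out z))) (\<lambda>y \<sigma>'. inv y \<sigma>' \<and> length (snd y) = Suc i)"
    if "inv (K, xs) \<sigma>1 \<and> sampler \<sigma>1 n m s w (Suc i) ?ys \<and>
    sampler.rel \<sigma>1 n m s (Suc i) ?ys (real F) ?x0 \<sigma>1 \<and>
    ireg \<sigma>1 42 = 3 * m + w \<and> w < n \<and> rreg \<sigma>1 11 = p * K u \<and> rreg \<sigma>1 12 = K w \<and> rreg \<sigma>1 13 = ?M" for \<sigma>1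
  proof -
    from that have i1: "inv (K, xs) \<sigma>1" and sam: "sampler \<sigma>1 n m s w (Suc i) ?ys"
      and rel: "sampler.rel \<sigma>1 n m s (Suc i) ?ys (real F) ?x0 \<sigma>1"
      and r: "ireg \<sigma>1 42 = 3 * m + w" "w < n" "rreg \<sigma>1 11 = p * K u" "rreg \<sigma>1 12 = K w" "rreg \<sigma>1 13 = ?M"
          by auto
    interpret S: sampler \<sigma>1 n m s w "Suc i" ?ys 0 by (rule sam)
    have zero: "rreg \<sigma>1 2 = 0" using inv_regs[OF i1] by simp
    have rev: "refines 50 revise_prog \<sigma>2 (return_pmf (?out z)) (\<lambda>y \<sigma>'. inv y \<sigma>' \<and> length (snd y) = Suc i)"
      if R: "S.rel z \<sigma>2" for z \<sigma>2
    proof -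
      have fr: "S.frame \<sigma>2" and c: "ireg \<sigma>2 12 = snd z" using R by (auto simp: S.rel_def)
      \<comment> \<open>\<open>frame\<close> protects every cell below slot 1, which covers the
        arcs, the sorting data and the template.\<close>
      have lt: "S.addr 1 = base + (n + 2)" by (simp add: S.addr_def base_def)
      have "inv (K, xs) \<sigma>2"
        using i1 fr unfolding inv_def S.frame_def lt by auto
      moreover have "ireg \<sigma>2 42 = 3 * m + w" "rreg \<sigma>2 11 = p * K u" "rreg \<sigma>2 12 = K w" "rreg \<sigma>2 13 = ?M"
        using r fr unfolding S.frame_def by auto
      ultimately have "runs 50 revise_prog \<sigma>2 (inv (?out z))"
        using revise_spec[OF _ len' len(2) e r(2), where \<sigma> = \<sigma>2 and c = "snd z"] c by simp
      then show ?thesis using len' unfolding refines_def rel_pmf_return_pmf1 by auto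
    qed
    show ?thesis by (rule refines_Seq[OF micro_loop_spec[OF sam zero rel] rev])
  qed
  show ?thesis unfolding sw phase_prog_def
    by (rule refines_mono[OF runs_Seq[OF enter_spec[OF i' len' len(2) e] body]]) auto
qed

lemma phase_loop_spec:
  assumes "inv (K, []) \<sigma>"
  shows "refines (m * (F * (24 * n + 210) + 112) + 1) (While (ILess 17 1) phase_prog) \<sigma>
    (iterate_pmf m (sweep N F s sorted_arcs) (K, [])) inv"
proof -
  have "refines (m * (F * (24 * n + 210) + 110 + 2) + 1) (While (ILess 17 1) phase_prog) \<sigma>
    (iterate_pmf m (sweep N F s sorted_arcs) (K, [])) (\<lambda>x \<sigma>'. inv x \<sigma>' \<and> length (snd x) + 0 = m)"
  proof (rule refines_While[where I = "\<lambda>k x \<sigma>'. inv x \<sigma>' \<and> length (snd x) + k = m"])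
    fix k x \<sigma> assume I: "inv x \<sigma> \<and> length (snd x) + Suc k = m"
    then have "refines (F * (24 * n + 210) + 110) phase_prog \<sigma> (sweep N F s sorted_arcs x)
      (\<lambda>y \<sigma>'. inv y \<sigma>' \<and> length (snd y) = Suc (length (snd x)))" by (intro phase_spec) auto
    then have "refines (F * (24 * n + 210) + 110) phase_prog \<sigma> (sweep N F s sorted_arcs x) (\<lambda>x \<sigma>'. inv x
        \<sigma>' \<and> length (snd x) + k = m)"
      by (rule refines_mono) (use I in auto)
    then show "holds (ILess 17 1) \<sigma> \<and> refines (F * (24 * n + 210) + 110) phase_prog \<sigma> (sweep N F s
        sorted_arcs x) (\<lambda>x \<sigma>'. inv x \<sigma>' \<and> length (snd x) + k = m)"
      using I inv_regs[of x \<sigma>] by simp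
  next
    fix x \<sigma> assume "inv x \<sigma> \<and> length (snd x) + 0 = m"
    then show "\<not> holds (ILess 17 1) \<sigma>" using inv_regs[of x \<sigma>] by simp
  qed (use assms in simp)
  then show ?thesis by (rule refines_mono) auto
qed

end

section \<open>The main program\<close>

definition init_code :: "instr list" where
  "init_code = [IConst 4 1, IAdd 6 1 1, IAdd 7 6 1, IAdd 8 7 0, IAdd 9 8 1, IAdd 10 0 4, IAdd 10 10 4]"

definition size_code :: "instr list" where
  "size_code = [ROfNat 6 1, RMul 6 6 6, RMul 7 0 0, RDiv 6 6 7, IConst 20 64, ROfNat 7 20, RMul 6 7 6,
      ROfNat 7 16]"

definition root_code :: "instr list" where
  "root_code = [IConst 20 48, ROfNat 8 20, ROfNat 9 1, RMul 8 8 9, RMul 8 8 9, RMul 8 8 9, RMul 8 8 7,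
      RAdd 3 8 2,
     IAdd 20 7 2, RStore 20 1, IAdd 20 9 4, IStore 20 2, IAdd 20 20 4, IAdd 20 20 2, IStore 20 4]"

text \<open>Since reals cannot be rounded, the ceiling \<open>N\<close> is found by counting up
  until its conversion is large enough. These \<open>O(N)\<close> steps are dominated by the
  sampling. The number \<open>1 / 2\<close> has to be computed, as programs contain no real
  constants.\<close>

definition prepare_prog :: prog where
  "prepare_prog = Seq (block [ROfNat 1 4, RAdd 5 1 1, RDiv 5 1 5]) (Seq (Cond (RLess 5 0) (block [RAdd 0 5
      2]) Skip)
     (Seq (block size_code) (Seq (While (RLess 7 6) (block [IAdd 16 16 4, ROfNat 7 16])) (block
         root_code))))"

definition reliability_prog :: prog where
  "reliability_prog = Seq (block init_code) (Seq sort_prog (Seq prepare_prog (Seq (While (ILess 17 1)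
      phase_prog)
     (block [IAdd 20 7 3, RLoad 0 20]))))"

context phases
begin

lemma prepare_spec:
  assumes regs: "ireg \<sigma> 0 = n" "ireg \<sigma> 1 = m" "ireg \<sigma> 2 = s" "ireg \<sigma> 3 = t" "ireg \<sigma> 4 = 1" "ireg \<sigma> 5 = 0"
      "ireg \<sigma> 6 = 2 * m"
    "ireg \<sigma> 7 = 3 * m" "ireg \<sigma> 9 = base" "ireg \<sigma> 10 = n + 2" "ireg \<sigma> 16 = 0" "ireg \<sigma> 17 = 0"
    "rreg \<sigma> 0 = \<epsilon>" "rreg \<sigma> 2 = 0"
    and im: "imem \<sigma> = layout es n L C" and rm: "rmem \<sigma> = (\<lambda>a. if a < m then q a else 0)" and s: "s < n"
    and \<delta>: "\<delta> = min \<epsilon> (1 / 2)" and N: "N = nat \<lceil>64 * (real m * real m / (\<delta> * \<delta>))\<rceil>" and F: "F = 48 * m ^ 3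
        * N"
  shows "runs (6 * N + 70) prepare_prog \<sigma> (inv (start_wt s, []))"
proof -
  let ?X = "64 * (real m * real m / (\<delta> * \<delta>))"
  define P where "P \<sigma>' \<longleftrightarrow> (\<forall>r. r \<notin> {16, 20} \<longrightarrow> ireg \<sigma>' r = ireg \<sigma> r) \<and> imem \<sigma>' = imem \<sigma> \<and> rmem \<sigma>' = rmem \<sigma> \<and>
    rreg \<sigma>' 1 = 1 \<and> rreg \<sigma>' 2 = 0" for \<sigma>' :: state
  have P: "ireg \<sigma>' 0 = n" "ireg \<sigma>' (Suc 0) = m" "ireg \<sigma>' 2 = s" "ireg \<sigma>' 3 = t" "ireg \<sigma>' 4 = 1" "ireg \<sigma>' 5
      = 0"
    "ireg \<sigma>' 6 = 2 * m" "ireg \<sigma>' 7 = 3 * m" "ireg \<sigma>' 9 = base" "ireg \<sigma>' 10 = n + 2" "ireg \<sigma>' 17 = 0"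
    "rreg \<sigma>' (Suc 0) = 1" "rreg \<sigma>' 2 = 0" "imem \<sigma>' = layout es n L C" "rmem \<sigma>' = (\<lambda>a. if a < m then q a
        else 0)"
    if "P \<sigma>'" for \<sigma>'
    using that regs im rm unfolding P_def by auto
  have 1: "runs 6 (block [ROfNat 1 4, RAdd 5 1 1, RDiv 5 1 5]) \<sigma> (\<lambda>\<sigma>'. P \<sigma>' \<and> rreg \<sigma>' 0 = \<epsilon> \<and> rreg \<sigma>' 5 =
      1 / 2 \<and> ireg \<sigma>' 16 = 0)"
    using regs by (intro refines_block) (simp_all add: P_def)
  have cong: "P \<sigma>2" if "P \<sigma>1" "\<And>r. r \<notin> {16, 20} \<Longrightarrow> ireg \<sigma>2 r = ireg \<sigma>1 r" "imem \<sigma>2 = imem \<sigma>1" "rmem \<sigma>2 =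
      rmem \<sigma>1"
    "rreg \<sigma>2 1 = rreg \<sigma>1 1" "rreg \<sigma>2 2 = rreg \<sigma>1 2" for \<sigma>1 \<sigma>2
    using that unfolding P_def by simp
  have 2: "runs (Suc 2) (Cond (RLess 5 0) (block [RAdd 0 5 2]) Skip) \<sigma>' (\<lambda>\<sigma>'. P \<sigma>' \<and> rreg \<sigma>' 0 = \<delta> \<and> ireg
      \<sigma>' 16 = 0)"
    if S: "P \<sigma>' \<and> rreg \<sigma>' 0 = \<epsilon> \<and> rreg \<sigma>' 5 = 1 / 2 \<and> ireg \<sigma>' 16 = 0" for \<sigma>'
  proof -
    have p: "P \<sigma>'" "rreg \<sigma>' 0 = \<epsilon>" "rreg \<sigma>' 5 = 1 / 2" "ireg \<sigma>' 16 = 0" using S by blast+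
    show ?thesis
      by (intro refines_Cond refines_block refines_Skip)
        (use p(2-4) P(13)[OF p(1)] in \<open>simp_all add: cong[OF p(1)] \<delta> p(1)\<close>)
  qed
  have 3: "runs 16 (block size_code) \<sigma>' (\<lambda>\<sigma>'. P \<sigma>' \<and> rreg \<sigma>' 6 = ?X \<and> rreg \<sigma>' 7 = 0 \<and> ireg \<sigma>' 16 = 0)"
    if S: "P \<sigma>' \<and> rreg \<sigma>' 0 = \<delta> \<and> ireg \<sigma>' 16 = 0" for \<sigma>'
  proof -
    have p: "P \<sigma>'" "rreg \<sigma>' 0 = \<delta>" "ireg \<sigma>' 16 = 0" using S by blast+
    show ?thesis
      by (intro refines_block) (use p(2-3) P(2)[OF p(1)] in \<open>auto simp: size_code_def intro!: cong[OF
          p(1)] split: if_splits\<close>)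
  qed
  define I where "I k \<sigma>' \<longleftrightarrow> P \<sigma>' \<and> k \<le> N \<and> rreg \<sigma>' 6 = ?X \<and> rreg \<sigma>' 7 = real (N - k) \<and> ireg \<sigma>' 16 = N - k"
      for k \<sigma>'
  have 4: "runs (N * (4 + 2) + 1) (While (RLess 7 6) (block [IAdd 16 16 4, ROfNat 7 16])) \<sigma>' (I 0)"
    if "P \<sigma>' \<and> rreg \<sigma>' 6 = ?X \<and> rreg \<sigma>' 7 = 0 \<and> ireg \<sigma>' 16 = 0" for \<sigma>'
  proof (rule runs_While)
    show "I N \<sigma>'" using that by (simp add: I_def)
    show "\<not> holds (RLess 7 6) \<sigma>1" if "I 0 \<sigma>1" for \<sigma>1
    proof -
      have "?X \<le> real N" unfolding N by (rule of_nat_ceiling)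
      then show ?thesis using that by (simp add: I_def)
    qed
    fix k \<sigma>1 assume J: "I (Suc k) \<sigma>1"
    define j where "j = N - Suc k"
    have j: "j < N" "N - k = Suc j" and r: "rreg \<sigma>1 7 = real j" "ireg \<sigma>1 16 = j" "rreg \<sigma>1 6 = ?X" "P \<sigma>1"
        "k \<le> N"
      using J by (auto simp: I_def j_def)
    have "real j < ?X" using j(1) unfolding N by linarith
    moreover have "runs 4 (block [IAdd 16 16 4, ROfNat 7 16]) \<sigma>1 (I k)"
      by (intro refines_block) (use r(1-3,5) P(5)[OF r(4)] j in \<open>auto simp: I_def intro!: cong[OF r(4)]
          split: if_splits\<close>)
    ultimately show "holds (RLess 7 6) \<sigma>1 \<and> runs 4 (block [IAdd 16 16 4, ROfNat 7 16]) \<sigma>1 (I k)"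
      using r by simp
  qed
  have 5: "runs 30 (block root_code) \<sigma>1 (inv (start_wt s, []))" if I: "I 0 \<sigma>1" for \<sigma>1
  proof -
    have r: "rreg \<sigma>1 7 = real N" "ireg \<sigma>1 16 = N" "P \<sigma>1" using I by (auto simp: I_def)
    note p = P[OF r(3)]
    define \<sigma>' where "\<sigma>' = fold det_exec root_code \<sigma>1"
    define M where "M = (layout es n L C)(base + 1 := s, base + 2 + s := 1)"
    define R where "R = (\<lambda>a. if a < m then q a else 0)(3 * m + s := 1)"
    have eqs: "imem \<sigma>' = M" "rmem \<sigma>' = R" "\<And>r. r \<noteq> 20 \<Longrightarrow> ireg \<sigma>' r = ireg \<sigma>1 r"
      "rreg \<sigma>' (Suc 0) = 1" "rreg \<sigma>' 2 = 0" "rreg \<sigma>' 3 = real F"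
      unfolding \<sigma>'_def by (simp_all add: root_code_def p r M_def R_def F power3_eq_cube)
    have "layout es n L C a = 0" if "base \<le> a" for a 
    proof -
      have "4 * m + n \<le> a" using that by (simp only: base_def)
      then show ?thesis unfolding layout_def m[symmetric] by (simp add: Let_def)
    qed
    then have M: "\<forall>a<base. M a = layout es n L C a" "M base = 0" "M (base + 1) = s" "\<forall>y<n. M (base + 2 +
        y) = of_bool (y = s)"
      by (auto simp: M_def)
    have R: "\<forall>e<m. R e = q e" "\<forall>y<n. R (3 * m + y) = start_wt s y" by (auto simp: R_def start_wt_def)
    have "inv (start_wt s, []) \<sigma>'"
      unfolding inv_def eqs(1,2) using M R p r by (simp add: eqs)
    then show ?thesis unfolding \<sigma>'_def by (intro refines_block) (simp_all add: root_code_def)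
  qed
  have "runs (6 + Suc (Suc 2 + Suc (16 + Suc (N * (4 + 2) + 1 + Suc 30)))) prepare_prog \<sigma> (inv (start_wt
      s, []))"
    unfolding prepare_prog_def
    by (rule runs_Seq[OF 1], rule runs_Seq[OF 2], assumption, rule runs_Seq[OF 3], assumption, rule
        runs_Seq[OF 4], assumption, rule 5)
  then show ?thesis by (rule refines_mono) auto
qed

end

lemma reliability_prog_spec:
  fixes es :: "(nat \<times> nat) list" and n s t :: nat and q :: "nat \<Rightarrow> real"
  defines "m \<equiv> length es" and "L \<equiv> (pass es ^^ length es) []"
  defines "chain \<equiv> map (\<lambda>e. (fst (es ! e), snd (es ! e), 1 - q e)) L"
  assumes ac: "acyclic (set es)" and bd: "\<And>e. e < m \<Longrightarrow> fst (es ! e) < n \<and> snd (es ! e) < n" and st: "s < n"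
      "t < n"
    and \<sigma>: "ireg \<sigma> = (\<lambda>_. 0)(0 := n, 1 := m, 2 := s, 3 := t)" "rreg \<sigma> = (\<lambda>_. 0)(0 := \<epsilon>)"
      "imem \<sigma> = layout es n [] (\<lambda>_. 0)" "rmem \<sigma> = (\<lambda>a. if a < m then q a else 0)"
    and \<delta>: "\<delta> = min \<epsilon> (1 / 2)" and N: "N = nat \<lceil>64 * (real m * real m / (\<delta> * \<delta>))\<rceil>" and F: "F = 48 * m ^ 3
        * N"
  shows "refines (52 * m * m + 150 * m + 6 * N + m * F * (24 * n + 210) + 130) reliability_prog \<sigma>
    (iterate_pmf m (sweep N F s chain) (start_wt s, [])) (\<lambda>x \<sigma>'. rreg \<sigma>' 0 = fst x t)"
proof -
  define C where "C = pending es (set L)"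
  have L: "length L = m" "set L = {..<m}" using passes_all[OF ac] by (simp_all add: L_def m_def)
  interpret phases es n m s t N F L q C
    by unfold_locales (use bd L in \<open>auto simp: m_def\<close>)
  define \<sigma>1 where "\<sigma>1 = fold det_exec init_code \<sigma>"
  have i1: "ireg \<sigma>1 = (\<lambda>_. 0)(0 := n, 1 := m, 2 := s, 3 := t, 4 := 1, 6 := 2 * m, 7 := 3 * m, 8 := 3 * m +
      n, 9 := base, 10 := n + 2)"
    "rreg \<sigma>1 = rreg \<sigma>" "imem \<sigma>1 = imem \<sigma>" "rmem \<sigma>1 = rmem \<sigma>"
    by (auto simp: \<sigma>1_def init_code_def \<sigma>(1) base_def fun_eq_iff)
  interpret so: sorting \<sigma>1 es n m
    by unfold_locales (use bd in \<open>auto simp: i1 m_def\<close>)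
  have "so.inv [] (\<lambda>_. 0) \<sigma>1" unfolding so.inv_def i1(3) \<sigma> by (simp add: i1)
  then have sort: "runs (52 * m * m + 30 * m + 3) sort_prog \<sigma>1 (so.inv L C)"
    using so.sort_spec[of \<sigma>1] by (simp add: i1 L_def C_def m_def)
  have prep: "runs (6 * N + 70) prepare_prog \<sigma>2 (inv (start_wt s, []))" if "so.inv L C \<sigma>2" for \<sigma>2
  proof (rule prepare_spec[OF _ _ _ _ _ _ _ _ _ _ _ _ _ _ _ _ st(1) \<delta> N F])
  qed (use that in \<open>simp_all add: so.inv_def i1 \<sigma>\<close>)
  have loop: "refines (m * (F * (24 * n + 210) + 112) + 1 + Suc 4) (Seq (While (ILess 17 1) phase_prog)
      (block [IAdd 20 7 3, RLoad 0 20])) \<sigma>3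
     (iterate_pmf m (sweep N F s sorted_arcs) (start_wt s, []) \<bind> return_pmf) (\<lambda>x \<sigma>'. rreg \<sigma>' 0 = fst x t)"
    if "inv (start_wt s, []) \<sigma>3" for \<sigma>3
  proof (rule refines_Seq[OF phase_loop_spec[OF that]])
    fix x \<sigma>4 assume i4: "inv x \<sigma>4"
    show "refines 4 (block [IAdd 20 7 3, RLoad 0 20]) \<sigma>4 (return_pmf x) (\<lambda>x \<sigma>'. rreg \<sigma>' 0 = fst x t)"
      using inv_regs[OF i4] inv_mem(6)[OF i4 st(2)] by (intro refines_block) simp_all
  qed
  have "refines (2 * length init_code + Suc (52 * m * m + 30 * m + 3 + Suc (6 * N + 70 + Suc (m * (F * (24
      * n + 210) + 112) + 1 + Suc 4))))
    reliability_prog \<sigma> (iterate_pmf m (sweep N F s sorted_arcs) (start_wt s, []) \<bind> return_pmf) (\<lambda>x \<sigma>'.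
        rreg \<sigma>' 0 = fst x t)"
    unfolding reliability_prog_def
    by (rule refines_block_Seq, simp add: init_code_def, fold \<sigma>1_def, rule runs_Seq[OF sort], rule
        runs_Seq[OF prep], assumption, rule loop)
  then show ?thesis
    unfolding bind_return_pmf' chain_def sorted_arcs_def[symmetric]
    by (rule refines_mono) (auto simp: init_code_def algebra_simps)
qed

text \<open>Apart from constants the dominant term is \<open>n m^6 / \<delta>^2\<close>. The factor
  \<open>m^2 / \<delta>^2\<close> is compared with the larger of \<open>m^4\<close> and
  \<open>1 / \<epsilon>^4\<close> according to which of \<open>m\<close> and
  \<open>1 / \<epsilon>\<close> is larger; for \<open>\<epsilon> > 1 / 2\<close>, where
  \<open>\<delta> = 1 / 2\<close>, this costs a factor 4. Finally
  \<open>n \<le> n^6\<close>.\<close>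

lemma time_estimate:
  fixes n m N F :: nat and \<epsilon> :: real
  assumes n: "1 \<le> n" and \<epsilon>: "0 < \<epsilon>" and \<delta>: "\<delta> = min \<epsilon> (1 / 2)"
    and N: "N = nat \<lceil>64 * (real m * real m / (\<delta> * \<delta>))\<rceil>" and F: "F = 48 * m ^ 3 * N"
  shows "real (52 * m * m + 150 * m + 6 * N + m * F * (24 * n + 210) + 130) \<le> time_bound 3000000 0 n m \<epsilon>"
proof (cases "m = 0")
  case True
  then show ?thesis by (simp add: N F time_bound_def)
next
  case False
  then have m: "1 \<le> real m" by simp
  have n1: "1 \<le> real n" using n by simp
  define X where "X = real m * real m / (\<delta> * \<delta>)"
  have \<delta>0: "0 < \<delta>" "\<delta> \<le> 1 / 2" using \<epsilon> \<delta> by auto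
  have "\<delta> * \<delta> \<le> 1 * 1" using \<delta>0 by (intro mult_mono) auto
  then have X1: "real m * real m \<le> X" using \<delta>0 unfolding X_def by (simp add: pos_le_divide_eq mult_left_le)
  moreover have "1 * 1 \<le> real m * real m" using m by (intro mult_mono) auto
  ultimately have X: "1 \<le> X" by simp
  define mx where "mx = max (real m ^ 4) (1 / \<epsilon> ^ 4)"
  have XM: "X \<le> 4 * mx"
  proof (cases "\<epsilon> \<le> 1 / 2")
    case True
    then have "X = real m ^ 2 * (1 / \<epsilon>) ^ 2" by (simp add: X_def \<delta> power2_eq_square)
    also have "\<dots> \<le> mx"
    proof (cases "real m \<le> 1 / \<epsilon>")
      case True
      then have "real m ^ 2 * (1 / \<epsilon>) ^ 2 \<le> (1 / \<epsilon>) ^ 2 * (1 / \<epsilon>) ^ 2" using \<epsilon> by (intro mult_right_mono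
          power_mono) auto
      also have "\<dots> = 1 / \<epsilon> ^ 4" by (simp add: power_divide flip: power_add)
      finally show ?thesis by (simp add: mx_def)
    next
      case False
      then have "real m ^ 2 * (1 / \<epsilon>) ^ 2 \<le> real m ^ 2 * real m ^ 2" using \<epsilon> by (intro mult_left_mono
          power_mono) auto
      also have "\<dots> = real m ^ 4" by (simp flip: power_add)
      finally show ?thesis by (simp add: mx_def)
    qed
    finally show ?thesis using X by simp
  next
    case False
    then have "X = 4 * real m ^ 2" by (simp add: X_def \<delta> power2_eq_square)
    also have "\<dots> \<le> 4 * real m ^ 4" using m by (intro mult_left_mono power_increasing) auto
    finally show ?thesis by (simp add: mx_def)
  qed
  have N65: "real N \<le> 65 * X"
  proof -
    have "real N \<le> 64 * X + 1" unfolding N X_def[symmetric] using X by linarith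
    then show ?thesis using X by simp
  qed
  define Y where "Y = real n * real m ^ 4 * X"
  have Y: "X \<le> Y" "real m * real m \<le> Y" "real m \<le> Y" "1 \<le> Y"
  proof -
    have "1 * 1 \<le> real n * real m ^ 4" using n1 m by (intro mult_mono) auto
    then have "1 * X \<le> Y" unfolding Y_def using X by (intro mult_right_mono) auto
    moreover have "real m * 1 \<le> real m * real m" using m by (intro mult_left_mono) auto
    ultimately show "X \<le> Y" "real m * real m \<le> Y" "real m \<le> Y" "1 \<le> Y" using X X1 by auto
  qed
  have "real (m * F * (24 * n + 210)) = 48 * real m ^ 4 * real N * (24 * real n + 210)"
    by (simp add: F power3_eq_cube power4_eq_xxxx)
  also have "\<dots> \<le> 48 * real m ^ 4 * (65 * X) * (234 * real n)"
    using N65 n1 X by (intro mult_mono) auto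
  also have "\<dots> = 730080 * Y" by (simp add: Y_def)
  finally have "real (m * F * (24 * n + 210)) \<le> 730080 * Y" .
  \<comment> \<open>The coefficients add up to \<open>730080 + 52 + 150 + 6 * 65 + 130\<close>,
    which is below 750000.\<close>
  then have "real (52 * m * m + 150 * m + 6 * N + m * F * (24 * n + 210) + 130) \<le> 750000 * Y"
    using Y N65 by simp
  also have "Y \<le> real n ^ 6 * real m ^ 4 * (4 * mx)"
    unfolding Y_def using n1 X XM by (intro mult_mono) (auto intro!: self_le_power)
  then have "750000 * Y \<le> 3000000 * (real n ^ 6 * real m ^ 4 * mx)" by (simp add: mult_ac)
  also have "\<dots> \<le> time_bound 3000000 0 n m \<epsilon>" by (simp add: time_bound_def mx_def)
  finally show ?thesis .
qed

lemma acyclic_image: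
  assumes "acyclic E" "inj_on f V" "E \<subseteq> V \<times> V"
  shows "acyclic (map_prod f f ` E)"
proof -
  let ?g = "inv_into V f"
  have "(?g x, ?g y) \<in> E\<^sup>+" if "(x, y) \<in> (map_prod f f ` E)\<^sup>+" for x y
    using that
  proof (induction rule: trancl_induct)
    case (base y)
    then show ?case using assms(2,3) by (auto simp: inv_into_f_f subset_iff)
  next
    case (step y z)
    then have "(?g y, ?g z) \<in> E" using assms(2,3) by (auto simp: inv_into_f_f subset_iff)
    then show ?case using step.IH by auto
  qed
  then show ?thesis using assms(1) unfolding acyclic_def by blast
qed

text \<open>The exponent of the logarithm can be chosen as 0. The time \<open>T\<close> depends only
  on \<open>n\<close>, \<open>m\<close> and \<open>\<epsilon>\<close>, because every phase executes
  its full step budget.\<close>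

theorem theorem1p1:
  shows "\<exists>(P :: prog) (C :: real) (k :: nat).
    \<forall>(G :: nat pair_pre_digraph) (q :: nat \<times> nat \<Rightarrow> real) (s :: nat) (t :: nat) (\<epsilon> :: real)
      (num :: nat \<Rightarrow> nat) (es :: (nat \<times> nat) list).
      dag G \<and> s \<in> pverts G \<and> t \<in> pverts G \<and>
      (\<forall>v \<in> pverts G - {s}. \<exists>u. (u, v) \<in> parcs G) \<and>
      (\<forall>e \<in> parcs G. 0 \<le> q e \<and> q e \<le> 1) \<and> \<epsilon> > 0 \<and>
      is_presentation G num es
      \<longrightarrow> (\<exists>T :: nat.
            real T \<le> time_bound C k (card (pverts G)) (card (parcs G)) \<epsilon> \<and>
            halts_within T P (input_state G num es q s t \<epsilon>) \<and>
            measure_pmf.prob (output_pmf T P (input_state G num es q s t \<epsilon>))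
              {r. approximates \<epsilon> (reliability G q s t) r} \<ge> 3 / 4)"
proof (rule exI[of _ reliability_prog], rule exI[of _ 3000000], rule exI[of _ 0], intro allI impI, elim
    conjE)
  fix G :: "nat pair_pre_digraph" and q :: "nat \<times> nat \<Rightarrow> real" and s t :: nat and \<epsilon> :: real and num :: "nat
      \<Rightarrow> nat"
    and es :: "(nat \<times> nat) list"
  assume dag: "dag G" and st: "s \<in> pverts G" "t \<in> pverts G" and q: "\<forall>e \<in> parcs G. 0 \<le> q e \<and> q e \<le> 1"
    and \<epsilon>: "\<epsilon> > 0" and pres: "is_presentation G num es"
  interpret pair_fin_digraph G using dag by (simp add: dag_def)
  define n where "n = card (pverts G)"
  define m where "m = length es"
  have es: "distinct es" "set es = parcs G" and bij: "bij_betw num (pverts G) {..<n}"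
    using pres by (auto simp: is_presentation_def n_def)
  have num: "num v < n" if "v \<in> pverts G" for v
    using bij that by (auto simp: bij_betw_def)
  have inj: "inj_on num (pverts G)" using bij by (simp add: bij_betw_def)
  have m: "card (parcs G) = m" using es distinct_card[of es] by (simp add: m_def)
  have n1: "1 \<le> n" using num[OF st(1)] by simp
  have V: "fst (es ! e) \<in> pverts G" "snd (es ! e) \<in> pverts G" if "e < m" for e
    using arc_fst_in_verts[of "es ! e"] arc_snd_in_verts[of "es ! e"] es(2) nth_mem[of e es] that by
        (simp_all add: m_def)
  define fs where "fs = map (map_prod num num) es"
  have len: "length fs = m" by (simp add: fs_def m_def)
  have fs: "fst (fs ! e) = num (fst (es ! e))" "snd (fs ! e) = num (snd (es ! e))" if "e < m" for e
    using that by (simp_all add: fs_def m_def)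
  have acG: "acyclic (parcs G)" using dag by (rule dag_acyclic)
  have ac: "acyclic (set fs)"
    unfolding fs_def using acyclic_image[OF acG inj] arc_fst_in_verts arc_snd_in_verts by (force simp:
        es(2))
  \<comment> \<open>The moment bounds need weights correct up to a factor of two, which is ensured
    by \<open>\<delta> \<le> 1 / 2\<close> even for large \<open>\<epsilon>\<close>.\<close>
  define \<delta> where "\<delta> = min \<epsilon> (1 / 2)"
  define N where "N = nat \<lceil>64 * (real m * real m / (\<delta> * \<delta>))\<rceil>"
  define F where "F = 48 * m ^ 3 * N"
  define T where "T = 52 * m * m + 150 * m + 6 * N + m * F * (24 * n + 210) + 130"
  define L where "L = (pass fs ^^ length fs) []"
  have L: "topo fs L" "length L = m" "set L = {..<m}" using passes_all[OF ac] len by (simp_all add: L_def)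
  define chain where "chain = map (\<lambda>e. (fst (fs ! e), snd (fs ! e), 1 - q (es ! e))) L"
  define \<sigma> where "\<sigma> = input_state G num es q s t \<epsilon>"
  let ?M = "iterate_pmf m (sweep N F (num s) chain) (start_wt (num s), [])"
  have "imem \<sigma> = layout fs n [] (\<lambda>_. 0)"
  proof
    fix a
    have "a div 2 < length es" if "a < 2 * length es" using that by simp
    then show "imem \<sigma> a = layout fs n [] (\<lambda>_. 0) a"
      by (auto simp: \<sigma>_def input_state_def layout_def fs_def Let_def)
  qed
  then have "refines (52 * length fs * length fs + 150 * length fs + 6 * N + length fs * F * (24 * n +
      210) + 130)
      reliability_prog \<sigma> (iterate_pmf (length fs) (sweep N F (num s) chain) (start_wt (num s), []))
      (\<lambda>x \<sigma>'. rreg \<sigma>' 0 = fst x (num t))"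
    unfolding chain_def L_def
    by (intro reliability_prog_spec[OF ac _ _ _ _ _ _ _ \<delta>_def])
      (use num st V fs in \<open>auto simp: \<sigma>_def input_state_def len n_def m_def N_def F_def fun_eq_iff\<close>)
  then have ref: "refines T reliability_prog \<sigma> ?M (\<lambda>x \<sigma>'. rreg \<sigma>' 0 = fst x (num t))"
    by (simp add: len T_def)
  \<comment> \<open>The arcs of \<open>G\<close> in the order found for their numbered copies
    \<open>fs\<close>; in this form \<open>reliability_eq_hit\<close> applies.\<close>
  define ds where "ds = map ((!) es) L"
  have "distinct ds" using L es(1) by (auto simp: ds_def distinct_map topo_def m_def inj_on_def
      nth_eq_iff_index_eq)
  moreover have "set ds = parcs G" unfolding es(2)[symmetric] using L by (auto simp: ds_def m_def
      set_conv_nth[of es])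
  moreover have "e \<in> set (take i ds)" if i: "i < length ds" and e: "e \<in> set ds" "snd e = fst (ds ! i)" for
      i e
  proof -
    obtain j where j: "j < m" "e = es ! j" using e(1) L by (auto simp: ds_def)
    have Li: "L ! i < m" using i L nth_mem[of i L] by (simp add: ds_def)
    have "snd (fs ! j) = fst (fs ! (L ! i))" using e(2) i j Li by (simp add: fs ds_def)
    then have "j \<in> set (take i L)" using L(1) i j len unfolding topo_def by (auto simp: ds_def)
    then show ?thesis by (auto simp: ds_def j take_map)
  qed
  ultimately have "hit (num t) (map (\<lambda>e. (num (fst e), num (snd e), 1 - q e)) ds) {num s} = reliability G
      q s t"
    using reliability_eq_hit[OF dag st _ inj] q by blast
  moreover have "map (\<lambda>e. (num (fst e), num (snd e), 1 - q e)) ds = chain"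
    using L fs by (auto simp: ds_def chain_def)
  ultimately have hit: "hit (num t) chain {num s} = reliability G q s t" by simp
  have ok: "list_all arc_ok chain"
  proof -
    have "num (fst (es ! e)) \<noteq> num (snd (es ! e))" "0 \<le> q (es ! e) \<and> q (es ! e) \<le> 1" if "e < m" for e
    proof -
      have mem: "es ! e \<in> parcs G" using that nth_mem[of e es] by (simp add: es(2) m_def)
      then show "0 \<le> q (es ! e) \<and> q (es ! e) \<le> 1" using q by auto
      have "fst (es ! e) \<noteq> snd (es ! e)"
      proof
        assume "fst (es ! e) = snd (es ! e)"
        then have "(fst (es ! e), fst (es ! e)) \<in> parcs G" using mem by (metis prod.collapse)
        then show False using acG unfolding acyclic_def by blast
      qed
      then show "num (fst (es ! e)) \<noteq> num (snd (es ! e))" using inj V[OF that] by (auto dest: inj_onD)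
    qed
    then show ?thesis using L fs by (auto simp: chain_def list_all_iff)
  qed
  have m_chain: "m = length chain" by (simp add: chain_def L)
  have \<delta>: "0 < \<delta>" "\<delta> \<le> 1 / 2" "\<delta> \<le> \<epsilon>" using \<epsilon> by (auto simp: \<delta>_def)
  have N: "64 * real m ^ 2 / \<delta>\<^sup>2 \<le> N"
    unfolding N_def using of_nat_ceiling[of "64 * (real m * real m / (\<delta> * \<delta>))"] by (simp add:
        power2_eq_square)
  have "good (num s) \<delta> chain 0 (start_wt (num s), [])"
    using \<delta> by (auto simp: good_def accurate_def approximates_def start_wt_def)
  then have "1 - m * (1 / (4 * real m)) \<le> measure_pmf.prob ?M {y. good (num s) \<delta> chain m y}"
    using N \<delta> by (intro sweep_good[OF ok m_chain]) (auto simp: F_def)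
  \<comment> \<open>For \<open>m = 0\<close> the quotient is 0, and no phase can fail.\<close>
  moreover have "3 / 4 \<le> 1 - m * (1 / (4 * real m))" by (cases "m = 0") auto
  ultimately have "3 / 4 \<le> measure_pmf.prob ?M {y. good (num s) \<delta> chain m y}" by linarith
  also have "\<dots> \<le> measure_pmf.prob (result T reliability_prog \<sigma>)
      {\<sigma>'. \<exists>y\<in>{y. good (num s) \<delta> chain m y}. rreg \<sigma>' 0 = fst y (num t)}"
    using ref unfolding refines_def by (intro rel_pmf_measureD) simp
  also have "\<dots> \<le> measure_pmf.prob (result T reliability_prog \<sigma>) {\<sigma>'. approximates \<epsilon> (reliability G q s t)
      (rreg \<sigma>' 0)}"
  proof (intro measure_pmf.finite_measure_mono subsetI)
    fix \<sigma>' assume "\<sigma>' \<in> {\<sigma>'. \<exists>y\<in>{y. good (num s) \<delta> chain m y}. rreg \<sigma>' 0 = fst y (num t)}"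
    then obtain K xs where g: "good (num s) \<delta> chain m (K, xs)" and K: "rreg \<sigma>' 0 = K (num t)" by auto
    have "map stage_arc xs = take m chain" using g by (simp add: good_def)
    then have "length xs = m" using m_chain by (metis length_map length_take min.idem)
    then have "accurate (num s) \<delta> chain K" using g m_chain by (auto simp: good_def)
    then have "approximates \<delta> (reliability G q s t) (K (num t))" by (simp add: accurate_def flip: hit)
    moreover have "0 \<le> reliability G q s t" by (simp add: reliability_def)
    ultimately have "approximates \<epsilon> (reliability G q s t) (K (num t))"
      using \<delta>(3) unfolding approximates_def
      by (meson add_left_mono diff_left_mono mult_right_mono order_trans)
    then show "\<sigma>' \<in> {\<sigma>'. approximates \<epsilon> (reliability G q s t) (rreg \<sigma>' 0)}" using K by simp
  qed simp
  also have "\<dots> = measure_pmf.prob (output_pmf T reliability_prog \<sigma>) {r. approximates \<epsilon> (reliability G q s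
      t) r}"
  proof -
    have "output_pmf T reliability_prog \<sigma> = map_pmf (\<lambda>\<sigma>'. rreg \<sigma>' 0) (result T reliability_prog \<sigma>)"
      by (simp add: output_pmf_def result_def pmf.map_comp o_def case_prod_unfold)
    then show ?thesis by (simp add: vimage_def)
  qed
  finally have "3 / 4 \<le> measure_pmf.prob (output_pmf T reliability_prog \<sigma>) {r. approximates \<epsilon> (reliability
      G q s t) r}" .
  moreover have "halts_within T reliability_prog \<sigma>" using ref by (simp add: refines_def)
  moreover have "real T \<le> time_bound 3000000 0 n m \<epsilon>"
    unfolding T_def using n1 \<epsilon> \<delta>_def N_def F_def by (rule time_estimate)
  ultimately show "\<exists>T. real T \<le> time_bound 3000000 0 (card (pverts G)) (card (parcs G)) \<epsilon> \<and>
      halts_within T reliability_prog (input_state G num es q s t \<epsilon>) \<and>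
      3 / 4 \<le> measure_pmf.prob (output_pmf T reliability_prog (input_state G num es q s t \<epsilon>))
        {r. approximates \<epsilon> (reliability G q s t) r}"
    unfolding m n_def \<sigma>_def by blast
qed

end
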